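(* Let $G$ be an Artemis graph. If $T\subseteq V(G)$ is an interesting set of $G$, then $C(T)$ contains a special even pair of $G$; that is, there are two vertices $a,b\in C(T)$ such that $\{a,b\}$ is a special even pair of $G$.
   Context: Graphs are finite, simple, undirected. "$G$ contains $H$" means that $H$ is isomorphic to an induced subgraph of $G$. A path of $G$ is an induced subgraph of $G$ that is a chordless path (possibly a single vertex); its length is its number of edges. A hole is a chordless cycle with at least 4 vertices; an antihole is the complement of a hole; a hole or antihole is long if it has at least 5 vertices; a hole is odd if it has an odd number of edges. A prism is a graph whose vertex set is partitioned into three sets inducing paths $P_1,P_2,P_3$, each of length at least 1, $P_i$ having ends $a_i,b_i$, such that $\{a_1,a_2,a_3\}$ and $\{b_1,b_2,b_3\}$ are triangles and there are no edges between different $P_i$'s other than those of these two triangles. An Artemis graph is a graph that contains no odd hole, no long antihole and no prism. An even pair of $G$ is a pair $\{x,y\}$ of vertices such that every path of $G$ joining $x$ to $y$ has even length. A quasi-prism with ends $a,b$ is a graph $S$ whose vertex set is partitioned into four sets inducing paths $S_1$ from $a$ to $a'$, $S_2$ from $b$ to $b'$, $S_3$ from $c$ to $c'$, $S_4$ from $d$ to $d'$, where $S_1,S_2$ may have length 0 but $S_3,S_4$ have length at least 1, and with $E(S)=E(S_1)\cup E(S_2)\cup E(S_3)\cup E(S_4)\cup\{a'c,a'd,cd,b'c',b'd',c'd'\}$. It is strict if at least one of $S_1,S_2$ has length at least 1. An even pair $\{a,b\}$ of $G$ is special if $G$ contains no strict quasi-prism with ends $a$ and $b$ (as an induced subgraph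 of $G$, with the vertices $a,b$ as its ends). For $T\subseteq V(G)$, $C(T)$ is the set of vertices of $V(G)\setminus T$ adjacent to every vertex of $T$. A graph is anticonnected if its complement is connected. A nonempty set $T\subseteq V(G)$ is interesting if $G[T]$ is anticonnected and $C(T)$ does not induce a clique (the empty graph and the one-vertex graph are cliques). *)

theory Defs
  imports Main
begin

record 'a ugraph =
  verts :: "'a set"
  edges :: "'a set set"

definition simple_graph :: "'a ugraph \<Rightarrow> bool" where
  "simple_graph G \<longleftrightarrow>
     finite (verts G) \<and> edges G \<subseteq> {e. e \<subseteq> verts G \<and> card e = 2}"

definition induced :: "'a ugraph \<Rightarrow> 'a set \<Rightarrow> 'a ugraph" where
  "induced G X = \<lparr>verts = X, edges = {e \<in> edges G. e \<subseteq> X}\<rparr>"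

definition complement :: "'a ugraph \<Rightarrow> 'a ugraph" where
  "complement G =
     \<lparr>verts = verts G, edges = {e. e \<subseteq> verts G \<and> card e = 2} - edges G\<rparr>"

definition isomorphic :: "'a ugraph \<Rightarrow> 'b ugraph \<Rightarrow> bool" where
  "isomorphic H K \<longleftrightarrow>
     (\<exists>f. bij_betw f (verts H) (verts K) \<and> edges K = (\<lambda>e. f ` e) ` edges H)"

definition contains :: "'a ugraph \<Rightarrow> 'b ugraph \<Rightarrow> bool" where
  "contains G H \<longleftrightarrow> (\<exists>S \<subseteq> verts G. isomorphic H (induced G S))"

definition connected_graph :: "'a ugraph \<Rightarrow> bool" where
  "connected_graph G \<longleftrightarrow>
     (\<forall>u \<in> verts G. \<forall>v \<in> verts G. (\<lambda>x y. {x, y} \<in> edges G)\<^sup>*\<^sup>* u v)"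

definition anticonnected :: "'a ugraph \<Rightarrow> bool" where
  "anticonnected G \<longleftrightarrow> connected_graph (complement G)"

definition clique :: "'a ugraph \<Rightarrow> bool" where
  "clique G \<longleftrightarrow> (\<forall>u \<in> verts G. \<forall>v \<in> verts G. u \<noteq> v \<longrightarrow> {u, v} \<in> edges G)"

text \<open>Paths and cycles are given by the list of their vertices in order; the
  graph has no edges besides those of consecutive vertices.\<close>

definition path_graph :: "'a list \<Rightarrow> 'a ugraph \<Rightarrow> bool" where
  "path_graph p H \<longleftrightarrow> p \<noteq> [] \<and> distinct p \<and> verts H = set p \<and>
     edges H = {{p ! i, p ! Suc i} | i. Suc i < length p}"

definition cycle_graph :: "'a list \<Rightarrow> 'a ugraph \<Rightarrow> bool" where
  "cycle_graph p H \<longleftrightarrow> length p \<ge> 3 \<and> distinct p \<and> verts H = set p \<and>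
     edges H = {{p ! i, p ! (Suc i mod length p)} | i. i < length p}"

definition is_path :: "'a ugraph \<Rightarrow> 'a list \<Rightarrow> bool" where
  "is_path G p \<longleftrightarrow> set p \<subseteq> verts G \<and> path_graph p (induced G (set p))"

text \<open>The number of edges of a path; only used for nonempty lists.\<close>

definition path_length :: "'a list \<Rightarrow> nat" where
  "path_length p = length p - 1"

definition hole :: "'a ugraph \<Rightarrow> bool" where
  "hole H \<longleftrightarrow> card (verts H) \<ge> 4 \<and> (\<exists>p. cycle_graph p H)"

definition odd_hole :: "'a ugraph \<Rightarrow> bool" where
  "odd_hole H \<longleftrightarrow> hole H \<and> odd (card (edges H))"

definition antihole :: "'a ugraph \<Rightarrow> bool" where
  "antihole H \<longleftrightarrow> (\<exists>K. hole K \<and> H = complement K)"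

definition long_antihole :: "'a ugraph \<Rightarrow> bool" where
  "long_antihole H \<longleftrightarrow> antihole H \<and> card (verts H) \<ge> 5"

definition prism :: "'a ugraph \<Rightarrow> bool" where
  "prism H \<longleftrightarrow> (\<exists>p1 p2 p3.
     is_path H p1 \<and> is_path H p2 \<and> is_path H p3 \<and>
     path_length p1 \<ge> 1 \<and> path_length p2 \<ge> 1 \<and> path_length p3 \<ge> 1 \<and>
     verts H = set p1 \<union> set p2 \<union> set p3 \<and>
     set p1 \<inter> set p2 = {} \<and> set p1 \<inter> set p3 = {} \<and> set p2 \<inter> set p3 = {} \<and>
     edges H =
       edges (induced H (set p1)) \<union> edges (induced H (set p2)) \<union> edges (induced H (set p3)) \<union>
       {{hd p1, hd p2}, {hd p1, hd p3}, {hd p2, hd p3}} \<union>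
       {{last p1, last p2}, {last p1, last p3}, {last p2, last p3}})"

definition artemis :: "'a ugraph \<Rightarrow> bool" where
  "artemis G \<longleftrightarrow> \<not> (\<exists>H :: 'a ugraph. (odd_hole H \<or> long_antihole H \<or> prism H) \<and> contains G H)"

definition even_pair :: "'a ugraph \<Rightarrow> 'a \<Rightarrow> 'a \<Rightarrow> bool" where
  "even_pair G x y \<longleftrightarrow> x \<in> verts G \<and> y \<in> verts G \<and> x \<noteq> y \<and>
     (\<forall>p. is_path G p \<and> hd p = x \<and> last p = y \<longrightarrow> even (path_length p))"

text \<open>The lists \<open>s1\<close>, \<open>s2\<close>, \<open>s3\<close>, \<open>s4\<close> run from \<open>a\<close> to \<open>a'\<close>, from \<open>b\<close> to \<open>b'\<close>,
  from \<open>c\<close> to \<open>c'\<close> and from \<open>d\<close> to \<open>d'\<close> respectively.\<close>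

definition quasi_prism ::
  "'a ugraph \<Rightarrow> 'a list \<Rightarrow> 'a list \<Rightarrow> 'a list \<Rightarrow> 'a list \<Rightarrow> bool" where
  "quasi_prism H s1 s2 s3 s4 \<longleftrightarrow>
     is_path H s1 \<and> is_path H s2 \<and> is_path H s3 \<and> is_path H s4 \<and>
     path_length s3 \<ge> 1 \<and> path_length s4 \<ge> 1 \<and>
     verts H = set s1 \<union> set s2 \<union> set s3 \<union> set s4 \<and>
     set s1 \<inter> set s2 = {} \<and> set s1 \<inter> set s3 = {} \<and> set s1 \<inter> set s4 = {} \<and>
     set s2 \<inter> set s3 = {} \<and> set s2 \<inter> set s4 = {} \<and> set s3 \<inter> set s4 = {} \<and>
     edges H =
       edges (induced H (set s1)) \<union> edges (induced H (set s2)) \<union>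
       edges (induced H (set s3)) \<union> edges (induced H (set s4)) \<union>
       {{last s1, hd s3}, {last s1, hd s4}, {hd s3, hd s4},
        {last s2, last s3}, {last s2, last s4}, {last s3, last s4}}"

definition strict_quasi_prism :: "'a ugraph \<Rightarrow> 'a \<Rightarrow> 'a \<Rightarrow> bool" where
  "strict_quasi_prism H a b \<longleftrightarrow> (\<exists>s1 s2 s3 s4.
     quasi_prism H s1 s2 s3 s4 \<and> hd s1 = a \<and> hd s2 = b \<and>
     (path_length s1 \<ge> 1 \<or> path_length s2 \<ge> 1))"

definition special_even_pair :: "'a ugraph \<Rightarrow> 'a \<Rightarrow> 'a \<Rightarrow> bool" where
  "special_even_pair G a b \<longleftrightarrow> even_pair G a b \<and>
     \<not> (\<exists>S \<subseteq> verts G. strict_quasi_prism (induced G S) a b)"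

definition common_nbrs :: "'a ugraph \<Rightarrow> 'a set \<Rightarrow> 'a set" where
  "common_nbrs G T = {v \<in> verts G - T. \<forall>t \<in> T. {v, t} \<in> edges G}"

definition interesting :: "'a ugraph \<Rightarrow> 'a set \<Rightarrow> bool" where
  "interesting G T \<longleftrightarrow> T \<subseteq> verts G \<and> T \<noteq> {} \<and>
     anticonnected (induced G T) \<and> \<not> clique (induced G (common_nbrs G T))"

end

theory Submission
  imports Defs
begin

text \<open>Choose an anticonnected \<open>X \<supseteq> T\<close> maximal with two nonadjacent common neighbours and put
  \<open>C = C(X)\<close>. By maximality a vertex outside \<open>X \<union> C\<close> has a clique as its neighbourhood in \<open>C\<close>.
  If no chordless path leaves \<open>C\<close> and returns, then a special even pair of \<open>G[C]\<close> is one of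
  \<open>G\<close>, and \<open>G[C]\<close> is either a union of cliques or handled by induction.

  Otherwise let \<open>W\<close> be the interior of a shortest such path, and let \<open>A\<close> and \<open>B\<close> be the sets
  of vertices of \<open>C\<close> that see \<open>W\<close> exactly in its first and exactly in its last vertex; they are
  cliques. Every chordless path with an odd number of edges from \<open>a \<in> A\<close> to \<open>b \<in> B\<close> contains a
  further vertex of \<open>A \<union> B\<close>. Choosing \<open>a \<in> A\<close> whose component towards \<open>B\<close>, after deletion of the
  neighbours of \<open>a\<close>, is minimal, and \<open>b\<close> symmetrically, no chordless path between them (nor a
  quasi-prism) contains such a vertex.

  The engine is a statement on a hole with exactly two vertices complete to an anticonnected
  set \<open>X\<close>, these two being adjacent: no connected set that avoids their neighbours is attached to
  all of \<open>X\<close> and to the rest of the hole. It follows from the Roussel-Rubio lemma, by induction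
  on \<open>X\<close>.\<close>

section \<open>Chordless paths and holes as vertex lists\<close>

text \<open>Every contradiction ends in a hole of the wrong parity, an antihole with at least five
  vertices, or a prism. Parity is tied to the set \<open>T\<close> by the Roussel-Rubio property
  \<open>rr\<close>: a chordless path with an even number of vertices and \<open>T\<close>-complete
  ends has an odd number of edges with both ends \<open>T\<close>-complete. Cut such a path where it
  touches \<open>W\<close>; some stretch still has an odd number of these edges, and closing it
  through \<open>W\<close> gives a hole whose only \<open>T\<close>-complete vertices are two
  consecutive ones. This is what the engine forbids. Its connected set may overlap the rest of the
  hole, which is essential: the part of \<open>W\<close> that closes the stretch also serves as
  attachment.

  The common neighbours attached to \<open>W\<close> outside both sides (\<open>mid\<close>) are
  under control only because \<open>W\<close> is shortest: this makes them complete to both sides,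
  and a chordless path with four or more vertices contains no vertex seeing both its ends. The same
  remark keeps such paths out of \<open>T\<close>. Maximality is used through cliques: a chordless
  path that starts in the clique \<open>A\<close> can meet \<open>A\<close> again only in its second
  vertex.\<close>

primrec cpath :: "('a \<Rightarrow> 'a \<Rightarrow> bool) \<Rightarrow> 'a list \<Rightarrow> bool" where
  "cpath E [] \<longleftrightarrow> True"
| "cpath E (x # q) \<longleftrightarrow> cpath E q \<and> (\<forall>v\<in>set q. x \<noteq> v \<and> (E x v \<longleftrightarrow> v = hd q))"

text \<open>The bound on the tail excludes triangles. Singling out the head costs nothing, by
  \<open>chole_rotate\<close>.\<close>

primrec chole :: "('a \<Rightarrow> 'a \<Rightarrow> bool) \<Rightarrow> 'a list \<Rightarrow> bool" where
  "chole E [] \<longleftrightarrow> False"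
| "chole E (x # q) \<longleftrightarrow> length q \<ge> 3 \<and> cpath E q \<and>
     (\<forall>v\<in>set q. x \<noteq> v \<and> (E x v \<longleftrightarrow> v = hd q \<or> v = last q))"

abbreviation non_adj :: "('a \<Rightarrow> 'a \<Rightarrow> bool) \<Rightarrow> 'a \<Rightarrow> 'a \<Rightarrow> bool" where
  "non_adj E \<equiv> (\<lambda>u v. u \<noteq> v \<and> \<not> E u v)"

text \<open>Connectedness is phrased by cuts, which makes unions easy to handle.\<close>

definition conn :: "('a \<Rightarrow> 'a \<Rightarrow> bool) \<Rightarrow> 'a set \<Rightarrow> bool" where
  "conn E S \<longleftrightarrow> (\<forall>Y\<subseteq>S. Y \<noteq> {} \<and> Y \<noteq> S \<longrightarrow> (\<exists>y\<in>Y. \<exists>z\<in>S - Y. E y z))"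

text \<open>The lists of a prism run in parallel: the heads form one triangle and the last vertices
  the other. A path met in the opposite direction has to be reversed first.\<close>

definition cross :: "('a \<Rightarrow> 'a \<Rightarrow> bool) \<Rightarrow> 'a list \<Rightarrow> 'a list \<Rightarrow> bool" where
  "cross E p q \<longleftrightarrow> (\<forall>u\<in>set p. \<forall>v\<in>set q. u \<noteq> v \<and>
     (E u v \<longleftrightarrow> u = hd p \<and> v = hd q \<or> u = last p \<and> v = last q))"

definition prism_lists :: "('a \<Rightarrow> 'a \<Rightarrow> bool) \<Rightarrow> 'a list \<Rightarrow> 'a list \<Rightarrow> 'a list \<Rightarrow> bool" where
  "prism_lists E p q r \<longleftrightarrow> cpath E p \<and> cpath E q \<and> cpath E r \<and>
     2 \<le> length p \<and> 2 \<le> length q \<and> 2 \<le> length r \<and>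
     cross E p q \<and> cross E p r \<and> cross E q r"

text \<open>With completeness to a set as the mark, this counts the complete edges of a path, the
  quantity behind all uses of the Roussel-Rubio lemma.\<close>

primrec ecount :: "('a \<Rightarrow> bool) \<Rightarrow> 'a list \<Rightarrow> nat" where
  "ecount L [] = 0"
| "ecount L (x # q) = (if q \<noteq> [] \<and> L x \<and> L (hd q) then 1 else 0) + ecount L q"

lemma cpath_append:
  "cpath E (p @ q) \<longleftrightarrow> cpath E p \<and> cpath E q \<and>
     (\<forall>u\<in>set p. \<forall>v\<in>set q. u \<noteq> v \<and> (E u v \<longleftrightarrow> u = last p \<and> v = hd q))"
proof (induction p)
  case Nil
  then show ?case by simp
next
  case (Cons x p)
  show ?case
  proof (cases "p = []")
    case True
    then show ?thesis using Cons by auto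
  next
    case False
    then have "last p \<in> set p" "hd p \<in> set p" by auto
    with False Cons show ?thesis by (auto simp: hd_append)
  qed
qed

lemma cpath_appendI:
  assumes "cpath E p" "cpath E q"
    and "\<And>u v. u \<in> set p \<Longrightarrow> v \<in> set q \<Longrightarrow> u \<noteq> v \<and> (E u v \<longleftrightarrow> u = last p \<and> v = hd q)"
  shows "cpath E (p @ q)"
  unfolding cpath_append using assms by simp

lemma cpath_ConsI:
  assumes "cpath E q" and "\<And>v. v \<in> set q \<Longrightarrow> x \<noteq> v \<and> (E x v \<longleftrightarrow> v = hd q)"
  shows "cpath E (x # q)"
  unfolding cpath.simps using assms by simp

lemma choleI:
  assumes "cpath E q" "3 \<le> length q" and "\<And>v. v \<in> set q \<Longrightarrow> x \<noteq> v \<and> (E x v \<longleftrightarrow> v = hd q \<or> v = last q)"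
  shows "chole E (x # q)"
  unfolding chole.simps using assms by simp

lemma cpath_infix: "cpath E (xs @ p @ ys) \<Longrightarrow> cpath E p"
  by (simp only: cpath_append)

lemma cpath_distinct: "cpath E p \<Longrightarrow> distinct p"
  by (induction p) auto

lemma cpath_rev:
  assumes sym: "symp E"
  shows "cpath E (rev p) \<longleftrightarrow> cpath E p"
proof (induction p)
  case (Cons x p)
  have s: "E u v \<longleftrightarrow> E v u" for u v using sym by (blast dest: sympD)
  show ?case using Cons by (auto simp: cpath_append last_rev s[of x])
qed simp

lemma cpath_nth:
  assumes "cpath E p" "i < j" "j < length p"
  shows "E (p ! i) (p ! j) \<longleftrightarrow> j = Suc i"
  using assms
proof (induction p arbitrary: i j)
  case Nil
  then show ?case by simp
next
  case (Cons x q)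
  obtain j' where j: "j = Suc j'" "j' < length q" using Cons.prems by (cases j) auto
  show ?case
  proof (cases i)
    case 0
    have "distinct q" using Cons.prems(1) cpath_distinct by auto
    moreover have "hd q = q ! 0" using j by (cases q) auto
    ultimately have "q ! j' = hd q \<longleftrightarrow> j' = 0" using j nth_eq_iff_index_eq[of q j' 0] by (cases q) auto
    then show ?thesis using Cons.prems(1) j 0 by auto
  next
    case (Suc i')
    then show ?thesis using Cons j by auto
  qed
qed

lemma cpathI_nth:
  assumes "distinct p" "\<And>i j. i < j \<Longrightarrow> j < length p \<Longrightarrow> E (p ! i) (p ! j) \<longleftrightarrow> j = Suc i"
  shows "cpath E p"
  using assms
proof (induction p)
  case Nil
  then show ?case by simp
next
  case (Cons x q)
  have 1: "cpath E q"
  proof (rule Cons.IH)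
    show "distinct q" using Cons.prems by simp
    show "E (q ! i) (q ! j) = (j = Suc i)" if "i < j" "j < length q" for i j
      using Cons.prems(2)[of "Suc i" "Suc j"] that by simp
  qed
  have "x \<noteq> v \<and> (E x v \<longleftrightarrow> v = hd q)" if vq: "v \<in> set q" for v
  proof -
    obtain j where j: "j < length q" "v = q ! j" using vq unfolding in_set_conv_nth by blast
    have "q \<noteq> []" using that by auto
    then have h: "hd q = q ! 0" "0 < length q" by (simp_all add: hd_conv_nth)
    have "distinct q" "x \<notin> set q" using Cons.prems(1) by simp_all
    then have "v = hd q \<longleftrightarrow> j = 0" unfolding h(1) j(2) using nth_eq_iff_index_eq[of q j 0] j(1) h(2) by simp
    moreover have "E x v \<longleftrightarrow> j = 0" using Cons.prems(2)[of 0 "Suc j"] j by simp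
    ultimately show ?thesis using that \<open>x \<notin> set q\<close> by blast
  qed
  with 1 show ?case by simp
qed

lemma cpath_cong:
  "(\<And>u v. u \<in> set p \<Longrightarrow> v \<in> set p \<Longrightarrow> E u v \<longleftrightarrow> F u v) \<Longrightarrow> cpath E p \<longleftrightarrow> cpath F p"
  by (induction p) auto

lemma chole_rotate1:
  assumes sym: "symp E" and h: "chole E (x # q)"
  shows "chole E (q @ [x])"
proof -
  have s: "E u v \<longleftrightarrow> E v u" for u v using sym by (blast dest: sympD)
  from h obtain y r where q: "q = y # r" "r \<noteq> []" by (cases q; cases "tl q") auto
  have l: "last r \<in> set r" "hd r \<in> set r" using q(2) by auto
  show ?thesis using h l q s[of x] by (auto simp: cpath_append hd_append)
qed

lemma chole_rotate:
  assumes sym: "symp E" and h: "chole E (p @ q)"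
  shows "chole E (q @ p)"
  using h
proof (induction p arbitrary: q)
  case (Cons x p)
  then have "chole E ((p @ q) @ [x])" using chole_rotate1[OF sym, of x "p @ q"] by (simp del: chole.simps)
  then show ?case using Cons.IH[of "q @ [x]"] by simp
qed simp

lemma chole_cpath: "chole E (p @ q) \<Longrightarrow> p \<noteq> [] \<Longrightarrow> cpath E q"
  by (cases p) (auto simp: cpath_append)

lemma chole_distinct: "chole E p \<Longrightarrow> distinct p"
  by (cases p) (auto dest: cpath_distinct)

section \<open>Counting edges with both ends marked\<close>

lemma ecount_append: "ecount L (p @ q) = ecount L p + ecount L q +
   (if p \<noteq> [] \<and> q \<noteq> [] \<and> L (last p) \<and> L (hd q) then 1 else 0)"
  by (induction p) (auto simp: hd_append)

lemma ecount_none: "\<forall>v\<in>set p. \<not> L v \<Longrightarrow> ecount L p = 0"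
  by (induction p) auto

text \<open>A gap of odd length advances by an even number of positions and adds nothing to
  \<open>ecount\<close>; an empty gap advances by one position and adds one. So
  \<open>length p - 1\<close> and \<open>ecount L p\<close> have the same parity.\<close>

lemma segment_parity:
  assumes "p \<noteq> []" "L (hd p)" "L (last p)"
    and "\<And>xs u ys v zs. p = xs @ u # ys @ v # zs \<Longrightarrow> L u \<Longrightarrow> L v \<Longrightarrow> \<forall>y\<in>set ys. \<not> L y \<Longrightarrow> ys = [] \<or> odd (length ys)"
  shows "odd (length p + ecount L p)"
  using assms
proof (induction "length p" arbitrary: p rule: less_induct)
  case less
  obtain u q where p: "p = u # q" using less.prems(1) by (cases p) auto
  show ?case
  proof (cases "q = []")
    case True
    then show ?thesis using p by simp
  next
    case False
    then have "\<exists>v\<in>set q. L v" using less.prems(3) p by auto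
    then obtain ys v zs where q: "q = ys @ v # zs" "L v" "\<forall>y\<in>set ys. \<not> L y"
      by (metis split_list_first_prop)
    have Lu: "L u" using less.prems(2) p by simp
    have ys: "ys = [] \<or> odd (length ys)"
      using less.prems(4)[of "[]" u ys v zs] p q Lu by auto
    have "odd (length (v # zs) + ecount L (v # zs))"
    proof (rule less.hyps)
      show "length (v # zs) < length p" using p q by simp
      show "L (last (v # zs))" using less.prems(3) p q by simp
      show "ys' = [] \<or> odd (length ys')"
        if "v # zs = xs @ u' # ys' @ v' # zs'" "L u'" "L v'" "\<forall>y\<in>set ys'. \<not> L y" for xs u' ys' v' zs'
        using less.prems(4)[of "u # ys @ xs" u' ys' v' zs'] that p q by simp
    qed (use q in auto)
    then show ?thesis using ys p q Lu by (auto simp: ecount_append ecount_none hd_append)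
  qed
qed

text \<open>The \<open>M\<close>-vertices cut \<open>p\<close> into stretches that share only end
  vertices, so their edge counts add up, and an odd sum has an odd summand.\<close>

lemma odd_segment:
  assumes "p \<noteq> []" "M (hd p)" "M (last p)" "odd (ecount L p)"
  shows "\<exists>xs u ys v zs. p = xs @ u # ys @ v # zs \<and> M u \<and> M v \<and> (\<forall>y\<in>set ys. \<not> M y) \<and>
           odd (ecount L (u # ys @ [v]))"
  using assms
proof (induction "length p" arbitrary: p rule: less_induct)
  case less
  obtain u q where p: "p = u # q" using less.prems(1) by (cases p) auto
  have "q \<noteq> []" using less.prems(4) p by auto
  then have "\<exists>v\<in>set q. M v" using less.prems(3) p by auto
  then obtain ys v zs where q: "q = ys @ v # zs" "M v" "\<forall>y\<in>set ys. \<not> M y"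
    by (metis split_list_first_prop)
  show ?case
  proof (cases "odd (ecount L (u # ys @ [v]))")
    case True
    then show ?thesis using p q less.prems(2)
      by (intro exI[of _ "[]"] exI[of _ u] exI[of _ ys] exI[of _ v] exI[of _ zs]) (simp del: ecount.simps)
  next
    case False
    have "ecount L p = ecount L (u # ys @ [v]) + ecount L (v # zs)"
      using p q by (auto simp: ecount_append hd_append)
    then have "odd (ecount L (v # zs))" using False less.prems(4) by auto
    then obtain xs u' ys' v' zs' where "v # zs = xs @ u' # ys' @ v' # zs'" "M u'" "M v'"
       "\<forall>y\<in>set ys'. \<not> M y" "odd (ecount L (u' # ys' @ [v']))"
      using less.hyps[of "v # zs"] p q less.prems(3) by (auto simp del: ecount.simps)
    then show ?thesis using p q
      by (intro exI[of _ "u # ys @ xs"] exI[of _ u'] exI[of _ ys'] exI[of _ v'] exI[of _ zs']) (simp del: ecount.simps)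
  qed
qed

text \<open>Cutting off unmarked ends loses no marked edge and makes \<open>segment_parity\<close>
  applicable.\<close>

lemma trim_marked:
  assumes "\<exists>v\<in>set p. L v"
  shows "\<exists>xs mid zs. p = xs @ mid @ zs \<and> mid \<noteq> [] \<and> L (hd mid) \<and> L (last mid) \<and>
     (\<forall>v\<in>set xs \<union> set zs. \<not> L v) \<and> ecount L mid = ecount L p"
proof -
  obtain xs u q where p: "p = xs @ u # q" "L u" "\<forall>v\<in>set xs. \<not> L v"
    using assms by (metis split_list_first_prop)
  have "\<exists>v\<in>set (u # q). L v" using p by auto
  then obtain ms v zs where q: "u # q = ms @ v # zs" "L v" "\<forall>v\<in>set zs. \<not> L v"
    by (metis split_list_last_prop)
  have "p = xs @ (ms @ [v]) @ zs" using p q by simp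
  moreover have "L (hd (ms @ [v]))" using q p by (cases ms) auto
  moreover have "ecount L (xs @ (ms @ [v]) @ zs) = ecount L (ms @ [v])"
    using p(3) q(3) by (auto simp: ecount_append ecount_none hd_append)
  ultimately show ?thesis using p q
    by (intro exI[of _ xs] exI[of _ "ms @ [v]"] exI[of _ zs]) auto
qed

section \<open>Connected sets\<close>

lemma conn_Un:
  assumes "conn E S" "conn E R" "S \<inter> R \<noteq> {}"
  shows "conn E (S \<union> R)"
  unfolding conn_def
proof (intro allI impI)
  fix Y assume Y: "Y \<subseteq> S \<union> R" "Y \<noteq> {} \<and> Y \<noteq> S \<union> R"
  consider "Y \<inter> S \<noteq> {}" "Y \<inter> S \<noteq> S" | "Y \<inter> R \<noteq> {}" "Y \<inter> R \<noteq> R"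
    using Y assms(3) by blast
  then show "\<exists>y\<in>Y. \<exists>z\<in>S \<union> R - Y. E y z"
  proof cases
    case 1
    then obtain y z where "y\<in>Y \<inter> S" "z\<in>S - (Y \<inter> S)" "E y z"
      using assms(1) unfolding conn_def by (meson inf_le2)
    then show ?thesis by blast
  next
    case 2
    then obtain y z where "y\<in>Y \<inter> R" "z\<in>R - (Y \<inter> R)" "E y z"
      using assms(2) unfolding conn_def by (meson inf_le2)
    then show ?thesis by blast
  qed
qed

lemma conn_single: "conn E {x}"
  unfolding conn_def by (metis subset_singletonD)

lemma conn_edge: 
  assumes "E x y" "E y x" shows "conn E {x, y}"
  unfolding conn_def
proof (intro allI impI)
  fix Y assume Y: "Y \<subseteq> {x, y}" "Y \<noteq> {} \<and> Y \<noteq> {x, y}"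
  then have "Y = {x} \<and> y \<noteq> x \<or> Y = {y} \<and> y \<noteq> x" by (cases "x \<in> Y"; cases "y \<in> Y") auto
  then show "\<exists>y'\<in>Y. \<exists>z\<in>{x, y} - Y. E y' z" using assms by auto
qed

lemma conn_Un_edge:
  assumes "conn E S" "conn E R" "x \<in> S" "y \<in> R" "E x y" "E y x"
  shows "conn E (S \<union> R)"
proof -
  have "conn E (S \<union> {x, y})" using conn_Un[of E S "{x, y}"] conn_edge[of E x y] assms by auto
  then have "conn E ((S \<union> {x, y}) \<union> R)" using conn_Un[of E "S \<union> {x, y}" R] assms by auto
  moreover have "(S \<union> {x, y}) \<union> R = S \<union> R" using assms by auto
  ultimately show ?thesis by simp
qed

lemma conn_insert:
  assumes "conn E S" "y \<in> S" "E x y" "E y x"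
  shows "conn E (insert x S)"
  using conn_Un_edge[OF conn_single assms(1), of x x y] assms by auto

text \<open>Applied to all connected subsets of a set that contain \<open>b\<close>, this yields the
  component of \<open>b\<close> in that set.\<close>

lemma conn_Union:
  assumes "\<And>S. S \<in> F \<Longrightarrow> conn E S \<and> b \<in> S"
  shows "conn E (\<Union>F)"
  unfolding conn_def
proof (intro allI impI)
  fix Y assume Y: "Y \<subseteq> \<Union>F" "Y \<noteq> {} \<and> Y \<noteq> \<Union>F"
  have "\<exists>S\<in>F. Y \<inter> S \<noteq> {} \<and> Y \<inter> S \<noteq> S"
  proof (cases "b \<in> Y")
    case True
    obtain z S where "z \<notin> Y" "z \<in> S" "S \<in> F" using Y by blast
    then show ?thesis using True assms by blast
  next
    case False
    obtain z S where "z \<in> Y" "z \<in> S" "S \<in> F" using Y by blast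
    then show ?thesis using False assms by blast
  qed
  then obtain S where S: "S \<in> F" "Y \<inter> S \<noteq> {}" "Y \<inter> S \<noteq> S" by blast
  then obtain y z where "y\<in>Y \<inter> S" "z\<in>S - (Y \<inter> S)" "E y z"
    using assms[OF S(1)] unfolding conn_def by (meson inf_le2)
  then show "\<exists>y\<in>Y. \<exists>z\<in>\<Union>F - Y. E y z" using S by blast
qed

lemma conn_cpath:
  assumes sym: "symp E" and "cpath E p"
  shows "conn E (set p)"
  using assms(2)
proof (induction p)
  case Nil
  then show ?case by (simp add: conn_def)
next
  case (Cons x q)
  show ?case
  proof (cases "q = []")
    case True
    then show ?thesis by (simp add: conn_single)
  next
    case False
    then have "E x (hd q)" "hd q \<in> set q" using Cons.prems by auto
    then show ?thesis using conn_insert[of E "set q" "hd q" x] Cons sympD[OF sym, of x "hd q"] by simp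
  qed
qed

text \<open>A new vertex \<open>w\<close> is appended to the first vertex of the path that sees it,
  which keeps the result chordless.\<close>

lemma cpath_extend:
  assumes "cpath E p" "p \<noteq> []" "E (last p) w" "\<not> E w w"
  shows "\<exists>q. cpath E q \<and> q \<noteq> [] \<and> hd q = hd p \<and> last q = w \<and> set q \<subseteq> insert w (set p)"
proof (cases "w \<in> set p")
  case True
  then obtain xs ys where p: "p = xs @ w # ys" "w \<notin> set xs" by (metis split_list_first)
  have "cpath E (xs @ [w])" using assms(1) p by (auto simp: cpath_append)
  then show ?thesis using p by (intro exI[of _ "xs @ [w]"]) (auto simp: hd_append)
next
  case False
  have "\<exists>x\<in>set p. E x w" using assms(2,3) last_in_set by blast
  then obtain xs x ys where p: "p = xs @ x # ys" "E x w" "\<forall>v\<in>set xs. \<not> E v w"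
    using split_list_first_prop[of p "\<lambda>x. E x w"] by blast
  have "cpath E (xs @ [x, w])" using assms(1) p False by (auto simp: cpath_append)
  then show ?thesis using p by (intro exI[of _ "xs @ [x, w]"]) (auto simp: hd_append)
qed

text \<open>By \<open>cpath_extend\<close> no edge leaves the set \<open>R\<close> of vertices
  reached by chordless paths, so the cut condition forces \<open>R = S\<close>.\<close>

lemma conn_cpath_ex:
  assumes irr: "irreflp E" and "conn E S" "u \<in> S" "v \<in> S"
  shows "\<exists>p. cpath E p \<and> p \<noteq> [] \<and> set p \<subseteq> S \<and> hd p = u \<and> last p = v"
proof -
  define R where "R = {v \<in> S. \<exists>p. cpath E p \<and> p \<noteq> [] \<and> set p \<subseteq> S \<and> hd p = u \<and> last p = v}"
  have "u \<in> R" unfolding R_def using assms(3) by (simp, intro exI[of _ "[u]"], simp)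
  have "R = S"
  proof (rule ccontr)
    assume "R \<noteq> S"
    then obtain y z where yz: "y \<in> R" "z \<in> S - R" "E y z"
      using assms(2) \<open>u \<in> R\<close> unfolding conn_def R_def by (metis (no_types, lifting) empty_iff mem_Collect_eq subsetI)
    then obtain p where p: "cpath E p" "p \<noteq> []" "set p \<subseteq> S" "hd p = u" "last p = y" unfolding R_def by blast
    then have "z \<in> R" using cpath_extend[OF p(1,2), of z] yz p irreflpD[OF irr, of z] unfolding R_def by fastforce
    then show False using yz by simp
  qed
  then show ?thesis using assms(4) unfolding R_def by auto
qed

text \<open>The path is cut at its first \<open>Q\<close>-vertex and then at the last
  \<open>P\<close>-vertex before that. Links of this kind attach only by their ends, so closing them
  produces chordless cycles.\<close>

lemma conn_link:
  assumes irr: "irreflp E" and "conn E S" "u \<in> S" "P u" "v \<in> S" "Q v"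
  shows "\<exists>p. cpath E p \<and> p \<noteq> [] \<and> set p \<subseteq> S \<and> P (hd p) \<and> Q (last p) \<and>
     (\<forall>y\<in>set p. P y \<longrightarrow> y = hd p) \<and> (\<forall>y\<in>set p. Q y \<longrightarrow> y = last p)"
proof -
  obtain p where p: "cpath E p" "p \<noteq> []" "set p \<subseteq> S" "hd p = u" "last p = v"
    using conn_cpath_ex[OF irr assms(2,3,5)] by blast
  have "\<exists>x\<in>set p. Q x" using p(2,5) assms(6) last_in_set by blast
  then obtain xs x ys where x: "p = xs @ x # ys" "Q x" "\<forall>v\<in>set xs. \<not> Q v"
    using split_list_first_prop[of p Q] by blast
  have "hd (xs @ [x]) = u" using p(4) x(1) by (simp add: hd_append split: if_splits)
  then have "\<exists>y\<in>set (xs @ [x]). P y" using assms(4) by (metis append_is_Nil_conv list.set_sel(1) not_Cons_self2)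
  then obtain as y bs where y: "xs @ [x] = as @ y # bs" "P y" "\<forall>v\<in>set bs. \<not> P v"
    using split_list_last_prop[of "xs @ [x]" P] by blast
  have "cpath E (xs @ [x])" using p(1) x by (auto simp: cpath_append)
  then have c: "cpath E (y # bs)" unfolding y by (simp only: cpath_append)
  have sub: "set (y # bs) \<subseteq> set (xs @ [x])" unfolding y by auto
  have l: "last (y # bs) = x" using y(1) by (metis last_appendR last_snoc list.distinct(1))
  have "\<forall>z\<in>set (y # bs). Q z \<longrightarrow> z = x" using sub x by auto
  moreover have "\<forall>z\<in>set (y # bs). P z \<longrightarrow> z = y" using y(3) by simp
  moreover have "set (y # bs) \<subseteq> S" using sub x(1) p(3) by auto
  ultimately show ?thesis using c l x(2) y(2) by (intro exI[of _ "y # bs"]) simp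
qed

text \<open>A maximal connected proper subset of \<open>X\<close> containing \<open>r\<close> misses
  just one vertex: adding a vertex attached to it must already give all of \<open>X\<close>.\<close>

lemma conn_remove:
  assumes "symp E" "finite X" "conn E X" "r \<in> X" "X \<noteq> {r}"
  shows "\<exists>x\<in>X. x \<noteq> r \<and> conn E (X - {x})"
proof -
  let ?P = "\<lambda>Y. r \<in> Y \<and> Y \<subseteq> X \<and> Y \<noteq> X \<and> conn E Y"
  have "finite {Y. ?P Y}" using assms(2) by (auto intro: finite_subset[of _ "Pow X"])
  moreover have "{r} \<in> {Y. ?P Y}" using assms conn_single[of E r] by blast
  ultimately have "\<exists>Y\<in>{Y. ?P Y}. \<forall>Z\<in>{Y. ?P Y}. Y \<subseteq> Z \<longrightarrow> Y = Z"
    by (intro finite_has_maximal) auto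
  then obtain Y where Y0: "Y \<in> {Y. ?P Y}" "\<forall>Z\<in>{Y. ?P Y}. Y \<subseteq> Z \<longrightarrow> Y = Z" ..
  have Y: "?P Y" using Y0(1) by simp
  have max: "Y = Z" if "?P Z" "Y \<subseteq> Z" for Z using Y0(2) that by simp
  obtain y z where yz: "y \<in> Y" "z \<in> X - Y" "E y z"
    using assms(3)[unfolded conn_def, rule_format, of Y] Y by auto
  have "conn E (insert z Y)" using conn_insert[of E Y y z] Y yz sympD[OF assms(1), of y z] by blast
  then have "insert z Y = X" using max[of "insert z Y"] Y yz by blast
  then have "X - {z} = Y" using yz by auto
  then show ?thesis using Y yz by auto
qed

lemma conn_remove2:
  assumes "symp E" "finite X" "conn E X" "X \<noteq> {}" "\<And>x. X \<noteq> {x}"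
  shows "\<exists>x\<in>X. \<exists>y\<in>X. x \<noteq> y \<and> conn E (X - {x}) \<and> conn E (X - {y})"
proof -
  obtain r where "r \<in> X" using assms by auto
  then obtain x where x: "x \<in> X" "conn E (X - {x})" using conn_remove[OF assms(1-3)] assms(5) by metis
  then obtain y where "y \<in> X" "y \<noteq> x" "conn E (X - {y})" using conn_remove[OF assms(1-3)] assms(5) by metis
  with x show ?thesis by blast
qed

section \<open>Artemis graphs and the Roussel-Rubio lemma\<close>

locale artemis_adj =
  fixes E :: "'a \<Rightarrow> 'a \<Rightarrow> bool"
  assumes symE: "symp E" and irrE: "irreflp E"
    and hole_even: "chole E p \<Longrightarrow> even (length p)"
    and no_antihole: "chole (non_adj E) p \<Longrightarrow> length p < 5"
    and no_prism: "\<not> prism_lists E p q r"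
begin

lemma adj_sym: "E u v \<Longrightarrow> E v u"
  using symE by (blast dest: sympD)

lemma adj_comm: "E u v \<longleftrightarrow> E v u"
  using adj_sym by blast

lemma not_self [simp]: "\<not> E u u"
  using irrE by (blast dest: irreflpD)

lemma symp_non_adj: "symp (non_adj E)"
  by (rule sympI) (auto dest: adj_sym)

lemma irreflp_non_adj: "irreflp (non_adj E)"
  by (rule irreflpI) auto

definition complete_to :: "'a \<Rightarrow> 'a set \<Rightarrow> bool" where
  "complete_to v X \<longleftrightarrow> (\<forall>x\<in>X. E v x)"

text \<open>The Roussel-Rubio lemma for Berge graphs has two further outcomes, a leap and a path
  with three edges completed by an antipath; in an Artemis graph they yield a prism and a long
  antihole, so only this one remains. An even number of vertices means an odd number of edges. Being
  a predicate on \<open>S\<close>, it can be passed for smaller sets within an induction.\<close>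

definition rr :: "'a set \<Rightarrow> bool" where
  "rr S \<longleftrightarrow> (\<forall>p. cpath E p \<longrightarrow> 4 \<le> length p \<longrightarrow> even (length p) \<longrightarrow> set p \<inter> S = {} \<longrightarrow>
     complete_to (hd p) S \<longrightarrow> complete_to (last p) S \<longrightarrow>
     (\<exists>v\<in>set p - {hd p, last p}. complete_to v S))"

lemma rr_segment:
  assumes "rr S" "cpath E (u # ys @ [v])" "set (u # ys @ [v]) \<inter> S = {}"
    "complete_to u S" "complete_to v S" "\<forall>y\<in>set ys. \<not> complete_to y S"
  shows "ys = [] \<or> odd (length ys)"
proof (rule ccontr)
  assume "\<not> ?thesis"
  then have e: "even (length ys)" "ys \<noteq> []" by auto
  then have "2 \<le> length ys" by (cases ys; cases "tl ys") auto
  then have "\<exists>w\<in>set (u # ys @ [v]) - {u, v}. complete_to w S"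
    using assms(1)[unfolded rr_def, rule_format, of "u # ys @ [v]"] assms(2-) e by auto
  then show False using assms(6) by auto
qed

text \<open>Only the stretches between consecutive complete vertices have to be chordless, so
  \<open>p\<close> may also run along a hole and have adjacent ends.\<close>

lemma rr_parity:
  assumes "rr S" "p \<noteq> []" "complete_to (hd p) S" "complete_to (last p) S" "set p \<inter> S = {}"
    and "\<And>xs u ys v zs. p = xs @ u # ys @ v # zs \<Longrightarrow> complete_to u S \<Longrightarrow> complete_to v S \<Longrightarrow>
       \<forall>y\<in>set ys. \<not> complete_to y S \<Longrightarrow> cpath E (u # ys @ [v])"
  shows "odd (length p + ecount (\<lambda>v. complete_to v S) p)"
proof (rule segment_parity[OF assms(2-4)])
  fix xs u ys v zs assume *: "p = xs @ u # ys @ v # zs" "complete_to u S" "complete_to v S"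
    "\<forall>y\<in>set ys. \<not> complete_to y S"
  show "ys = [] \<or> odd (length ys)"
    using rr_segment[OF assms(1) assms(6)[OF *]] * assms(5) by auto
qed

lemma rr_parity_path:
  assumes "rr S" "p \<noteq> []" "complete_to (hd p) S" "complete_to (last p) S" "set p \<inter> S = {}" "cpath E p"
  shows "odd (length p + ecount (\<lambda>v. complete_to v S) p)"
proof (rule rr_parity[OF assms(1-5)])
  fix xs u ys v zs assume "p = xs @ u # ys @ v # zs"
  then have "cpath E (xs @ (u # ys @ [v]) @ zs)" using assms(6) by simp
  then show "cpath E (u # ys @ [v])" by (simp only: cpath_append)
qed

text \<open>Trimmed to its outermost complete vertices \<open>u\<close> and \<open>v\<close>, the
  arc \<open>p\<close> has an even number of vertices by \<open>rr_parity\<close>. If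
  \<open>u\<close> and \<open>v\<close> were not consecutive, the complementary arc from
  \<open>v\<close> to \<open>u\<close> would be chordless without complete interior vertices, so its
  interior would be odd by \<open>rr_segment\<close>, and so would the hole.\<close>

lemma hole_odd_complete_edges:
  assumes R: "rr S" and h: "chole E (p @ w)" and w: "w \<noteq> []" "\<forall>v\<in>set w. \<not> complete_to v S"
    and dis: "set (p @ w) \<inter> S = {}" and odd: "odd (ecount (\<lambda>v. complete_to v S) p)"
  shows "\<exists>xs u v zs. p = xs @ u # v # zs \<and> complete_to u S \<and> complete_to v S \<and>
     (\<forall>y\<in>set xs \<union> set zs. \<not> complete_to y S)"
proof -
  have "\<exists>v\<in>set p. complete_to v S" using odd ecount_none by (metis (no_types, lifting) even_zero)
  then obtain xs mid zs where p: "p = xs @ mid @ zs" "mid \<noteq> []" "complete_to (hd mid) S"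
      "complete_to (last mid) S" "\<forall>v\<in>set xs \<union> set zs. \<not> complete_to v S"
      "ecount (\<lambda>v. complete_to v S) mid = ecount (\<lambda>v. complete_to v S) p"
    using trim_marked[of p "\<lambda>v. complete_to v S"] by blast
  have "odd (length mid + ecount (\<lambda>v. complete_to v S) mid)"
  proof (rule rr_parity[OF R p(2-4)])
    show "set mid \<inter> S = {}" using dis p by auto
    fix xs' u ys v zs' assume m: "mid = xs' @ u # ys @ v # zs'"
    have "chole E ((xs @ xs' @ (u # ys @ [v])) @ (zs' @ zs @ w))" using h p m by simp
    from chole_rotate[OF symE this] have "chole E ((zs' @ zs @ w @ xs @ xs') @ (u # ys @ [v]))"
      by simp
    from chole_cpath[OF this] w show "cpath E (u # ys @ [v])" by simp
  qed
  then have em: "even (length mid)" using odd p(6) by simp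
  obtain u r where r: "mid = u # r" using p(2) by (cases mid) auto
  then have "r \<noteq> []" using em by auto
  then obtain m v where m: "mid = u # m @ [v]" using r by (metis append_butlast_last_id)
  have cuv: "complete_to u S" "complete_to v S" using m p(3,4) by auto
  show ?thesis
  proof (cases "m = []")
    case True
    then show ?thesis using m p(1,5) cuv by (intro exI[of _ xs] exI[of _ u] exI[of _ v] exI[of _ zs]) auto
  next
    case False
    have "chole E ((xs @ [u]) @ (m @ [v] @ zs @ w))" using h p m by simp
    from chole_rotate[OF symE this] have "chole E (m @ (v # (zs @ w @ xs) @ [u]))" by simp
    from chole_cpath[OF this False] have "cpath E (v # (zs @ w @ xs) @ [u])" .
    then have "zs @ w @ xs = [] \<or> Parity.odd (length (zs @ w @ xs))"
      by (rule rr_segment[OF R]) (use dis p m cuv w in auto)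
    then have "Parity.odd (length (p @ w))" using w p(1) em by auto
    then show ?thesis using hole_even[OF h] by simp
  qed
qed

text \<open>If \<open>v\<close> were not the end of \<open>m\<close>, then \<open>k\<close>, the
  rest of \<open>ys\<close>, \<open>v\<close>, \<open>x\<close>, \<open>b\<close> would form a
  chordless path with complete ends whose interior has \<open>length ys + 1\<close> vertices, an
  even number, none of them complete.\<close>

lemma segment_left:
  assumes R: "rr S" and c: "cpath E (a # m)" "cpath E (m @ [b])" and ab: "a \<noteq> b"
    and m: "even (length m)" "m = ys @ v # zs" and x: "E x a" "E x b" "E x v" "\<forall>y\<in>set ys. \<not> E x y"
    and cab: "complete_to b S" and dis: "set (x # a # b # m) \<inter> S = {}" "x \<notin> set (a # b # m)"
    and xS: "\<not> complete_to x S" and ys: "ys = k # ys'" "complete_to k S" "\<forall>y\<in>set ys' \<union> {v}. \<not> complete_to y S"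
    and oys: "odd (length ys)"
  shows "zs = []"
proof (rule ccontr)
  assume z: "zs \<noteq> []"
  have "cpath E ((ys @ [v]) @ zs @ [b])" using c(2) m(2) by simp
  then have cy: "cpath E (ys @ [v])" and nb: "\<forall>u\<in>set (ys @ [v]). u \<noteq> b \<and> \<not> E u b"
    using z unfolding cpath_append by (auto simp: hd_append cpath_append)
  have nx: "\<forall>u\<in>set (ys @ [v]). u \<noteq> x \<and> (E u x \<longleftrightarrow> u = v)"
  proof
    fix u assume "u \<in> set (ys @ [v])"
    then show "u \<noteq> x \<and> (E u x \<longleftrightarrow> u = v)" using x(3,4) m(2) dis(2) adj_sym[of u x] adj_sym[of x u] by auto
  qed
  have "cpath E ((ys @ [v]) @ [x, b])"
  proof (rule cpath_appendI[OF cy])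
    show "cpath E [x, b]" using x(2) dis(2) by simp
    fix u w assume "u \<in> set (ys @ [v])" "w \<in> set [x, b]"
    then show "u \<noteq> w \<and> (E u w \<longleftrightarrow> u = last (ys @ [v]) \<and> w = hd [x, b])"
      using nb[rule_format, of u] nx[rule_format, of u] dis(2) by (cases "w = x") auto
  qed
  then have "cpath E (k # (ys' @ [v, x]) @ [b])" using ys(1) by simp
  then have "ys' @ [v, x] = [] \<or> Parity.odd (length (ys' @ [v, x]))"
    by (rule rr_segment[OF R]) (use dis ys xS cab m in auto)
  then show False using oys ys(1) by simp
qed

text \<open>An odd stretch of the path between consecutive neighbours of \<open>x\<close> closes to a hole
  through \<open>x\<close> having exactly two \<open>S\<close>-complete vertices; rerouting through \<open>x\<close> and
  an end of the path gives paths of both parities, unless the stretch is extremal.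
  The ends \<open>a\<close> and \<open>b\<close> may be adjacent, so that the lemma serves both paths and holes.\<close>

lemma attachment_type:
  assumes R: "rr S" and c: "cpath E (a # m)" "cpath E (m @ [b])" and ab: "a \<noteq> b"
    and m: "even (length m)" "m \<noteq> []" and x: "E x a" "E x b"
    and cab: "complete_to a S" "complete_to b S" and dis: "set (x # a # b # m) \<inter> S = {}" "x \<notin> set (a # b # m)"
    and xS: "\<not> complete_to x S"
    and no: "\<forall>v\<in>set m. \<not> (complete_to v S \<and> E x v)"
    and ex: "\<exists>v\<in>set m. complete_to v S" "\<exists>v\<in>set m. E x v"
  shows "(\<forall>v\<in>set m. E x v \<longleftrightarrow> v = last m) \<and> complete_to (hd m) S \<or>
         (\<forall>v\<in>set m. E x v \<longleftrightarrow> v = hd m) \<and> complete_to (last m) S"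
proof -
  let ?L = "\<lambda>v. complete_to v S"
  let ?p = "a # m @ [b]"
  have am: "\<forall>v\<in>set m. a \<noteq> v \<and> (E a v \<longleftrightarrow> v = hd m)" and bm: "\<forall>v\<in>set m. b \<noteq> v \<and> (E v b \<longleftrightarrow> v = last m)"
    using c by (auto simp: cpath_append)
  have cm: "cpath E m" using c by simp
  \<comment> \<open>Since \<open>a\<close> and \<open>b\<close> may be adjacent, the whole list need
    not be chordless. A stretch between consecutive complete vertices is: it cannot be the whole
    list, because \<open>m\<close> contains a complete vertex.\<close>
  have "odd (length ?p + ecount ?L ?p)"
  proof (rule rr_parity[OF R])
    fix xs u ys v zs assume s: "?p = xs @ u # ys @ v # zs" "complete_to u S" "complete_to v S"
      "\<forall>y\<in>set ys. \<not> complete_to y S"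
    consider "xs = []" "zs = []" | xs' where "xs = a # xs'" | "xs = []" "zs \<noteq> []"
      using s(1) by (cases xs) auto
    then show "cpath E (u # ys @ [v])"
    proof cases
      case 1
      then have "ys = m" using s(1) by simp
      then show ?thesis using s(4) ex(1) by auto
    next
      case 2
      then have "m @ [b] = xs' @ (u # ys @ [v]) @ zs" using s(1) by simp
      then have "cpath E (xs' @ (u # ys @ [v]) @ zs)" using c(2) by simp
      then show ?thesis by (simp only: cpath_append)
    next
      case 3
      then obtain zs' where "zs = zs' @ [b]" using s(1)
        by (metis append_butlast_last_id append_is_Nil_conv last_ConsR last_appendR last_snoc list.distinct(1))
      then have "a # m = (u # ys @ [v]) @ zs'" using s(1) 3 by simp
      then have "cpath E ((u # ys @ [v]) @ zs')" using c(1) by simp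
      then show ?thesis by (simp only: cpath_append)
    qed
  qed (use cab dis in auto)
  then have "odd (ecount ?L ?p)" using m by simp
  then have "\<exists>xs u ys v zs. ?p = xs @ u # ys @ v # zs \<and> E x u \<and> E x v \<and> (\<forall>y\<in>set ys. \<not> E x y) \<and>
     odd (ecount ?L (u # ys @ [v]))"
    using x by (intro odd_segment) auto
  then obtain xs u ys v zs where s: "?p = xs @ u # ys @ v # zs" "E x u" "E x v" "\<forall>y\<in>set ys. \<not> E x y"
     and o: "odd (ecount ?L (u # ys @ [v]))" by blast
  have ysne: "ys \<noteq> []"
  proof
    assume "ys = []"
    then have "?L u" "?L v" using o by (auto split: if_splits)
    moreover have "u \<in> set m \<or> v \<in> set m" using s(1) \<open>ys = []\<close> m by (cases xs) (auto simp: Cons_eq_append_conv append_eq_Cons_conv append_eq_append_conv2)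
    ultimately show False using no s by auto
  qed
  have ends: "xs \<noteq> [] \<or> zs \<noteq> []"
  proof (rule ccontr)
    assume "\<not> ?thesis"
    then have "ys = m" using s(1) by simp
    then show False using s(4) ex(2) by auto
  qed
  have cuv: "cpath E (u # ys @ [v])"
  proof (cases xs)
    case Nil
    then obtain zs' where "zs = zs' @ [b]" using s(1) ends
      by (metis append_butlast_last_id append_is_Nil_conv last_ConsR last_appendR last_snoc list.distinct(1))
    then have "a # m = (u # ys @ [v]) @ zs'" using s(1) Nil by simp
    then have "cpath E ((u # ys @ [v]) @ zs')" using c(1) by simp
    then show ?thesis by (simp only: cpath_append)
  next
    case (Cons a' xs')
    then have "m @ [b] = xs' @ (u # ys @ [v]) @ zs" using s(1) by simp
    then have "cpath E (xs' @ (u # ys @ [v]) @ zs)" using c(2) by simp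
    then show ?thesis by (simp only: cpath_append)
  qed
  have sub: "set (u # ys @ [v]) \<subseteq> set (a # m @ [b])" unfolding s(1) by auto
  have "\<forall>w\<in>set (u # ys @ [v]). x \<noteq> w \<and> (E x w \<longleftrightarrow> w = hd (u # ys @ [v]) \<or> w = last (u # ys @ [v]))"
  proof
    fix w assume "w \<in> set (u # ys @ [v])"
    then show "x \<noteq> w \<and> (E x w \<longleftrightarrow> w = hd (u # ys @ [v]) \<or> w = last (u # ys @ [v]))"
      using s(2-4) sub dis(2) by (cases "w \<in> set ys") auto
  qed
  then have h: "chole E (x # u # ys @ [v])"
    using cuv ysne unfolding chole.simps by (cases ys) simp_all
  then have oys: "odd (length ys)" using hole_even[OF h] by simp
  have h': "chole E ((u # ys @ [v]) @ [x])" using chole_rotate1[OF symE h] by simp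
  obtain xs' k k' zs' where kk: "u # ys @ [v] = xs' @ k # k' # zs'" "?L k" "?L k'"
     "\<forall>y\<in>set xs' \<union> set zs'. \<not> ?L y"
  proof -
    have "[x] \<noteq> []" "\<forall>v\<in>set [x]. \<not> complete_to v S" using xS by simp_all
    moreover have "set ((u # ys @ [v]) @ [x]) \<inter> S = {}" using dis(1) sub by auto
    ultimately show ?thesis using hole_odd_complete_edges[OF R h' _ _ _ o] that by blast
  qed
  show ?thesis
  proof (cases "xs = []")
    case True
    then have ua: "u = a" "m @ [b] = ys @ v # zs" using s(1) by auto
    then have x0: "xs' = []" "k = a" using kk cab by (cases xs'; auto)+
    obtain zs0 where zs: "zs = zs0 @ [b]" "m = ys @ v # zs0" using ends True ua(2)
      by (metis append_butlast_last_id append_is_Nil_conv butlast_append butlast_snoc last_ConsR last_appendR last_snoc list.distinct(1) butlast.simps(2))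
    obtain ys' where ys': "ys = k' # ys'" "zs' = ys' @ [v]" using kk(1) x0 ua ysne by (cases ys) auto
    have "zs0 = []"
      by (rule segment_left[OF R c ab m(1) zs(2) x s(3,4) cab(2) dis xS ys'(1) kk(3) _ oys]) (use kk(4) ys' in auto)
    then show ?thesis using zs ys' kk(3) s(3,4) by auto
  next
    case False
    then obtain xs0 where xs: "xs = a # xs0" "m @ [b] = xs0 @ u # ys @ v # zs" using s(1) by (cases xs) auto
    show ?thesis
    proof (cases "zs = []")
      case True
      then have vb: "v = b" "m = xs0 @ u # ys" using xs(2) by (auto simp: append_eq_append_conv2 Cons_eq_append_conv append_eq_Cons_conv)
      have z0: "zs' = [] \<and> k' = b"
      proof (cases zs' rule: rev_cases)
        case Nil then show ?thesis using kk(1) vb by auto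
      next
        case (snoc zz z)
        then have "z = v" using kk(1) by (metis append.assoc append_Cons last_ConsR last_snoc list.distinct(1) snoc_eq_iff_butlast)
        then show ?thesis using kk(4) vb cab snoc by auto
      qed
      obtain ys' where ys': "ys = ys' @ [k]" "xs' = u # ys'"
      proof (cases xs')
        case Nil
        then show ?thesis using kk(1) z0 ysne by auto
      next
        case (Cons u' ys')
        then show ?thesis using kk(1) z0 that[of ys'] by auto
      qed
      have "rev xs0 = []"
      proof (rule segment_left[OF R, of b "rev m" a "rev ys" u "rev xs0" x k "rev ys'"])
        show "cpath E (b # rev m)" "cpath E (rev m @ [a])"
          using c cpath_rev[OF symE, of "m @ [b]"] cpath_rev[OF symE, of "a # m"] by auto
      qed (use vb m x s kk ys' oys dis xS ab cab in auto)
      then show ?thesis using vb ys' kk(2) s(2,4) by auto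
    next
      case False
      obtain zs0 where zs: "zs = zs0 @ [b]" "m = xs0 @ u # ys @ v # zs0"
      proof (cases zs rule: rev_cases)
        case Nil then show ?thesis using False by simp
      next
        case (snoc zz z)
        then show ?thesis using xs(2) that[of zz] by auto
      qed
      have "\<not> ?L u" "\<not> ?L v" using no zs(2) s by auto
      obtain \<alpha> where \<alpha>: "xs' = u # \<alpha>" using kk(1,2) \<open>\<not> ?L u\<close> by (cases xs') auto
      obtain \<beta> where \<beta>: "zs' = \<beta> @ [v]"
      proof (cases zs' rule: rev_cases)
        case Nil
        then have "k' = v" using kk(1) by (metis append.assoc append_Cons last_ConsR last_snoc list.distinct(1) snoc_eq_iff_butlast last.simps last_append)
        then show ?thesis using kk(3) \<open>\<not> ?L v\<close> by simp
      next
        case (snoc zz z)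
        then have "z = v" using kk(1) by (metis append.assoc append_Cons last_ConsR last_snoc list.distinct(1) snoc_eq_iff_butlast)
        then show ?thesis using snoc that[of zz] by simp
      qed
      have ys: "ys = \<alpha> @ k # k' # \<beta>" using kk(1) \<alpha> \<beta> by auto
      have par: "odd (length \<alpha> + length \<beta>)" using oys ys by simp
      have nL: "\<forall>y\<in>set \<alpha> \<union> set \<beta> \<union> {u, v, x}. \<not> ?L y" using kk(4) \<alpha> \<beta> xS by auto
      have cy: "cpath E (u # \<alpha> @ [k])" "cpath E (v # rev \<beta> @ [k'])"
      proof -
        have "cpath E ((u # \<alpha> @ [k]) @ (k' # \<beta> @ [v]))" using cuv ys by simp
        then have "cpath E (u # \<alpha> @ [k])" "cpath E (rev (k' # \<beta> @ [v]))"
          using cpath_rev[OF symE] by (blast dest: cpath_append[THEN iffD1])+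
        then show "cpath E (u # \<alpha> @ [k])" "cpath E (v # rev \<beta> @ [k'])" by auto
      qed
      \<comment> \<open>Detours from an end \<open>e\<close> through \<open>x\<close> and then along
        the stretch, from \<open>u\<close> to \<open>k\<close> or from \<open>v\<close> to
        \<open>k'\<close>. The lengths of \<open>\<alpha>\<close> and \<open>\<beta>\<close> differ
        in parity, so one of the two detours violates \<open>rr\<close>.\<close>
      have route: "cpath E (e # (x # w # \<gamma>) @ [l])"
        if q: "cpath E (w # \<gamma> @ [l])" and "set (w # \<gamma> @ [l]) \<subseteq> set (u # ys @ [v])"
          and e: "\<And>y. y \<in> set (u # ys @ [v]) \<Longrightarrow> e \<noteq> y \<and> \<not> E e y" and "E e x"
          and "E x w" "set (\<gamma> @ [l]) \<subseteq> set ys" for e w \<gamma> l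
      proof -
        have xn: "x \<notin> set (u # ys @ [v])" using dis(2) zs(2) by auto
        have cx: "cpath E (x # (w # \<gamma> @ [l]))"
        proof (rule cpath_ConsI[OF q])
          fix y assume y: "y \<in> set (w # \<gamma> @ [l])"
          show "x \<noteq> y \<and> (E x y \<longleftrightarrow> y = hd (w # \<gamma> @ [l]))"
          proof (cases "y = w")
            case True
            then show ?thesis using that(2,5) xn by auto
          next
            case False
            then have "y \<in> set ys" using y that(6) by auto
            then show ?thesis using False s(4) xn by auto
          qed
        qed
        have "e \<noteq> x" using that(4) by auto
        have "cpath E (e # (x # (w # \<gamma> @ [l])))"
        proof (rule cpath_ConsI[OF cx])
          fix y assume y: "y \<in> set (x # (w # \<gamma> @ [l]))"
          show "e \<noteq> y \<and> (E e y \<longleftrightarrow> y = hd (x # (w # \<gamma> @ [l])))"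
          proof (cases "y = x")
            case True
            then show ?thesis using that(4) \<open>e \<noteq> x\<close> by simp
          next
            case False
            then have "y \<in> set (u # ys @ [v])" using y that(2) by auto
            then show ?thesis using False e[of y] by simp
          qed
        qed
        then show ?thesis by simp
      qed
      have xm: "x \<notin> set m" using dis by auto
      \<comment> \<open>The stretch has an odd number of vertices and \<open>m\<close> an even one,
        so part of \<open>m\<close> remains on one side; the end of the path on that side sees
        nothing of the stretch.\<close>
      have "xs0 \<noteq> [] \<or> zs0 \<noteq> []"
      proof (rule ccontr)
        assume "\<not> ?thesis"
        then show False using zs(2) m(1) oys by simp
      qed
      then show ?thesis
      proof
        assume ne: "xs0 \<noteq> []"
        have na: "\<forall>y\<in>set (u # ys @ [v]). a \<noteq> y \<and> \<not> E a y"
          using am cpath_distinct[OF cm] zs(2) ne by (cases xs0) auto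
        have "cpath E (a # (x # u # \<alpha>) @ [k])"
          by (rule route[OF cy(1) _ na[rule_format] adj_sym[OF x(1)] s(2)]) (use ys in auto)
        then have 1: "x # u # \<alpha> = [] \<or> odd (length (x # u # \<alpha>))"
          by (rule rr_segment[OF R]) (use dis nL cab kk(2) ys zs(2) in auto)
        have "cpath E (a # (x # v # rev \<beta>) @ [k'])"
          by (rule route[OF cy(2) _ na[rule_format] adj_sym[OF x(1)] s(3)]) (use ys in auto)
        then have "x # v # rev \<beta> = [] \<or> odd (length (x # v # rev \<beta>))"
          by (rule rr_segment[OF R]) (use dis nL cab kk(3) ys zs(2) in auto)
        then show ?thesis using 1 par by simp
      next
        assume ne: "zs0 \<noteq> []"
        have na: "\<forall>y\<in>set (u # ys @ [v]). b \<noteq> y \<and> \<not> E b y"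
        proof
          fix y assume y: "y \<in> set (u # ys @ [v])"
          have "y \<noteq> last m" using cpath_distinct[OF cm] zs(2) ne y by (cases zs0 rule: rev_cases) auto
          moreover have "y \<in> set m" using y zs(2) by auto
          ultimately show "b \<noteq> y \<and> \<not> E b y" using bm adj_sym[of b y] by blast
        qed
        have "cpath E (b # (x # u # \<alpha>) @ [k])"
          by (rule route[OF cy(1) _ na[rule_format] adj_sym[OF x(2)] s(2)]) (use ys in auto)
        then have 1: "x # u # \<alpha> = [] \<or> odd (length (x # u # \<alpha>))"
          by (rule rr_segment[OF R]) (use dis nL cab kk(2) ys zs(2) in auto)
        have "cpath E (b # (x # v # rev \<beta>) @ [k'])"
          by (rule route[OF cy(2) _ na[rule_format] adj_sym[OF x(2)] s(3)]) (use ys in auto)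
        then have "x # v # rev \<beta> = [] \<or> odd (length (x # v # rev \<beta>))"
          by (rule rr_segment[OF R]) (use dis nL cab kk(3) ys zs(2) in auto)
        then show ?thesis using 1 par by simp
      qed
    qed
  qed
qed

lemma anti_nonneighbor:
  assumes "conn (non_adj E) X" "x \<in> X" "X \<noteq> {x}"
  shows "\<not> complete_to x (X - {x})"
proof -
  have "\<exists>y\<in>{x}. \<exists>z\<in>X - {x}. non_adj E y z"
    using assms(1)[unfolded conn_def, rule_format, of "{x}"] assms(2,3) by auto
  then show ?thesis unfolding complete_to_def by auto
qed

lemma complete_to_mono: "complete_to v X \<Longrightarrow> Y \<subseteq> X \<Longrightarrow> complete_to v Y"
  unfolding complete_to_def by auto

lemma complete_to_split: "x \<in> X \<Longrightarrow> complete_to v X \<longleftrightarrow> complete_to v (X - {x}) \<and> E v x"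
  unfolding complete_to_def by auto

text \<open>A chordless antipath in \<open>X\<close> from \<open>x\<close> to \<open>y\<close> has
  at least three vertices, because \<open>x\<close> and \<open>y\<close> are adjacent. Outside it
  \<open>q\<close> misses only \<open>x\<close> and \<open>r\<close> only \<open>y\<close>, so the
  non-edge \<open>q r\<close> closes it to an antihole with at least five vertices.\<close>

lemma antihole_through:
  assumes X: "conn (non_adj E) X" "x \<in> X" "y \<in> X" "E x y"
    and q: "q \<notin> X" "complete_to q (X - {x})" "\<not> E q x" and r: "r \<notin> X" "complete_to r (X - {y})" "\<not> E r y"
    and qr: "q \<noteq> r" "\<not> E q r"
  shows False
proof -
  obtain Q where Q: "cpath (non_adj E) Q" "Q \<noteq> []" "set Q \<subseteq> X" "hd Q = x" "last Q = y"
    using conn_cpath_ex[OF irreflp_non_adj X(1,2,3)] by blast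
  have dQ: "distinct Q" by (rule cpath_distinct[OF Q(1)])
  have "length Q \<ge> 3"
  proof (rule ccontr)
    assume "\<not> ?thesis"
    then have "Q = [x] \<or> Q = [x, y]" using Q by (cases Q; cases "tl Q"; cases "tl (tl Q)") auto
    then show False
    proof
      assume "Q = [x]" then show False using Q(5) X(4) by simp
    next
      assume "Q = [x, y]"
      with Q(1) have "cpath (non_adj E) [x, y]" by simp
      then show False using X(4) by simp
    qed
  qed
  have "cpath (non_adj E) (Q @ [r])"
  proof (rule cpath_appendI[OF Q(1)])
    fix u v assume "u \<in> set Q" "v \<in> set [r]"
    then show "u \<noteq> v \<and> (non_adj E u v \<longleftrightarrow> u = last Q \<and> v = hd [r])"
      using Q r adj_sym[of u r] adj_sym[of r u] unfolding complete_to_def by auto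
  qed simp
  then have "chole (non_adj E) (q # (Q @ [r]))"
  proof (rule choleI)
    show "3 \<le> length (Q @ [r])" using \<open>length Q \<ge> 3\<close> by simp
    fix v assume "v \<in> set (Q @ [r])"
    then show "q \<noteq> v \<and> (non_adj E q v \<longleftrightarrow> v = hd (Q @ [r]) \<or> v = last (Q @ [r]))"
      using Q q r qr unfolding complete_to_def by auto
  qed
  from no_antihole[OF this] show False using \<open>length Q \<ge> 3\<close> by simp
qed

text \<open>Induction on the size of \<open>X\<close>, removing either of two vertices whose removal
  keeps \<open>X\<close> anticonnected. The path has an interior vertex complete to the smaller set,
  so \<open>attachment_type\<close> tells how the removed vertex sees the path. The two removable
  vertices are attached at opposite ends, which leads to a prism or a long antihole.\<close>

theorem roussel_rubio:
  assumes "finite X" "X \<noteq> {}" "conn (non_adj E) X"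
  shows "rr X"
  using assms
proof (induction "card X" arbitrary: X rule: less_induct)
  case less
  show ?case unfolding rr_def
  proof (intro allI impI, rule ccontr)
    fix p assume p: "cpath E p" "4 \<le> length p" "even (length p)" "set p \<inter> X = {}"
      "complete_to (hd p) X" "complete_to (last p) X" "\<not> (\<exists>v\<in>set p - {hd p, last p}. complete_to v X)"
    obtain a r where r: "p = a # r" using p(2) by (cases p) auto
    then have "r \<noteq> []" using p(2) by auto
    then obtain m b where pm: "p = a # m @ [b]" using r by (metis append_butlast_last_id)
    have m: "even (length m)" "m \<noteq> []" using p pm by auto
    have c: "cpath E (a # m)" "cpath E (m @ [b])" using p(1) pm cpath_append[of E "a # m" "[b]"] by auto
    have cab: "complete_to a X" "complete_to b X" using p pm by auto
    have am: "\<forall>v\<in>set m. a \<noteq> v \<and> (E a v \<longleftrightarrow> v = hd m)" and bm: "\<forall>v\<in>set m. b \<noteq> v \<and> (E v b \<longleftrightarrow> v = last m)"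
      using c by (auto simp: cpath_append)
    have "hd m \<noteq> b" using bm m(2) by auto
    then have ab: "a \<noteq> b" "\<not> E a b" using p(1) m(2) unfolding pm by auto
    have no: "\<forall>v\<in>set m. \<not> complete_to v X" using p(7) pm am bm by auto
    \<comment> \<open>A vertex of \<open>X\<close> without neighbours in \<open>m\<close> would
      close the path, which has an even number of vertices, to an odd hole.\<close>
    have hole: "\<exists>v\<in>set m. E t v" if t: "t \<in> X" for t
    proof (rule ccontr)
      assume n: "\<not> ?thesis"
      have "chole E (t # p)"
      proof (rule choleI[OF p(1)])
        show "3 \<le> length p" using p by simp
        fix v assume "v \<in> set p"
        then show "t \<noteq> v \<and> (E t v \<longleftrightarrow> v = hd p \<or> v = last p)"
          using n t p(4) cab adj_sym[of _ t] unfolding pm complete_to_def by auto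
      qed
      then show False using hole_even p(3) by fastforce
    qed
    show False
    proof (cases "\<exists>t. X = {t}")
      case True
      then obtain t where "X = {t}" by blast
      then show False using hole[of t] no adj_sym[of t] unfolding complete_to_def by auto
    next
      case False
      then obtain x1 x2 where x: "x1 \<in> X" "x2 \<in> X" "x1 \<noteq> x2" "conn (non_adj E) (X - {x1})" "conn (non_adj E) (X - {x2})"
        using conn_remove2[OF symp_non_adj less.prems(1,3,2)] by blast
      have type: "(\<forall>v\<in>set m. E x v \<longleftrightarrow> v = last m) \<and> complete_to (hd m) (X - {x}) \<or>
         (\<forall>v\<in>set m. E x v \<longleftrightarrow> v = hd m) \<and> complete_to (last m) (X - {x})"
        if xX: "x \<in> X" and cx: "conn (non_adj E) (X - {x})" for x
      proof -
        have "X - {x} \<noteq> {}" using False xX by auto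
        then have R: "rr (X - {x})" using less.hyps[OF _ _ _ cx] less.prems(1) xX
          by (metis card_Diff1_less finite_Diff)
        have "\<exists>v\<in>set p - {hd p, last p}. complete_to v (X - {x})"
          using R[unfolded rr_def, rule_format, OF p(1-3)] p(4-6) complete_to_mono[of _ X "X - {x}"] by auto
        then have ex: "\<exists>v\<in>set m. complete_to v (X - {x})" unfolding pm by auto
        show ?thesis
        proof (rule attachment_type[OF R c ab(1) m _ _ _ _ _ _ _ _ ex hole[OF xX]])
          show "E x a" "E x b" using cab xX adj_sym unfolding complete_to_def by blast+
          show "complete_to a (X - {x})" "complete_to b (X - {x})" using cab complete_to_split[OF xX] by blast+
          show "set (x # a # b # m) \<inter> (X - {x}) = {}" "x \<notin> set (a # b # m)" using p(4) pm xX by auto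
          show "\<not> complete_to x (X - {x})" using anti_nonneighbor[OF less.prems(3) xX] False by blast
          show "\<forall>v\<in>set m. \<not> (complete_to v (X - {x}) \<and> E x v)"
            using no complete_to_split[OF xX] adj_sym[of x] by blast
        qed
      qed
      have hl: "hd m \<noteq> last m"
        using m cpath_distinct[OF c(1)] by (cases m rule: list.exhaust; cases "tl m") auto
      have hlm: "hd m \<in> set m" "last m \<in> set m" using m by auto
      have key: False if x: "x1 \<in> X" "x2 \<in> X" "x1 \<noteq> x2" and
         L: "\<forall>v\<in>set m. E x1 v \<longleftrightarrow> v = last m" "complete_to (hd m) (X - {x1})" and
         R: "\<forall>v\<in>set m. E x2 v \<longleftrightarrow> v = hd m" "complete_to (last m) (X - {x2})" for x1 x2
      proof -
        have disj: "x1 \<notin> set p" "x2 \<notin> set p" using x p(4) by auto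
        have e: "E a x1" "E a x2" "E b x1" "E b x2" using cab x unfolding complete_to_def by auto
        show False
        proof (cases "E x1 x2")
          case False
          \<comment> \<open>The triangles are \<open>a\<close>, \<open>hd m\<close>,
            \<open>x2\<close> and \<open>x1\<close>, \<open>last m\<close>,
            \<open>b\<close>.\<close>
          have "prism_lists E [a, x1] m [x2, b]" unfolding prism_lists_def cross_def
          proof (intro conjI ballI)
            show "cpath E [a, x1]" "cpath E [x2, b]" "cpath E m" using e x disj pm c adj_sym by auto
            show "2 \<le> length m" using m by (cases m; cases "tl m") auto
            fix u v assume "u \<in> set [a, x1]" "v \<in> set m"
            then show "u \<noteq> v" "E u v = (u = hd [a, x1] \<and> v = hd m \<or> u = last [a, x1] \<and> v = last m)"
              using am L disj pm by auto
          next
            fix u v assume "u \<in> set [a, x1]" "v \<in> set [x2, b]"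
            then show "u \<noteq> v" "E u v = (u = hd [a, x1] \<and> v = hd [x2, b] \<or> u = last [a, x1] \<and> v = last [x2, b])"
              using ab e x(3) disj pm adj_sym False by auto
          next
            fix u v assume "u \<in> set m" "v \<in> set [x2, b]"
            then show "u \<noteq> v" "E u v = (u = hd m \<and> v = hd [x2, b] \<or> u = last m \<and> v = last [x2, b])"
              using bm R(1) disj pm adj_comm[of u x2] by auto
          qed auto
          then show False using no_prism by blast
        next
          case True
          have n: "\<not> E (hd m) x1" "\<not> E (last m) x2"
            using L(1) R(1) hl hlm adj_sym[of "hd m" x1] adj_sym[of "last m" x2] by auto
          have nX: "hd m \<notin> X" "last m \<notin> X" using hlm p(4) pm by auto
          \<comment> \<open>Adjacent ends mean that \<open>m\<close> has only two vertices.\<close>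
          have h: "E (hd m) (last m)"
            using antihole_through[OF less.prems(3) x(1,2) True nX(1) L(2) n(1) nX(2) R(2) n(2) hl] by blast
          obtain q r m' where qr0: "m = q # r # m'" using m by (cases m; cases "tl m") auto
          have "m' = []"
          proof (rule ccontr)
            assume ne: "m' \<noteq> []"
            have "\<forall>v\<in>set (r # m'). E q v \<longleftrightarrow> v = r" using c(1) unfolding qr0 by simp
            then have "last m' = r" using h ne unfolding qr0 by simp
            moreover have "r \<notin> set m'" using cpath_distinct[OF c(1)] unfolding qr0 by simp
            ultimately show False using ne last_in_set by blast
          qed
          then have qr: "m = [q, r]" using qr0 by simp
          obtain Q where Q: "cpath (non_adj E) Q" "Q \<noteq> []" "set Q \<subseteq> X" "hd Q = x1" "last Q = x2"
            using conn_cpath_ex[OF irreflp_non_adj less.prems(3) x(1,2)] by blast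
          have dis: "\<forall>v\<in>set Q. v \<notin> {a, b, q, r}" using Q(3) p(4) pm qr by auto
          have co: "\<forall>v\<in>set Q. E a v \<and> E b v \<and> (E q v \<longleftrightarrow> v \<noteq> x1) \<and> (E r v \<longleftrightarrow> v \<noteq> x2)"
            using Q(3) L R cab n qr unfolding complete_to_def by auto
          have co': "\<forall>v\<in>set Q. E v a \<and> E v b \<and> (E v r \<longleftrightarrow> v \<noteq> x2)" using co adj_sym by blast
          have f: "E a q" "E r b" "\<not> E a r" "\<not> E q b" "a \<noteq> q" "a \<noteq> r" "b \<noteq> q" "b \<noteq> r" "q \<noteq> r"
            using am bm qr hl by auto
          have c2: "cpath (non_adj E) [r, a, b]" using f ab adj_sym by auto
          have "cpath (non_adj E) (Q @ [r, a, b])"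
          proof (rule cpath_appendI[OF Q(1) c2])
            fix u v assume "u \<in> set Q" "v \<in> set [r, a, b]"
            then show "u \<noteq> v \<and> (non_adj E u v \<longleftrightarrow> u = last Q \<and> v = hd [r, a, b])"
              using dis co' Q(5) f by auto
          qed
          \<comment> \<open>The antipath from \<open>x1\<close> to \<open>x2\<close> is closed
            through the non-edges \<open>x2 r\<close>, \<open>r a\<close>, \<open>a b\<close>,
            \<open>b q\<close>, \<open>q x1\<close>.\<close>
          then have "chole (non_adj E) (q # (Q @ [r, a, b]))"
          proof (rule choleI)
            fix v assume v: "v \<in> set (Q @ [r, a, b])"
            have "E q a" "E q r" using f h qr adj_sym by auto
            have hq: "hd (Q @ [r, a, b]) = x1" "last (Q @ [r, a, b]) = b" using Q(2,4) by simp_all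
            have "x1 \<in> set Q" using Q(2,4) by auto
            show "q \<noteq> v \<and> (non_adj E q v \<longleftrightarrow> v = hd (Q @ [r, a, b]) \<or> v = last (Q @ [r, a, b]))"
              unfolding hq
            proof (cases "v \<in> set Q")
              case True
              then show "q \<noteq> v \<and> (non_adj E q v \<longleftrightarrow> v = x1 \<or> v = b)" using co[rule_format, of v] dis[rule_format, of v] by auto
            next
              case False
              then have "v = r \<or> v = a \<or> v = b" using v by auto
              then show "q \<noteq> v \<and> (non_adj E q v \<longleftrightarrow> v = x1 \<or> v = b)"
                using \<open>E q a\<close> \<open>E q r\<close> f False \<open>x1 \<in> set Q\<close> dis[rule_format, of x1] ab by auto
            qed
          qed simp
          from no_antihole[OF this] show False using Q(2) by (cases Q) auto
        qed
      qed
      \<comment> \<open>Excludes equal types: the end of \<open>m\<close> that is complete to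
        \<open>X - {x1}\<close> is seen by \<open>x2\<close>, whereas \<open>x1\<close> sees only
        the other end.\<close>
      have 1: "E x2 (hd m)" if "complete_to (hd m) (X - {x1})" using that x adj_sym unfolding complete_to_def by auto
      have 2: "E x2 (last m)" if "complete_to (last m) (X - {x1})" using that x adj_sym unfolding complete_to_def by auto
      from type[OF x(1,4)] show False
      proof
        assume l: "(\<forall>v\<in>set m. E x1 v \<longleftrightarrow> v = last m) \<and> complete_to (hd m) (X - {x1})"
        then have "(\<forall>v\<in>set m. E x2 v \<longleftrightarrow> v = hd m) \<and> complete_to (last m) (X - {x2})"
        proof -
          have "\<not> (\<forall>v\<in>set m. E x2 v \<longleftrightarrow> v = last m)" using 1 l hl hlm by auto
          then show ?thesis using type[OF x(2,5)] by satx
        qed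
        then show False using key[OF x(1-3)] l by blast
      next
        assume l: "(\<forall>v\<in>set m. E x1 v \<longleftrightarrow> v = hd m) \<and> complete_to (last m) (X - {x1})"
        then have "(\<forall>v\<in>set m. E x2 v \<longleftrightarrow> v = last m) \<and> complete_to (hd m) (X - {x2})"
        proof -
          have "\<not> (\<forall>v\<in>set m. E x2 v \<longleftrightarrow> v = hd m)" using 2 l hl hlm by auto
          then show ?thesis using type[OF x(2,5)] by satx
        qed
        then show False using key[OF x(2,1) x(3)[symmetric]] l by blast
      qed
    qed
  qed
qed

end

section \<open>Holes with a pair of adjacent complete vertices\<close>

context artemis_adj
begin

lemma hole_close:
  assumes "cpath E q" "3 \<le> length q" "\<And>v. v \<in> set q \<Longrightarrow> x \<noteq> v \<and> (E x v \<longleftrightarrow> v = hd q \<or> v = last q)"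
  shows "odd (length q)"
  using hole_even[OF choleI[OF assms]] by simp

lemma first_last_split:
  assumes "\<exists>v\<in>set m. P v"
  obtains us k vs where "m = us @ k # vs" "P k" "\<forall>v\<in>set us \<union> set vs. \<not> P v"
    | us k ws k' vs where "m = us @ k # ws @ k' # vs" "P k" "P k'" "\<forall>v\<in>set us \<union> set vs. \<not> P v"
proof -
  obtain us k r where 1: "m = us @ k # r" "P k" "\<forall>v\<in>set us. \<not> P v"
    using split_list_first_prop[OF assms] by blast
  show ?thesis
  proof (cases "\<exists>v\<in>set r. P v")
    case True
    then obtain ws k' vs where "r = ws @ k' # vs" "P k'" "\<forall>v\<in>set vs. \<not> P v"
      using split_list_last_prop[OF True] by blast
    then show ?thesis using 1 by (intro that(2)[of us k ws k' vs]) auto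
  next
    case False
    then show ?thesis using 1 by (intro that(1)[of us k r]) auto
  qed
qed

lemma cpath_two:
  assumes "cpath E (xs @ u # ys @ v # zs)"
  shows "cpath E (xs @ [u])" "cpath E (v # zs)" "\<forall>x\<in>set (xs @ [u]). \<forall>z\<in>set (v # zs). x \<noteq> z \<and> (E x z \<longleftrightarrow> ys = [] \<and> x = u \<and> z = v)"
proof -
  have "cpath E ((xs @ [u]) @ (ys @ v # zs))" using assms by simp
  then have 1: "cpath E (xs @ [u])" "cpath E (ys @ v # zs)"
    and 2: "\<forall>x\<in>set (xs @ [u]). \<forall>z\<in>set (ys @ v # zs). x \<noteq> z \<and> (E x z \<longleftrightarrow> x = u \<and> z = hd (ys @ v # zs))"
    unfolding cpath_append by simp_all
  show "cpath E (xs @ [u])" "cpath E (v # zs)" using 1 unfolding cpath_append by simp_all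
  have d: "distinct (ys @ v # zs)" using 1(2) by (rule cpath_distinct)
  show "\<forall>x\<in>set (xs @ [u]). \<forall>z\<in>set (v # zs). x \<noteq> z \<and> (E x z \<longleftrightarrow> ys = [] \<and> x = u \<and> z = v)"
  proof (intro ballI)
    fix x z assume xz: "x \<in> set (xs @ [u])" "z \<in> set (v # zs)"
    then have "x \<noteq> z \<and> (E x z \<longleftrightarrow> x = u \<and> z = hd (ys @ v # zs))" using 2[rule_format, OF xz(1), of z] by auto
    moreover have "z = hd (ys @ v # zs) \<longleftrightarrow> ys = [] \<and> z = v" using d xz(2) by (cases ys) auto
    ultimately show "x \<noteq> z \<and> (E x z \<longleftrightarrow> ys = [] \<and> x = u \<and> z = v)" by blast
  qed
qed

text \<open>A path from \<open>t\<close> into the hole, leaving the edge \<open>ab\<close> alone, ends in a vertex that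
  sees the hole in two adjacent vertices (by parity), which gives a prism.\<close>

lemma no_hat:
  assumes c: "cpath E (a # m)" "cpath E (m @ [b])" and ab: "E a b" and m: "even (length m)" "m \<noteq> []"
    and t: "E t a" "E t b" "\<forall>v\<in>set m. t \<noteq> v \<and> \<not> E t v"
    and D: "conn E D" "D \<inter> {a, b, t} = {}" "\<forall>d\<in>D. \<not> E d a \<and> \<not> E d b"
      "\<exists>d\<in>D. E t d" "\<exists>d\<in>D. \<exists>v\<in>set m. d = v \<or> E d v"
  shows False
proof -
  have am: "\<And>v. v \<in> set m \<Longrightarrow> a \<noteq> v \<and> (E a v \<longleftrightarrow> v = hd m)" and bm: "\<And>v. v \<in> set m \<Longrightarrow> b \<noteq> v \<and> (E v b \<longleftrightarrow> v = last m)"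
    using c by (auto simp: cpath_append)
  have cm: "cpath E m" using c(1) by simp
  have nab: "a \<noteq> b" using ab by auto
  obtain d1 d2 where "d1 \<in> D" "E t d1" "d2 \<in> D" "\<exists>v\<in>set m. d2 = v \<or> E d2 v" using D(4,5) by blast
  from conn_link[OF irrE D(1), of d1 "E t" d2 "\<lambda>d. \<exists>v\<in>set m. d = v \<or> E d v", OF this]
  obtain Y where Y: "cpath E Y" "Y \<noteq> []" "set Y \<subseteq> D" "E t (hd Y)" "\<exists>v\<in>set m. last Y = v \<or> E (last Y) v"
     "\<forall>y\<in>set Y. E t y \<longrightarrow> y = hd Y" "\<forall>y\<in>set Y. (\<exists>v\<in>set m. y = v \<or> E y v) \<longrightarrow> y = last Y" by blast
  \<comment> \<open>A vertex of \<open>Y\<close> on \<open>m\<close> would be the last one, and its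
    predecessor would already see \<open>m\<close>.\<close>
  have Ym: "\<forall>y\<in>set Y. y \<notin> set m"
  proof (rule ballI, rule notI)
    fix y assume y: "y \<in> set Y" "y \<in> set m"
    then have yl: "y = last Y" using Y(7) by blast
    have "y \<noteq> hd Y" using y(2) t(3) Y(4) by blast
    have "Y = butlast Y @ [y]" using yl Y(2) by simp
    moreover have "butlast Y \<noteq> []" using \<open>y \<noteq> hd Y\<close> calculation by (cases "butlast Y") auto
    ultimately obtain Z where Z: "Y = Z @ [y]" "Z \<noteq> []" by blast
    then have "E (last Z) y" "last Z \<in> set Y" using Y(1) last_in_set[of Z] unfolding Z(1) cpath_append by auto
    then have "last Z = y" using Y(7) y(2) yl by blast
    moreover have "y \<notin> set Z" using cpath_distinct[OF Y(1)] Z by simp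
    ultimately show False using Z(2) last_in_set by blast
  qed
  let ?y = "last Y"
  have yY: "?y \<in> set Y" using Y(2) by simp
  have Yab: "\<And>y. y \<in> set Y \<Longrightarrow> y \<noteq> a \<and> y \<noteq> b \<and> y \<noteq> t \<and> \<not> E y a \<and> \<not> E y b" using Y(3) D(2,3) by blast
  have Yn: "\<And>y v. y \<in> set Y \<Longrightarrow> v \<in> set m \<Longrightarrow> y \<noteq> v \<and> (E y v \<longrightarrow> y = ?y)" using Ym Y(7) by blast
  have ex: "\<exists>v\<in>set m. E ?y v" using Y(5) Ym yY by blast
  \<comment> \<open>The hole runs through \<open>t\<close> and \<open>Y\<close> to the first
    neighbour \<open>k\<close> of \<open>?y\<close> and back along \<open>us\<close> to
    \<open>a\<close>. In \<open>h2\<close> the last neighbour and \<open>b\<close> take these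
    roles.\<close>
  have h1: "odd (length Y + length us)" if s: "m = us @ k # vs" "E ?y k" "\<forall>v\<in>set us. \<not> E ?y v" for us k vs
  proof -
    have R: "cpath E (k # rev us @ [a])"
    proof -
      have "cpath E ((a # us @ [k]) @ vs)" using c(1) s by simp
      then have "cpath E (rev (a # us @ [k]))" unfolding cpath_append using cpath_rev[OF symE] by blast
      then show ?thesis by simp
    qed
    have "cpath E (Y @ (k # rev us @ [a]))"
    proof (rule cpath_appendI[OF Y(1) R])
      fix u v assume u: "u \<in> set Y" and v: "v \<in> set (k # rev us @ [a])"
      show "u \<noteq> v \<and> (E u v \<longleftrightarrow> u = ?y \<and> v = hd (k # rev us @ [a]))"
      proof (cases "v = a")
        case True
        then show ?thesis using Yab[OF u] am[of k] s(1) by auto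
      next
        case False
        then have vm: "v \<in> set (us @ [k])" "v \<in> set m" using v s(1) by auto
        have "v = k \<longleftrightarrow> v \<notin> set us" using vm cpath_distinct[OF cm] s(1) by auto
        then show ?thesis using Yn[OF u vm(2)] s(2,3) vm(1) by auto
      qed
    qed
    then have "odd (length (Y @ (k # rev us @ [a])))"
    proof (rule hole_close)
      show "3 \<le> length (Y @ k # rev us @ [a])" using Y(2) by (cases Y) auto
      fix v assume v: "v \<in> set (Y @ k # rev us @ [a])"
      have hq: "hd (Y @ k # rev us @ [a]) = hd Y" "last (Y @ k # rev us @ [a]) = a" using Y(2) by auto
      have "v \<in> set Y \<or> v = a \<or> v \<in> set m" using v s(1) by auto
      then show "t \<noteq> v \<and> (E t v \<longleftrightarrow> v = hd (Y @ k # rev us @ [a]) \<or> v = last (Y @ k # rev us @ [a]))"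
        unfolding hq
      proof (elim disjE)
        assume vY: "v \<in> set Y"
        then show "t \<noteq> v \<and> (E t v \<longleftrightarrow> v = hd Y \<or> v = a)" using Y(4,6) Yab[OF vY] by auto
      next
        assume "v = a"
        then show "t \<noteq> v \<and> (E t v \<longleftrightarrow> v = hd Y \<or> v = a)" using t(1) by auto
      next
        assume vm: "v \<in> set m"
        have "hd Y \<in> set Y" using Y(2) by simp
        then have "v \<noteq> hd Y" "v \<noteq> a" using Ym vm am by auto
        then show "t \<noteq> v \<and> (E t v \<longleftrightarrow> v = hd Y \<or> v = a)" using t(3) vm by auto
      qed
    qed
    then show ?thesis by simp
  qed
  have h2: "odd (length Y + length vs)" if s: "m = us @ k # vs" "E ?y k" "\<forall>v\<in>set vs. \<not> E ?y v" for us k vs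
  proof -
    have R: "cpath E (k # vs @ [b])"
    proof -
      have "cpath E (us @ (k # vs @ [b]))" using c(2) s by simp
      then show ?thesis by (simp only: cpath_append)
    qed
    have "cpath E (Y @ (k # vs @ [b]))"
    proof (rule cpath_appendI[OF Y(1) R])
      fix u v assume u: "u \<in> set Y" and v: "v \<in> set (k # vs @ [b])"
      show "u \<noteq> v \<and> (E u v \<longleftrightarrow> u = ?y \<and> v = hd (k # vs @ [b]))"
      proof (cases "v = b")
        case True
        then show ?thesis using Yab[OF u] bm[of k] s(1) by auto
      next
        case False
        then have vm: "v \<in> set (k # vs)" "v \<in> set m" using v s(1) by auto
        have "v = k \<longleftrightarrow> v \<notin> set vs" using vm cpath_distinct[OF cm] s(1) by auto
        then show ?thesis using Yn[OF u vm(2)] s(2,3) vm(1) by auto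
      qed
    qed
    then have "odd (length (Y @ (k # vs @ [b])))"
    proof (rule hole_close)
      show "3 \<le> length (Y @ k # vs @ [b])" using Y(2) by (cases Y) auto
      fix v assume v: "v \<in> set (Y @ k # vs @ [b])"
      have hq: "hd (Y @ k # vs @ [b]) = hd Y" "last (Y @ k # vs @ [b]) = b" using Y(2) by auto
      have "v \<in> set Y \<or> v = b \<or> v \<in> set m" using v s(1) by auto
      then show "t \<noteq> v \<and> (E t v \<longleftrightarrow> v = hd (Y @ k # vs @ [b]) \<or> v = last (Y @ k # vs @ [b]))"
        unfolding hq
      proof (elim disjE)
        assume vY: "v \<in> set Y"
        then show "t \<noteq> v \<and> (E t v \<longleftrightarrow> v = hd Y \<or> v = b)" using Y(4,6) Yab[OF vY] by auto
      next
        assume "v = b"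
        then show "t \<noteq> v \<and> (E t v \<longleftrightarrow> v = hd Y \<or> v = b)" using t(2) by auto
      next
        assume vm: "v \<in> set m"
        have "hd Y \<in> set Y" using Y(2) by simp
        then have "v \<noteq> hd Y" "v \<noteq> b" using Ym vm bm by auto
        then show "t \<noteq> v \<and> (E t v \<longleftrightarrow> v = hd Y \<or> v = b)" using t(3) vm by auto
      qed
    qed
    then show ?thesis by simp
  qed
  show False
  proof (rule first_last_split[OF ex])
    fix us k vs assume s: "m = us @ k # vs" "E ?y k" "\<forall>v\<in>set us \<union> set vs. \<not> E ?y v"
    \<comment> \<open>With a single neighbour \<open>k\<close>, the lists \<open>us\<close> and
      \<open>vs\<close> have lengths of equal parity, and \<open>m\<close> would be odd.\<close>
    then show False using h1[of us k vs] h2[of us k vs] m(1) by auto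
  next
    fix us k ws k' vs assume s: "m = us @ k # ws @ k' # vs" "E ?y k" "E ?y k'" "\<forall>v\<in>set us \<union> set vs. \<not> E ?y v"
    have par: "odd (length Y + length us)" "odd (length Y + length vs)"
      using h1[of us k "ws @ k' # vs"] h2[of "us @ k # ws" k' vs] s by auto
    have two: "cpath E ((a # us) @ [k])" "cpath E (k' # vs @ [b])"
    proof -
      have "cpath E ((a # us) @ k # ws @ k' # vs)" using c(1) s(1) by simp
      then show "cpath E ((a # us) @ [k])" by (rule cpath_two(1))
      have "cpath E (us @ k # ws @ k' # (vs @ [b]))" using c(2) s(1) by simp
      then show "cpath E (k' # vs @ [b])" by (rule cpath_two(2))
    qed
    have sep: "\<And>x z. x \<in> set (us @ [k]) \<Longrightarrow> z \<in> set (k' # vs) \<Longrightarrow> x \<noteq> z \<and> (E x z \<longleftrightarrow> ws = [] \<and> x = k \<and> z = k')"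
      using cpath_two(3)[of us k ws k' vs] cm s(1) by blast
    have sepa: "\<And>z. z \<in> set (k' # vs) \<Longrightarrow> a \<noteq> z \<and> \<not> E a z"
    proof -
      fix z assume z: "z \<in> set (k' # vs)"
      have "cpath E ([] @ a # (us @ [k] @ ws) @ k' # vs)" using c(1) s(1) by simp
      from cpath_two(3)[OF this] show "a \<noteq> z \<and> \<not> E a z" using z by auto
    qed
    have sepb: "\<And>z. z \<in> set (us @ [k]) \<Longrightarrow> z \<noteq> b \<and> \<not> E z b"
    proof -
      fix z assume z: "z \<in> set (us @ [k])"
      have "last m = last (k' # vs)" unfolding s(1) by simp
      then have "z \<in> set m" "z \<noteq> last m" using z s(1) sep[OF z] by auto
      then show "z \<noteq> b \<and> \<not> E z b" using bm by blast
    qed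
    have ka: "k \<noteq> a" "k' \<noteq> b" using am[of k] bm[of k'] s(1) by auto
    have sep2: "x \<noteq> z \<and> (E x z \<longleftrightarrow> (ws = [] \<and> x = k \<and> z = k') \<or> (x = a \<and> z = b))"
      if "x \<in> set (a # us @ [k])" "z \<in> set (k' # vs @ [b])" for x z
    proof -
      consider "x = a" "z = b" | "x = a" "z \<in> set (k' # vs)" | "x \<in> set (us @ [k])" "z = b"
        | "x \<in> set (us @ [k])" "z \<in> set (k' # vs)" using \<open>x \<in> set (a # us @ [k])\<close> \<open>z \<in> set (k' # vs @ [b])\<close> by auto
      then show ?thesis
      proof cases
        case 1 then show ?thesis using ab nab by auto
      next
        case 2 then show ?thesis using sepa[of z] ka bm[of z] s(1) by auto
      next
        case 3 then show ?thesis using sepb[of x] ka am[of x] s(1) by auto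
      next
        case 4 then show ?thesis using sep[of x z] sepa[of z] sepb[of x] am[of x] s(1) by auto
      qed
    qed
    have yn: "E ?y v \<longleftrightarrow> v = k" if "v \<in> set (a # us @ [k])" for v
      using \<open>v \<in> set (a # us @ [k])\<close> s(2,4) Yab[OF yY] by auto
    have yn': "E ?y v \<longleftrightarrow> v = k'" if "v \<in> set (k' # vs @ [b])" for v
      using \<open>v \<in> set (k' # vs @ [b])\<close> s(3,4) Yab[OF yY] by auto
    show False
    proof (cases "ws = []")
      case False
      \<comment> \<open>If \<open>k\<close> and \<open>k'\<close> are not consecutive, the hole from
        \<open>?y\<close> over \<open>k'\<close>, \<open>b\<close>, \<open>a\<close>,
        \<open>k\<close> has \<open>length us + length vs + 5\<close> vertices, an odd
        number.\<close>
      have "cpath E ((k' # vs @ [b]) @ (a # us @ [k]))"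
      proof (rule cpath_appendI)
        show "cpath E (k' # vs @ [b])" "cpath E (a # us @ [k])" using two by auto
        fix u v assume "u \<in> set (k' # vs @ [b])" "v \<in> set (a # us @ [k])"
        then show "u \<noteq> v \<and> (E u v \<longleftrightarrow> u = last (k' # vs @ [b]) \<and> v = hd (a # us @ [k]))"
          using sep2[of v u] False adj_comm[of u v] by auto
      qed
      then have "odd (length ((k' # vs @ [b]) @ (a # us @ [k])))"
      proof (rule hole_close)
        fix v assume v: "v \<in> set ((k' # vs @ [b]) @ (a # us @ [k]))"
        have hq: "hd ((k' # vs @ [b]) @ (a # us @ [k])) = k'" "last ((k' # vs @ [b]) @ (a # us @ [k])) = k" by auto
        have "?y \<noteq> v" using v Yab[OF yY] Yn[OF yY, of v] s(1) by auto
        moreover have "E ?y v \<longleftrightarrow> v = k' \<or> v = k"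
        proof (cases "v \<in> set (k' # vs @ [b])")
          case True
          then show ?thesis using yn'[OF True] sep2[of k v] by auto
        next
          case False
          then have "v \<in> set (a # us @ [k])" using v by auto
          then show ?thesis using yn[of v] sep2[of v k'] by auto
        qed
        ultimately show "?y \<noteq> v \<and> (E ?y v \<longleftrightarrow> v = hd ((k' # vs @ [b]) @ (a # us @ [k])) \<or> v = last ((k' # vs @ [b]) @ (a # us @ [k])))"
          unfolding hq by blast
      qed simp
      then show False using par by simp
    next
      case True
      have tY: "\<And>u. u \<in> set (rev Y @ [t]) \<Longrightarrow> u \<in> set Y \<or> u = t" by auto
      have cr: "cpath E (rev Y @ [t])"
      proof (rule cpath_appendI)
        show "cpath E (rev Y)" using Y(1) cpath_rev[OF symE] by blast
        fix u v assume "u \<in> set (rev Y)" "v \<in> set [t]"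
        then show "u \<noteq> v \<and> (E u v \<longleftrightarrow> u = last (rev Y) \<and> v = hd [t])"
          using Y(4,6) Yab[of u] adj_comm[of u t] by (auto simp: last_rev)
      qed simp
      have hl: "hd (rev Y @ [t]) = ?y" "last (rev Y @ [t]) = t" using Y(2) by (simp_all add: hd_rev)
      have ty: "t \<noteq> ?y" using Yab[OF yY] by auto
      have tm: "\<And>v. v \<in> set m \<Longrightarrow> t \<noteq> v \<and> \<not> E t v" using t(3) by blast
      \<comment> \<open>The triangles are \<open>?y\<close>, \<open>k\<close>, \<open>k'\<close> and
        \<open>t\<close>, \<open>a\<close>, \<open>b\<close>.\<close>
      have "prism_lists E (rev Y @ [t]) (k # rev us @ [a]) (k' # vs @ [b])"
        unfolding prism_lists_def cross_def
      proof (intro conjI ballI)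
        show "cpath E (k # rev us @ [a])" using two(1) cpath_rev[OF symE, of "a # us @ [k]"] by auto
        show "2 \<le> length (rev Y @ [t])" using Y(2) by (cases Y) auto
        fix u v assume u: "u \<in> set (rev Y @ [t])" and v: "v \<in> set (k # rev us @ [a])"
        then have v': "v \<in> set (a # us @ [k])" by auto
        have *: "u \<noteq> v \<and> (E u v \<longleftrightarrow> u = ?y \<and> v = k \<or> u = t \<and> v = a)"
        proof (cases "u = t")
          case True
          then show ?thesis using v' t(1) tm[of v] s(1) ty by auto
        next
          case False
          then have uY: "u \<in> set Y" using u by auto
          then show ?thesis using False Yab[OF uY] Yn[OF uY, of v] yn[OF v'] v' s(1,2) by auto
        qed
        then show "u \<noteq> v" "E u v = (u = hd (rev Y @ [t]) \<and> v = hd (k # rev us @ [a]) \<or> u = last (rev Y @ [t]) \<and> v = last (k # rev us @ [a]))"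
          unfolding hl by auto
      next
        fix u v assume u: "u \<in> set (rev Y @ [t])" and v: "v \<in> set (k' # vs @ [b])"
        have *: "u \<noteq> v \<and> (E u v \<longleftrightarrow> u = ?y \<and> v = k' \<or> u = t \<and> v = b)"
        proof (cases "u = t")
          case True
          then show ?thesis using v t(2) tm[of v] s(1) ty by auto
        next
          case False
          then have uY: "u \<in> set Y" using u by auto
          then show ?thesis using False Yab[OF uY] Yn[OF uY, of v] yn'[OF v] v s(1,3) by auto
        qed
        then show "u \<noteq> v" "E u v = (u = hd (rev Y @ [t]) \<and> v = hd (k' # vs @ [b]) \<or> u = last (rev Y @ [t]) \<and> v = last (k' # vs @ [b]))"
          unfolding hl by auto
      next
        fix u v assume "u \<in> set (k # rev us @ [a])" and v: "v \<in> set (k' # vs @ [b])"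
        then have u: "u \<in> set (a # us @ [k])" by auto
        show "u \<noteq> v" "E u v = (u = hd (k # rev us @ [a]) \<and> v = hd (k' # vs @ [b]) \<or> u = last (k # rev us @ [a]) \<and> v = last (k' # vs @ [b]))"
          using sep2[OF u v] True by auto
      qed (use cr two in auto)
      then show False using no_prism by blast
    qed
  qed
qed

text \<open>A shortest path \<open>Y\<close> leaves \<open>x1\<close> inside \<open>D\<close> and
  stops at the first vertex \<open>z\<close> that sees \<open>x2\<close> or \<open>q # n\<close>.
  Closing it in different ways gives holes with contradictory lengths; where the lengths agree,
  there is a prism. The choice of \<open>Y\<close> does not control the neighbours of
  \<open>r\<close> on it, which accounts for the case distinctions on them.\<close>

lemma no_leap:
  assumes c: "cpath E (a # q # n @ [r])" "cpath E ((q # n @ [r]) @ [b])" and ab: "E a b"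
    and n: "even (length n)" "n \<noteq> []"
    and x1: "E x1 a" "E x1 b" "E x1 r" "x1 \<notin> set (q # n)" "\<forall>v\<in>set (q # n). \<not> E x1 v"
    and x2: "E x2 a" "E x2 b" "E x2 q" "x2 \<notin> set (n @ [r])" "\<forall>v\<in>set (n @ [r]). \<not> E x2 v"
    and x12: "x1 \<noteq> x2" "\<not> E x1 x2"
    and D: "conn E D" "D \<inter> {a, b, x1, x2} = {}" "\<forall>d\<in>D. \<not> E d a \<and> \<not> E d b"
      "\<exists>d\<in>D. E x1 d" "\<exists>d\<in>D. E x2 d"
  shows False
proof -
  have ne: "u \<noteq> v" if "E u v" for u v using that by auto
  have cm: "cpath E (q # n @ [r])" using c(1) by simp
  have am: "\<And>v. v \<in> set (q # n @ [r]) \<Longrightarrow> a \<noteq> v \<and> (E a v \<longleftrightarrow> v = q)"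
    using c(1) by (simp only: cpath.simps(2)[of E a] list.sel) blast
  have bm: "\<And>v. v \<in> set (q # n @ [r]) \<Longrightarrow> v \<noteq> b \<and> (E v b \<longleftrightarrow> v = r)"
  proof -
    fix v assume v: "v \<in> set (q # n @ [r])"
    have "v \<noteq> b \<and> (E v b \<longleftrightarrow> v = last (q # n @ [r]) \<and> b = hd [b])"
      using c(2)[unfolded cpath_append[of E "q # n @ [r]" "[b]"]] v list.set_intros(1)[of b "[]"] by blast
    then show "v \<noteq> b \<and> (E v b \<longleftrightarrow> v = r)" by simp
  qed
  have cqn: "cpath E (q # n)" "cpath E (n @ [r])" using cm cpath_append[of E "q # n" "[r]"] by auto
  have qnr: "\<And>v. v \<in> set (q # n) \<Longrightarrow> v \<noteq> r \<and> (E v r \<longleftrightarrow> v = last n)"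
  proof -
    fix v assume v: "v \<in> set (q # n)"
    have "cpath E ((q # n) @ [r])" using cm by simp
    then have "v \<noteq> r \<and> (E v r \<longleftrightarrow> v = last (q # n) \<and> r = hd [r])"
      unfolding cpath_append using v list.set_intros(1)[of r "[]"] by blast
    then show "v \<noteq> r \<and> (E v r \<longleftrightarrow> v = last n)" using n(2) by simp
  qed
  have lq: "last n \<noteq> q" "last n \<in> set n" using cpath_distinct[OF cm] n(2) by auto
  have qr: "q \<noteq> r" "\<not> E q r" using qnr[of q] lq by auto
  have dis: "distinct (q # n @ [r])" by (rule cpath_distinct[OF cm])
  have nab: "a \<noteq> b" using ab by auto
  have ar: "a \<noteq> r" "\<not> E a r" "\<not> E q b" "q \<noteq> b" using am[of r] bm[of q] qr by auto
  have x1n: "\<And>v. v \<in> set (q # n) \<Longrightarrow> x1 \<noteq> v \<and> \<not> E x1 v \<and> \<not> E v x1" using x1(4,5) adj_sym by blast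
  have x2n: "\<And>v. v \<in> set (n @ [r]) \<Longrightarrow> x2 \<noteq> v \<and> \<not> E x2 v \<and> \<not> E v x2" using x2(4,5) adj_sym by blast
  have xne: "x1 \<noteq> a" "x1 \<noteq> b" "x1 \<noteq> r" "x2 \<noteq> a" "x2 \<noteq> b" "x2 \<noteq> q" "x1 \<noteq> q" "x2 \<noteq> r"
    using x1 x2 x1n[of q] x2n[of r] ne by auto
  have Es: "E a x1" "E b x1" "E r x1" "E a x2" "E b x2" "E q x2" "E b a" "E a q" "E q a" "E r b" "E b r"
     "\<not> E x2 x1" "\<not> E r q" "\<not> E r a" "\<not> E b q" "\<not> E x1 q" "\<not> E q x1" "\<not> E x2 r" "\<not> E r x2"
    using x1(1-3) x2(1-3) ab am[of q] bm[of r] x12 qr ar x1n[of q] x2n[of r] adj_sym by (auto dest: adj_sym)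
  obtain d1 d2 where "d1 \<in> D" "E x1 d1" "d2 \<in> D" "E x2 d2 \<or> (\<exists>v\<in>set (q # n). E d2 v)" using D(4,5) by blast
  from conn_link[OF irrE D(1), of d1 "E x1" d2 "\<lambda>d. E x2 d \<or> (\<exists>v\<in>set (q # n). E d v)", OF this]
  obtain Y where Y: "cpath E Y" "Y \<noteq> []" "set Y \<subseteq> D" "E x1 (hd Y)"
     "E x2 (last Y) \<or> (\<exists>v\<in>set (q # n). E (last Y) v)"
     "\<forall>y\<in>set Y. E x1 y \<longrightarrow> y = hd Y" "\<forall>y\<in>set Y. (E x2 y \<or> (\<exists>v\<in>set (q # n). E y v)) \<longrightarrow> y = last Y" by blast
  define z where "z = last Y"
  have zY: "z \<in> set Y" "hd Y \<in> set Y" using Y(2) by (simp_all add: z_def)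
  have qrD: "q \<notin> D" "r \<notin> D" using D(3) Es by blast+
  have nn: "\<exists>w\<in>set (q # n). E v w" if vn: "v \<in> set n" for v
  proof -
    obtain us vs where s: "n = us @ v # vs" using vn by (meson split_list)
    have "cpath E ((q # us) @ v # vs)" using cqn(1) s by simp
    then have "E (last (q # us)) v" unfolding cpath_append by (auto split: if_splits)
    moreover have "last (q # us) \<in> set (q # n)" using s by auto
    ultimately show ?thesis using adj_sym by blast
  qed
  \<comment> \<open>A vertex of \<open>n\<close> has a neighbour in \<open>q # n\<close>, so on
    \<open>Y\<close> it could only be the last vertex, and then its predecessor would have stopped
    the path.\<close>
  have Yn: "y \<notin> set (q # n @ [r])" if yY: "y \<in> set Y" for y
  proof
    assume "y \<in> set (q # n @ [r])"
    then have y: "y \<in> set n" using qrD yY Y(3) by auto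
    then have yl: "y = last Y" using Y(7) nn yY by blast
    have "y \<noteq> hd Y" using x1n[of y] y Y(4) by auto
    have "Y = butlast Y @ [y]" using yl Y(2) by simp
    moreover have "butlast Y \<noteq> []" using \<open>y \<noteq> hd Y\<close> calculation by (cases "butlast Y") auto
    ultimately obtain Z where Z: "Y = Z @ [y]" "Z \<noteq> []" by blast
    then have "E (last Z) y" "last Z \<in> set Y" using Y(1) last_in_set[of Z] unfolding Z(1) cpath_append by auto
    then have "last Z = y" using Y(7) y yl by (metis list.set_intros(2))
    moreover have "y \<notin> set Z" using cpath_distinct[OF Y(1)] Z by simp
    ultimately show False using Z(2) last_in_set by blast
  qed
  have Yab: "\<And>y. y \<in> set Y \<Longrightarrow> y \<noteq> a \<and> y \<noteq> b \<and> y \<noteq> x1 \<and> y \<noteq> x2 \<and> y \<noteq> q \<and> y \<noteq> r \<and> \<not> E y a \<and> \<not> E y b \<and> \<not> E a y \<and> \<not> E b y"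
    using Y(3) D(2,3) qrD adj_sym by blast
  have Y1: "\<And>y. y \<in> set Y \<Longrightarrow> (E x1 y \<longleftrightarrow> y = hd Y) \<and> (E y x1 \<longleftrightarrow> y = hd Y)" using Y(4,6) adj_sym by blast
  have Y2: "\<And>y. y \<in> set Y \<Longrightarrow> (E x2 y \<longleftrightarrow> y = z \<and> E x2 z) \<and> (E y x2 \<longleftrightarrow> y = z \<and> E x2 z)"
    using Y(7) adj_sym unfolding z_def by blast
  have Yq: "\<And>y v. y \<in> set Y \<Longrightarrow> v \<in> set (q # n) \<Longrightarrow> y \<noteq> v \<and> (E y v \<longrightarrow> y = z)"
    using Y(7) Yn unfolding z_def by (metis list.set_intros Un_iff set_append append_Cons)
  have c1: "cpath E (x1 # Y)" using Y(1) Y1 Yab by (intro cpath_ConsI) auto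
  have hY: "hd (Y @ ys) = hd Y" for ys using Y(2) by simp
  have lenY: "1 \<le> length Y" using Y(2) by (cases Y) auto
  \<comment> \<open>Hole through \<open>a\<close>, \<open>x1\<close>, \<open>Y\<close>,
    \<open>x2\<close>.\<close>
  have h0: "odd (length Y)" if zx: "E x2 z"
  proof -
    have "cpath E ((x1 # Y) @ [x2])"
    proof (rule cpath_appendI[OF c1])
      fix u v assume "u \<in> set (x1 # Y)" "v \<in> set [x2]"
      then show "u \<noteq> v \<and> (E u v \<longleftrightarrow> u = last (x1 # Y) \<and> v = hd [x2])"
        using x12 Y2[of u] Yab[of u] zx Y(2) zY Yab[of z] by (auto simp: z_def)
    qed simp
    then have "odd (length ((x1 # Y) @ [x2]))"
    proof (rule hole_close)
      show "3 \<le> length ((x1 # Y) @ [x2])" using lenY by simp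
      fix v assume "v \<in> set ((x1 # Y) @ [x2])"
      then show "a \<noteq> v \<and> (E a v \<longleftrightarrow> v = hd ((x1 # Y) @ [x2]) \<or> v = last ((x1 # Y) @ [x2]))"
        using Es xne Yab[of v] by auto
    qed
    then show ?thesis by simp
  qed
  have bwd: "cpath E (k # rev us)" "last (k # rev us) = q" if s: "q # n = us @ k # vs" for us k vs
  proof -
    have "cpath E ((us @ [k]) @ vs)" using cqn(1) s by simp
    then have "cpath E (us @ [k])" using cpath_infix[of E "[]" "us @ [k]" vs] by simp
    then have "cpath E (rev (us @ [k]))" using cpath_rev[OF symE] by blast
    then show "cpath E (k # rev us)" by simp
    show "last (k # rev us) = q" using s by (cases us) auto
  qed
  have Yback: "cpath E ((x1 # Y) @ k # rev us)" if s: "q # n = us @ k # vs" "E z k" "\<forall>v\<in>set us. \<not> E z v" for us k vs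
  proof (rule cpath_appendI[OF c1 bwd(1)[OF s(1)]])
    fix u v assume u: "u \<in> set (x1 # Y)" and v: "v \<in> set (k # rev us)"
    have vq: "v \<in> set (q # n)" unfolding s(1) using v by auto
    have vk: "v = k \<or> v \<in> set us" "E z v \<longleftrightarrow> v = k" using v s(2,3) by auto
    show "u \<noteq> v \<and> (E u v \<longleftrightarrow> u = last (x1 # Y) \<and> v = hd (k # rev us))"
    proof (cases "u = x1")
      case True
      then show ?thesis using x1n[OF vq] Y(2) zY Yab[of z] by (auto simp: z_def)
    next
      case False
      then have "u \<in> set Y" using u by simp
      then show ?thesis using Yq[OF _ vq, of u] vk Y(2) by (auto simp: z_def)
    qed
  qed
  \<comment> \<open>Hole through \<open>a\<close>, \<open>x1\<close>, \<open>Y\<close> and then from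
    the first neighbour \<open>k\<close> of \<open>z\<close> back to \<open>q\<close>.\<close>
  have hk: "odd (length Y + length us)" if s: "q # n = us @ k # vs" "E z k" "\<forall>v\<in>set us. \<not> E z v" for us k vs
  proof -
    from Yback[OF s] have "odd (length ((x1 # Y) @ k # rev us))"
    proof (rule hole_close)
      show "3 \<le> length ((x1 # Y) @ k # rev us)" using lenY by simp
      fix v assume v: "v \<in> set ((x1 # Y) @ k # rev us)"
      have l: "last ((x1 # Y) @ k # rev us) = q" using bwd(2)[OF s(1)] by simp
      have "v = x1 \<or> v \<in> set Y \<or> v \<in> set (q # n)" using v unfolding s(1) by auto
      then show "a \<noteq> v \<and> (E a v \<longleftrightarrow> v = hd ((x1 # Y) @ k # rev us) \<or> v = last ((x1 # Y) @ k # rev us))"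
      proof (elim disjE)
        assume "v = x1" then show ?thesis using Es xne l by auto
      next
        assume "v \<in> set Y" then show ?thesis using Yab[of v] l by auto
      next
        assume vq: "v \<in> set (q # n)"
        then have "v \<in> set (q # n @ [r])" by auto
        then show ?thesis using am[of v] x1n[OF vq] l by auto
      qed
    qed
    then show ?thesis by simp
  qed
  \<comment> \<open>Hole through \<open>r\<close>, the part of \<open>Y\<close> from the last
    neighbour \<open>g\<close> of \<open>r\<close> onwards, \<open>x2\<close> and
    \<open>b\<close>.\<close>
  have B: "even (length zs)" if s: "Y = ys @ g # zs" "E g r" "\<forall>v\<in>set zs. \<not> E v r" and zx: "E x2 z"
    for ys g zs
  proof -
    have "cpath E (ys @ (g # zs))" using Y(1) s by simp
    then have cg: "cpath E (g # zs)" by (simp only: cpath_append)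
    have lz: "last (g # zs) = z" unfolding z_def s(1) by simp
    have gY: "set (g # zs) \<subseteq> set Y" unfolding s(1) by auto
    have "cpath E ((g # zs) @ [x2, b])"
    proof (rule cpath_appendI[OF cg])
      show "cpath E [x2, b]" using x2 xne by simp
      fix u v assume u: "u \<in> set (g # zs)" and v: "v \<in> set [x2, b]"
      show "u \<noteq> v \<and> (E u v \<longleftrightarrow> u = last (g # zs) \<and> v = hd [x2, b])"
        unfolding lz using Yab[of u] Y2[of u] gY u v zx xne by auto
    qed
    then have "odd (length ((g # zs) @ [x2, b]))"
    proof (rule hole_close)
      fix v assume v: "v \<in> set ((g # zs) @ [x2, b])"
      have "v \<in> set Y \<Longrightarrow> v \<in> set (g # zs)" using v Yab[of v] by auto
      have gz: "g \<notin> set zs" using cpath_distinct[OF cg] by simp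
      have "v = g \<or> v \<in> set zs \<or> v = x2 \<or> v = b" using v by auto
      then show "r \<noteq> v \<and> (E r v \<longleftrightarrow> v = hd ((g # zs) @ [x2, b]) \<or> v = last ((g # zs) @ [x2, b]))"
      proof (elim disjE)
        assume "v = g" then show ?thesis using s(2) adj_sym ne by auto
      next
        assume "v \<in> set zs" then show ?thesis using s(3) gz Yab[of v] gY adj_sym[of r v] by auto
      next
        assume "v = x2" then show ?thesis using Es xne gY Yab[of g] by auto
      next
        assume "v = b" then show ?thesis using Es ne[of r b] by auto
      qed
    qed simp
    then show ?thesis by simp
  qed
  show False
  proof (cases "\<exists>v\<in>set (q # n). E z v")
    case True
    then obtain us k vs where s: "q # n = us @ k # vs" "E z k" "\<forall>v\<in>set us. \<not> E z v"
      using split_list_first_prop[OF True] by blast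
    show False
    proof (cases "E x2 z")
      case False
      have l: "last ((x1 # Y) @ k # rev us) = q" using bwd(2)[OF s(1)] by simp
      have "cpath E (((x1 # Y) @ k # rev us) @ [x2])"
      proof (rule cpath_appendI[OF Yback[OF s]])
        fix u v assume u: "u \<in> set ((x1 # Y) @ k # rev us)" and v: "v \<in> set [x2]"
        have "u = x1 \<or> u \<in> set Y \<or> u = q \<or> u \<in> set n" using u set_append[of us "k # vs"] s(1)[symmetric] by auto
        then show "u \<noteq> v \<and> (E u v \<longleftrightarrow> u = last ((x1 # Y) @ k # rev us) \<and> v = hd [x2])"
        proof (elim disjE)
          assume "u = x1" then show ?thesis using x12 v l xne by auto
        next
          assume "u \<in> set Y" then show ?thesis using Y2[of u] Yab[of u] False v l by auto
        next
          assume "u = q" then show ?thesis using v Es xne l by auto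
        next
          assume "u \<in> set n" then show ?thesis using x2n[of u] v l dis by auto
        qed
      qed simp
      \<comment> \<open>Closing by \<open>x2\<close> and \<open>b\<close> instead of
        \<open>a\<close> gives one vertex more than the hole of \<open>hk\<close>.\<close>
      then have "odd (length (((x1 # Y) @ k # rev us) @ [x2]))"
      proof (rule hole_close)
        fix v assume v: "v \<in> set (((x1 # Y) @ k # rev us) @ [x2])"
        have "v = x1 \<or> v \<in> set Y \<or> v \<in> set (q # n) \<or> v = x2" using v unfolding s(1) by auto
        then show "b \<noteq> v \<and> (E b v \<longleftrightarrow> v = hd (((x1 # Y) @ k # rev us) @ [x2]) \<or> v = last (((x1 # Y) @ k # rev us) @ [x2]))"
        proof (elim disjE)
          assume "v = x1" then show ?thesis using Es xne by auto
        next
          assume "v \<in> set Y" then show ?thesis using Yab[of v] by auto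
        next
          assume vq: "v \<in> set (q # n)"
          then have "v \<in> set (q # n @ [r])" by auto
          moreover have "v \<noteq> x2" using vq xne x2n[of v] by auto
          ultimately show ?thesis using bm[of v] qnr[OF vq] x1n[OF vq] adj_sym[of b v] by auto
        next
          assume "v = x2" then show ?thesis using Es xne by auto
        qed
      qed simp
      then show False using hk[OF s] by simp
    next
      case zx: True
      \<comment> \<open>Otherwise \<open>x2\<close>, \<open>z\<close> and the way from
        \<open>k\<close> back to \<open>q\<close> form a hole, so \<open>us\<close> is odd; by
        \<open>h0\<close> and \<open>hk\<close> it is even.\<close>
      have us: "us = []"
      proof (rule ccontr)
        assume une: "us \<noteq> []"
        have "cpath E (z # k # rev us)"
        proof (rule cpath_ConsI[OF bwd(1)[OF s(1)]])
          fix v assume v: "v \<in> set (k # rev us)"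
          then have "v \<in> set (q # n)" unfolding s(1) by auto
          then show "z \<noteq> v \<and> (E z v \<longleftrightarrow> v = hd (k # rev us))" using Yq[OF zY(1), of v] s(2,3) v by auto
        qed
        then have "odd (length (z # k # rev us))"
        proof (rule hole_close)
          show "3 \<le> length (z # k # rev us)" using une by (cases us) auto
          fix v assume v: "v \<in> set (z # k # rev us)"
          have l: "last (z # k # rev us) = q" using bwd(2)[OF s(1)] by simp
          have "v = z \<or> v = q \<or> v \<in> set n" using v set_append[of us "k # vs"] s(1)[symmetric] by auto
          then show "x2 \<noteq> v \<and> (E x2 v \<longleftrightarrow> v = hd (z # k # rev us) \<or> v = last (z # k # rev us))"
          proof (elim disjE)
            assume "v = z" then show ?thesis using zx ne l by auto
          next
            assume "v = q" then show ?thesis using x2 xne l by auto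
          next
            assume vn: "v \<in> set n"
            then have "v \<noteq> z" using Yn[OF zY(1)] by auto
            then show ?thesis using vn x2n[of v] dis l by auto
          qed
        qed
        then show False using h0[OF zx] hk[OF s] by simp
      qed
      then have zq: "E z q" using s by simp
      show False
      proof (cases "\<exists>y\<in>set Y. E y r")
        case yr: True
        then obtain ys g zs where g: "Y = ys @ g # zs" "E g r" "\<forall>v\<in>set zs. \<not> E v r"
          using split_list_last_prop[OF yr] by blast
        have "cpath E (ys @ (g # zs))" using Y(1) g by simp
        then have cg: "cpath E (g # zs)" by (simp only: cpath_append)
        have lz: "last (g # zs) = z" unfolding z_def g(1) by simp
        have gY: "set (g # zs) \<subseteq> set Y" unfolding g(1) by auto
        have "cpath E ((g # zs) @ [q, a, b])"
        proof (rule cpath_appendI[OF cg])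
          show "cpath E [q, a, b]" using Es ar ab nab ne[of q a] by auto
          fix u v assume u: "u \<in> set (g # zs)" and v: "v \<in> set [q, a, b]"
          then show "u \<noteq> v \<and> (E u v \<longleftrightarrow> u = last (g # zs) \<and> v = hd [q, a, b])"
            unfolding lz using Yab[of u] Yq[of u q] gY u v zq am[of q] ar by auto
        qed
        \<comment> \<open>Going round by \<open>q\<close> and \<open>a\<close> instead of
          \<open>x2\<close> gives one vertex more than the hole of \<open>B\<close>.\<close>
        then have "odd (length ((g # zs) @ [q, a, b]))"
        proof (rule hole_close)
          fix v assume v: "v \<in> set ((g # zs) @ [q, a, b])"
          have gz: "g \<notin> set zs" using cpath_distinct[OF cg] by simp
          have "v = g \<or> v \<in> set zs \<or> v = q \<or> v = a \<or> v = b" using v by auto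
          then show "r \<noteq> v \<and> (E r v \<longleftrightarrow> v = hd ((g # zs) @ [q, a, b]) \<or> v = last ((g # zs) @ [q, a, b]))"
          proof (elim disjE)
            assume "v = g" then show ?thesis using g(2) adj_sym ne by auto
          next
            assume "v \<in> set zs" then show ?thesis using g(3) gz Yab[of v] gY adj_sym[of r v] by auto
          next
            assume "v = q" then show ?thesis using Es qr ar gY Yab[of g] by auto
          next
            assume "v = a" then show ?thesis using Es ar nab gY Yab[of g] by auto
          next
            assume "v = b" then show ?thesis using Es ne[of r b] by auto
          qed
        qed simp
        then show False using B[OF g zx] by simp
      next
        case nr: False
        obtain us' k' vs' where s': "q # n = us' @ k' # vs'" "E z k'" "\<forall>v\<in>set vs'. \<not> E z v"
          using split_list_last_prop[OF True] by blast
        have Yr: "\<And>y. y \<in> set Y \<Longrightarrow> \<not> E y r \<and> \<not> E r y" using nr adj_sym by blast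
        show False
        proof (cases "us' = []")
          case True
          then have only: "\<And>v. v \<in> set n \<Longrightarrow> \<not> E z v" using s' by auto
          have cr: "cpath E (rev Y @ [x1])" using c1 cpath_rev[OF symE, of "x1 # Y"] by simp
          have hl: "hd (rev Y @ [x1]) = z" "last (rev Y @ [x1]) = x1" using Y(2) by (simp_all add: hd_rev z_def)
          \<comment> \<open>The triangles are \<open>x2\<close>, \<open>z\<close>, \<open>q\<close>
            and \<open>b\<close>, \<open>x1\<close>, \<open>r\<close>.\<close>
          have "prism_lists E [x2, b] (rev Y @ [x1]) (q # n @ [r])"
            unfolding prism_lists_def cross_def
          proof (intro conjI ballI)
            show "cpath E [x2, b]" using x2 xne by simp
            show "2 \<le> length (rev Y @ [x1])" using lenY by simp
            fix u v assume u: "u \<in> set [x2, b]" and v: "v \<in> set (rev Y @ [x1])"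
            then have "v = x1 \<or> v \<in> set Y" by auto
            then have "u \<noteq> v \<and> (E u v \<longleftrightarrow> u = x2 \<and> v = z \<or> u = b \<and> v = x1)"
              using u Yab[of v] Y2[of v] x12 xne Es zx Yab[OF zY(1)] by auto
            then show "u \<noteq> v" "E u v = (u = hd [x2, b] \<and> v = hd (rev Y @ [x1]) \<or> u = last [x2, b] \<and> v = last (rev Y @ [x1]))"
              unfolding hl by auto
          next
            fix u v assume u: "u \<in> set [x2, b]" and v: "v \<in> set (q # n @ [r])"
            have "u \<noteq> v \<and> (E u v \<longleftrightarrow> u = x2 \<and> v = q \<or> u = b \<and> v = r)"
            proof (cases "u = b")
              case True
              then show ?thesis using bm[OF v] adj_comm[of b v] xne by auto
            next
              case False
              then have "u = x2" using u by simp
              moreover have "v = q \<or> v \<in> set (n @ [r])" using v by auto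
              ultimately show ?thesis using x2 xne x2n[of v] qr dis by auto
            qed
            then show "u \<noteq> v" "E u v = (u = hd [x2, b] \<and> v = hd (q # n @ [r]) \<or> u = last [x2, b] \<and> v = last (q # n @ [r]))"
              by auto
          next
            fix u v assume u: "u \<in> set (rev Y @ [x1])" and v: "v \<in> set (q # n @ [r])"
            have vv: "v = q \<or> v \<in> set n \<or> v = r" using v by auto
            have "u \<noteq> v \<and> (E u v \<longleftrightarrow> u = z \<and> v = q \<or> u = x1 \<and> v = r)"
            proof (cases "u = x1")
              case True
              then show ?thesis using vv x1n[of v] x1(3) xne Yab[OF zY(1)] qr dis by auto
            next
              case False
              then have uY: "u \<in> set Y" using u by simp
              then show ?thesis using vv Yq[OF uY, of v] Yr[OF uY] zq only[of v] Yab[OF uY] False dis by auto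
            qed
            then show "u \<noteq> v" "E u v = (u = hd (rev Y @ [x1]) \<and> v = hd (q # n @ [r]) \<or> u = last (rev Y @ [x1]) \<and> v = last (q # n @ [r]))"
              unfolding hl by auto
          qed (use cr cm in auto)
          then show False using no_prism by blast
        next
          case False
          have "cpath E (us' @ (k' # vs' @ [r]))" using cm s'(1) by (metis append_Cons append_assoc)
          then have ck: "cpath E (k' # vs' @ [r])" by (simp only: cpath_append)
          have sub: "set (k' # vs') \<subseteq> set n" using False s'(1) by (cases us') auto
          have ckb: "cpath E ((k' # vs' @ [r]) @ [b])"
          proof (rule cpath_appendI[OF ck])
            fix u v assume u: "u \<in> set (k' # vs' @ [r])" and v: "v \<in> set [b]"
            then have "u \<in> set (q # n @ [r])" using sub by auto
            then show "u \<noteq> v \<and> (E u v \<longleftrightarrow> u = last (k' # vs' @ [r]) \<and> v = hd [b])" using bm[of u] v by auto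
          qed simp
          have kd: "k' \<notin> set vs'" using cpath_distinct[OF ck] by simp
          have "cpath E (z # ((k' # vs' @ [r]) @ [b]))"
          proof (rule cpath_ConsI[OF ckb])
            fix v assume v: "v \<in> set ((k' # vs' @ [r]) @ [b])"
            have "v = k' \<or> v \<in> set vs' \<or> v = r \<or> v = b" using v by auto
            then show "z \<noteq> v \<and> (E z v \<longleftrightarrow> v = hd ((k' # vs' @ [r]) @ [b]))"
              using s'(2,3) Yr[OF zY(1)] Yab[OF zY(1)] Yn[OF zY(1)] sub kd by auto
          qed
          \<comment> \<open>This hole, closed by \<open>x2\<close>, makes \<open>vs'\<close> odd;
            the one below, closed by \<open>x1\<close>, makes it even, because
            \<open>length Y\<close> is odd.\<close>
          then have "odd (length (z # ((k' # vs' @ [r]) @ [b])))"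
          proof (rule hole_close)
            fix v assume v: "v \<in> set (z # ((k' # vs' @ [r]) @ [b]))"
            have "v = z \<or> v \<in> set (n @ [r]) \<or> v = b" using v sub by auto
            then show "x2 \<noteq> v \<and> (E x2 v \<longleftrightarrow> v = hd (z # ((k' # vs' @ [r]) @ [b])) \<or> v = last (z # ((k' # vs' @ [r]) @ [b])))"
            proof (elim disjE)
              assume "v = z" then show ?thesis using zx ne by auto
            next
              assume vn: "v \<in> set (n @ [r])"
              then have "v \<in> set (q # n @ [r])" by auto
              then have "v \<noteq> z" "v \<noteq> b" using Yn[OF zY(1)] bm[of v] by auto
              then show ?thesis using x2n[OF vn] by auto
            next
              assume "v = b" then show ?thesis using x2 xne by auto
            qed
          qed simp
          then have 1: "odd (length vs')" by simp
          have "cpath E (Y @ (k' # vs' @ [r]))"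
          proof (rule cpath_appendI[OF Y(1) ck])
            fix u v assume u: "u \<in> set Y" and v: "v \<in> set (k' # vs' @ [r])"
            have "v = k' \<or> v \<in> set vs' \<or> v = r" using v by auto
            then show "u \<noteq> v \<and> (E u v \<longleftrightarrow> u = last Y \<and> v = hd (k' # vs' @ [r]))"
            proof (elim disjE)
              assume "v = r" then show ?thesis using Yr[OF u] Yab[OF u] qnr[of k'] sub by auto
            next
              assume "v = k'" then show ?thesis using Yq[OF u, of k'] sub s'(2) by (auto simp: z_def)
            next
              assume "v \<in> set vs'" then show ?thesis using Yq[OF u, of v] sub s'(3) kd by (auto simp: z_def)
            qed
          qed
          then have "odd (length (Y @ (k' # vs' @ [r])))"
          proof (rule hole_close)
            show "3 \<le> length (Y @ k' # vs' @ [r])" using lenY by simp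
            fix v assume v: "v \<in> set (Y @ k' # vs' @ [r])"
            have hq: "hd (Y @ k' # vs' @ [r]) = hd Y" "last (Y @ k' # vs' @ [r]) = r" using Y(2) by auto
            have "v \<in> set Y \<or> v \<in> set n \<or> v = r" using v sub by auto
            then show "x1 \<noteq> v \<and> (E x1 v \<longleftrightarrow> v = hd (Y @ k' # vs' @ [r]) \<or> v = last (Y @ k' # vs' @ [r]))"
              unfolding hq
            proof (elim disjE)
              assume vY: "v \<in> set Y" then show "x1 \<noteq> v \<and> (E x1 v \<longleftrightarrow> v = hd Y \<or> v = r)" using Y1[OF vY] Yab[OF vY] by auto
            next
              assume vn: "v \<in> set n"
              then have "v \<noteq> hd Y" "v \<noteq> r" using Yn[OF zY(2)] dis by auto
              then show "x1 \<noteq> v \<and> (E x1 v \<longleftrightarrow> v = hd Y \<or> v = r)" using vn x1n[of v] by auto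
            next
              assume "v = r" then show "x1 \<noteq> v \<and> (E x1 v \<longleftrightarrow> v = hd Y \<or> v = r)" using x1 xne by auto
            qed
          qed
          then show False using 1 h0[OF zx] by simp
        qed
      qed
    qed
  next
    case none: False
    then have zx: "E x2 z" using Y(5) z_def by auto
    have Yq': "\<And>y v. y \<in> set Y \<Longrightarrow> v \<in> set (q # n) \<Longrightarrow> y \<noteq> v \<and> \<not> E y v \<and> \<not> E v y" using none Yq adj_sym by blast
    have cYx: "cpath E (Y @ [x2])"
    proof (rule cpath_appendI[OF Y(1)])
      fix u v assume "u \<in> set Y" "v \<in> set [x2]"
      then show "u \<noteq> v \<and> (E u v \<longleftrightarrow> u = last Y \<and> v = hd [x2])" using Y2[of u] Yab[of u] zx by (auto simp: z_def)
    qed simp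
    show False
    proof (cases "\<exists>y\<in>set Y. E y r")
      case False
      then have Yr: "\<And>y. y \<in> set Y \<Longrightarrow> \<not> E y r \<and> \<not> E r y" using adj_sym by blast
      have "cpath E ((Y @ [x2]) @ (q # n @ [r]))"
      proof (rule cpath_appendI[OF cYx cm])
        fix u v assume u: "u \<in> set (Y @ [x2])" and v: "v \<in> set (q # n @ [r])"
        have vv: "v \<in> set (q # n) \<or> v = r" "v = q \<or> v \<in> set (n @ [r])" using v by auto
        show "u \<noteq> v \<and> (E u v \<longleftrightarrow> u = last (Y @ [x2]) \<and> v = hd (q # n @ [r]))"
        proof (cases "u = x2")
          case True
          then show ?thesis using vv(2) x2 xne x2n[of v] dis by auto
        next
          case False
          then have "u \<in> set Y" using u by simp
          then show ?thesis using False vv(1) Yq'[of u v] Yr[of u] Yab[of u] by auto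
        qed
      qed
      \<comment> \<open>This hole through \<open>x1\<close> is odd, since \<open>length Y\<close> is
        odd by \<open>h0\<close> and \<open>length n\<close> is even.\<close>
      then have "odd (length ((Y @ [x2]) @ (q # n @ [r])))"
      proof (rule hole_close)
        fix v assume v: "v \<in> set ((Y @ [x2]) @ (q # n @ [r]))"
        have hq: "hd ((Y @ [x2]) @ (q # n @ [r])) = hd Y" "last ((Y @ [x2]) @ (q # n @ [r])) = r" using Y(2) by auto
        have "v \<in> set Y \<or> v = x2 \<or> v \<in> set (q # n) \<or> v = r" using v by auto
        then show "x1 \<noteq> v \<and> (E x1 v \<longleftrightarrow> v = hd ((Y @ [x2]) @ (q # n @ [r])) \<or> v = last ((Y @ [x2]) @ (q # n @ [r])))"
          unfolding hq
        proof (elim disjE)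
          assume vY: "v \<in> set Y" then show "x1 \<noteq> v \<and> (E x1 v \<longleftrightarrow> v = hd Y \<or> v = r)" using Y1[OF vY] Yab[OF vY] by auto
        next
          assume "v = x2" then show "x1 \<noteq> v \<and> (E x1 v \<longleftrightarrow> v = hd Y \<or> v = r)" using x12 Yab[OF zY(2)] xne by auto
        next
          assume vn: "v \<in> set (q # n)"
          then have "v \<noteq> hd Y" "v \<noteq> r" using Yn[OF zY(2)] qnr[OF vn] by auto
          then show "x1 \<noteq> v \<and> (E x1 v \<longleftrightarrow> v = hd Y \<or> v = r)" using x1n[OF vn] by auto
        next
          assume "v = r" then show "x1 \<noteq> v \<and> (E x1 v \<longleftrightarrow> v = hd Y \<or> v = r)" using x1 xne by auto
        qed
      qed simp
      then show False using h0[OF zx] n by simp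
    next
      case yr: True
      then obtain ys g zs where g: "Y = ys @ g # zs" "E g r" "\<forall>v\<in>set zs. \<not> E v r"
        using split_list_last_prop[OF yr] by blast
      have "cpath E (ys @ (g # zs))" using Y(1) g by simp
      then have cg: "cpath E (g # zs)" by (simp only: cpath_append)
      have lz: "last (g # zs) = z" unfolding z_def g(1) by simp
      have gY: "set (g # zs) \<subseteq> set Y" unfolding g(1) by auto
      have gz: "g \<notin> set zs" using cpath_distinct[OF cg] by simp
      show False
      proof (cases "ys = []")
        case False
        have nh: "\<And>v. v \<in> set (g # zs) \<Longrightarrow> v \<noteq> hd Y"
          using False g(1) cpath_distinct[OF Y(1)] by (cases ys) auto
        have "cpath E ((g # zs) @ [x2, a, x1])"
        proof (rule cpath_appendI[OF cg])
          show "cpath E [x2, a, x1]" using x2 xne Es x12 by auto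
          fix u v assume u: "u \<in> set (g # zs)" and v: "v \<in> set [x2, a, x1]"
          show "u \<noteq> v \<and> (E u v \<longleftrightarrow> u = last (g # zs) \<and> v = hd [x2, a, x1])"
            unfolding lz using Yab[of u] Y2[of u] Y1[of u] nh[OF u] gY u v zx xne x12 by auto
        qed
        \<comment> \<open>As \<open>g\<close> is not the head of \<open>Y\<close>, the tail from
          \<open>g\<close> misses \<open>x1\<close>; \<open>a\<close> and \<open>x1\<close> in place
          of \<open>b\<close> give one vertex more than the hole of \<open>B\<close>.\<close>
        then have "odd (length ((g # zs) @ [x2, a, x1]))"
        proof (rule hole_close)
          fix v assume v: "v \<in> set ((g # zs) @ [x2, a, x1])"
          have "v = g \<or> v \<in> set zs \<or> v = x2 \<or> v = a \<or> v = x1" using v by auto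
          then show "r \<noteq> v \<and> (E r v \<longleftrightarrow> v = hd ((g # zs) @ [x2, a, x1]) \<or> v = last ((g # zs) @ [x2, a, x1]))"
          proof (elim disjE)
            assume "v = g" then show ?thesis using g(2) adj_sym ne by auto
          next
            assume "v \<in> set zs" then show ?thesis using g(3) gz Yab[of v] gY adj_sym[of r v] by auto
          next
            assume "v = x2" then show ?thesis using Es xne x12 gY Yab[of g] by auto
          next
            assume "v = a" then show ?thesis using Es ar xne gY Yab[of g] by auto
          next
            assume "v = x1" then show ?thesis using Es xne by auto
          qed
        qed simp
        then show False using B[OF g zx] by simp
      next
        case True
        then have gh: "Y = g # zs" using g(1) by simp
        then have hg: "hd Y = g" by simp
        have cr: "cpath E (r # rev n @ [q])" using cm cpath_rev[OF symE, of "q # n @ [r]"] by simp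
        have hl: "hd (Y @ [x2]) = g" "last (Y @ [x2]) = x2" unfolding gh by simp_all
        have Yr: "\<And>y. y \<in> set Y \<Longrightarrow> (E y r \<longleftrightarrow> y = g)" using g(2,3) unfolding gh by auto
        \<comment> \<open>The triangles are \<open>x1\<close>, \<open>g\<close>, \<open>r\<close>
          and \<open>a\<close>, \<open>x2\<close>, \<open>q\<close>.\<close>
        have "prism_lists E [x1, a] (Y @ [x2]) (r # rev n @ [q])"
          unfolding prism_lists_def cross_def
        proof (intro conjI ballI)
          show "cpath E [x1, a]" using x1 xne by simp
          show "2 \<le> length (Y @ [x2])" using lenY by simp
          fix u v assume u: "u \<in> set [x1, a]" and v: "v \<in> set (Y @ [x2])"
          then have "v = x2 \<or> v \<in> set Y" by auto
          then have "u \<noteq> v \<and> (E u v \<longleftrightarrow> u = x1 \<and> v = g \<or> u = a \<and> v = x2)"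
            using u Yab[of v] Y1[of v] x12 xne Es hg Yab[OF zY(2)] by auto
          then show "u \<noteq> v" "E u v = (u = hd [x1, a] \<and> v = hd (Y @ [x2]) \<or> u = last [x1, a] \<and> v = last (Y @ [x2]))"
            unfolding hl by auto
        next
          fix u v assume u: "u \<in> set [x1, a]" and v0: "v \<in> set (r # rev n @ [q])"
          then have v: "v \<in> set (q # n @ [r])" "v = r \<or> v \<in> set (q # n)" by auto
          have "u \<noteq> v \<and> (E u v \<longleftrightarrow> u = x1 \<and> v = r \<or> u = a \<and> v = q)"
          proof (cases "u = a")
            case True
            then show ?thesis using am[OF v(1)] xne by auto
          next
            case False
            then have "u = x1" using u by simp
            then show ?thesis using v(2) x1 xne x1n[of v] qnr[of v] by auto
          qed
          then show "u \<noteq> v" "E u v = (u = hd [x1, a] \<and> v = hd (r # rev n @ [q]) \<or> u = last [x1, a] \<and> v = last (r # rev n @ [q]))"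
            by auto
        next
          fix u v assume u: "u \<in> set (Y @ [x2])" and v0: "v \<in> set (r # rev n @ [q])"
          then have v: "v = r \<or> v \<in> set (q # n)" "v = q \<or> v \<in> set (n @ [r])" by auto
          have "u \<noteq> v \<and> (E u v \<longleftrightarrow> u = g \<and> v = r \<or> u = x2 \<and> v = q)"
          proof (cases "u = x2")
            case True
            then show ?thesis using v(2) x2 xne x2n[of v] Yab[OF zY(2)] hg dis by auto
          next
            case False
            then have uY: "u \<in> set Y" using u by simp
            then show ?thesis using v(1) Yq'[OF uY, of v] Yr[OF uY] Yab[OF uY] False qnr[of v] by auto
          qed
          then show "u \<noteq> v" "E u v = (u = hd (Y @ [x2]) \<and> v = hd (r # rev n @ [q]) \<or> u = last (Y @ [x2]) \<and> v = last (r # rev n @ [q]))"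
            unfolding hl by auto
        qed (use cr cYx in auto)
        then show False using no_prism by blast
      qed
    qed
  qed
qed

text \<open>The counterpart of \<open>no_leap\<close> for a hole \<open>a q r b\<close> with four
  vertices. By Roussel-Rubio, a path from \<open>q\<close> through \<open>D\<close> to
  \<open>x1\<close> contains a vertex \<open>d\<close> of \<open>D\<close> complete to
  \<open>r\<close> and to \<open>X - {x1}\<close>. An antipath in \<open>X\<close> from
  \<open>x2\<close> to \<open>x1\<close> is closed by \<open>d\<close>, \<open>a\<close>,
  \<open>r\<close>, and additionally by \<open>q\<close>, or by \<open>q\<close> and
  \<open>b\<close>, according to whether \<open>d\<close> sees \<open>x1\<close> and
  \<open>q\<close>.\<close>

lemma no_square:
  assumes e: "E a q" "E q r" "E r b" "E a b" "\<not> E a r" "\<not> E q b" "a \<noteq> r" "q \<noteq> b"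
    and X: "finite X" "conn (non_adj E) X" "x1 \<in> X" "x2 \<in> X" "x1 \<noteq> x2" "conn (non_adj E) (X - {x1})" "X \<inter> {a, b, q, r} = {}"
    and co: "complete_to a X" "complete_to b X" "complete_to q (X - {x1})" "\<not> E q x1" "complete_to r (X - {x2})" "\<not> E r x2"
    and D: "conn E D" "D \<inter> X = {}" "a \<notin> D" "b \<notin> D" "\<forall>d\<in>D. \<not> E d a \<and> \<not> E d b"
      "\<exists>d\<in>D. E x1 d" "\<exists>d\<in>D. E q d"
  shows False
proof -
  have ne: "u \<noteq> v" if "E u v" for u v using that not_self by metis
  have Es: "E q a" "E r q" "E b r" "E b a" "\<not> E r a" "\<not> E b q" "a \<noteq> b" "a \<noteq> q" "q \<noteq> r" "r \<noteq> b"
    using e ne adj_sym by blast+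
  have x1ne: "x1 \<noteq> a" "x1 \<noteq> b" "x1 \<noteq> q" "x1 \<noteq> r" "x2 \<noteq> r" "x2 \<noteq> a" using X by auto
  have ex: "E a x1" "E b x1" "E x1 a" "E x1 b" "\<not> E x1 q"
    using co X(3) adj_sym unfolding complete_to_def by blast+
  obtain d1 d2 where d: "d1 \<in> D" "E q d1" "d2 \<in> D" "E x1 d2" using D(6,7) by blast
  from conn_link[OF irrE D(1), of d1 "E q" d2 "E x1", OF this]
  obtain Y where Y: "cpath E Y" "Y \<noteq> []" "set Y \<subseteq> D" "E q (hd Y)" "E x1 (last Y)"
     "\<forall>y\<in>set Y. E q y \<longrightarrow> y = hd Y" "\<forall>y\<in>set Y. E x1 y \<longrightarrow> y = last Y" by blast
  have Yab: "\<And>y. y \<in> set Y \<Longrightarrow> y \<noteq> a \<and> y \<noteq> b \<and> y \<notin> X \<and> y \<noteq> q \<and> y \<noteq> r \<and> \<not> E y a \<and> \<not> E y b \<and> \<not> E a y \<and> \<not> E b y"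
    using Y(3) D(2-5) Es e adj_sym by blast
  have Y1: "\<And>y. y \<in> set Y \<Longrightarrow> (E q y \<longleftrightarrow> y = hd Y) \<and> (E y x1 \<longleftrightarrow> y = last Y)" using Y(4-7) adj_sym by blast
  have cq: "cpath E (q # Y)"
  proof (rule cpath_ConsI[OF Y(1)])
    fix v assume "v \<in> set Y"
    then show "q \<noteq> v \<and> (E q v \<longleftrightarrow> v = hd Y)" using Y1 Yab by blast
  qed
  have app: "u \<noteq> x1 \<and> (E u x1 \<longleftrightarrow> u = last (q # Y))" if "u \<in> set (q # Y)" for u
  proof (cases "u = q")
    case True
    have "last Y \<in> set Y" using Y(2) by simp
    then have "q \<noteq> last Y" using Yab by blast
    then show ?thesis using True x1ne co(4) Y(2) by simp
  next
    case False
    then have "u \<in> set Y" using \<open>u \<in> set (q # Y)\<close> by simp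
    then show ?thesis using Y1[of u] Yab[of u] X(3) Y(2) by auto
  qed
  have cqx: "cpath E ((q # Y) @ [x1])"
    by (rule cpath_appendI[OF cq]) (use app in auto)
  then have "odd (length ((q # Y) @ [x1]))"
  proof (rule hole_close)
    show "3 \<le> length ((q # Y) @ [x1])" using Y(2) by (cases Y) auto
    fix v assume "v \<in> set ((q # Y) @ [x1])"
    then have "v = q \<or> v \<in> set Y \<or> v = x1" by auto
    then show "a \<noteq> v \<and> (E a v \<longleftrightarrow> v = hd ((q # Y) @ [x1]) \<or> v = last ((q # Y) @ [x1]))"
      using e Es ex x1ne Yab[of v] by auto
  qed
  then have par: "odd (length Y)" by simp
  \<comment> \<open>Exchanging \<open>x1\<close> for \<open>r\<close> keeps the set anticonnected,
    because \<open>r\<close> misses \<open>x2\<close>. The path from \<open>q\<close> over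
    \<open>Y\<close> and \<open>x1\<close> to \<open>b\<close> has an even number of vertices and
    complete ends, and \<open>x1\<close> itself is not complete to the new set, so the complete
    interior vertex lies on \<open>Y\<close>.\<close>
  let ?T = "insert r (X - {x1})"
  have "conn (non_adj E) ?T"
    using conn_insert[OF X(6), of x2 r] X(4,5) co(6) x1ne adj_sym[of x2 r] by auto
  then have R: "rr ?T" using roussel_rubio[of ?T] X(1) by auto
  have cqb: "cpath E (((q # Y) @ [x1]) @ [b])"
  proof (rule cpath_appendI[OF cqx])
    fix u v assume u: "u \<in> set ((q # Y) @ [x1])" and "v \<in> set [b]"
    moreover have "u = q \<or> u \<in> set Y \<or> u = x1" using u by auto
    ultimately show "u \<noteq> v \<and> (E u v \<longleftrightarrow> u = last ((q # Y) @ [x1]) \<and> v = hd [b])"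
      using e Es ex x1ne Yab[of u] by auto
  qed simp
  have "\<exists>v\<in>set (((q # Y) @ [x1]) @ [b]) - {q, b}. complete_to v ?T"
  proof -
    have "4 \<le> length (((q # Y) @ [x1]) @ [b])" "even (length (((q # Y) @ [x1]) @ [b]))" using par Y(2) by (cases Y; auto)+
    moreover have "set (((q # Y) @ [x1]) @ [b]) \<inter> ?T = {}" using Yab X(7) Es x1ne by auto
    moreover have "complete_to q ?T" "complete_to b ?T"
      using co e(2) Es(3) unfolding complete_to_def by auto
    ultimately show ?thesis using R[unfolded rr_def, rule_format, OF cqb] by auto
  qed
  moreover have "\<not> complete_to x1 ?T"
    using anti_nonneighbor[OF X(2,3)] X(4,5) complete_to_mono[of x1 ?T "X - {x1}"] by auto
  ultimately obtain d where d: "d \<in> set Y" "complete_to d ?T" by auto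
  obtain Q where Q: "cpath (non_adj E) Q" "Q \<noteq> []" "set Q \<subseteq> X" "hd Q = x2" "last Q = x1"
    using conn_cpath_ex[OF irreflp_non_adj X(2,4,3)] by blast
  have lQ: "2 \<le> length Q" using Q(2,4,5) X(5) by (cases Q; cases "tl Q") auto
  have nQ: "\<And>v. v \<in> set Q \<Longrightarrow> v \<noteq> a \<and> v \<noteq> b \<and> v \<noteq> q \<and> v \<noteq> r \<and> v \<noteq> d \<and> v \<in> X"
    using Q(3) X(7) Yab[OF d(1)] by blast
  have aQ: "\<And>v. v \<in> set Q \<Longrightarrow> E a v \<and> E v a \<and> E v b \<and> (E r v \<longleftrightarrow> v \<noteq> x2) \<and> (E v q \<longleftrightarrow> v \<noteq> x1) \<and> (v \<noteq> x1 \<longrightarrow> E d v)"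
  proof -
    fix v assume v: "v \<in> set Q"
    have "E a v" "E b v" "E r v \<longleftrightarrow> v \<noteq> x2" "E q v \<longleftrightarrow> v \<noteq> x1" "v \<noteq> x1 \<longrightarrow> E d v"
      using co d(2) nQ[OF v] unfolding complete_to_def by auto
    then show "E a v \<and> E v a \<and> E v b \<and> (E r v \<longleftrightarrow> v \<noteq> x2) \<and> (E v q \<longleftrightarrow> v \<noteq> x1) \<and> (v \<noteq> x1 \<longrightarrow> E d v)"
      using adj_sym by blast
  qed
  have dd: "\<not> E d a" "\<not> E d b" "d \<noteq> a" "d \<noteq> b" "d \<noteq> q" "d \<noteq> r" "E d r"
    using Yab[OF d(1)] d(2) unfolding complete_to_def by auto
  have c1: "cpath (non_adj E) ([a, r] @ Q)"
  proof (rule cpath_appendI[OF _ Q(1)])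
    show "cpath (non_adj E) [a, r]" using e by simp
    fix u v assume u: "u \<in> set [a, r]" and v: "v \<in> set Q"
    then show "u \<noteq> v \<and> (non_adj E u v \<longleftrightarrow> u = last [a, r] \<and> v = hd Q)"
      using aQ[OF v] nQ[OF v] Q(4) e(7) by auto
  qed
  show False
  proof (cases "E d x1")
    case False
    from c1 have "chole (non_adj E) (d # ([a, r] @ Q))"
    proof (rule choleI)
      show "3 \<le> length ([a, r] @ Q)" using lQ by simp
      fix v assume "v \<in> set ([a, r] @ Q)"
      then have "v = a \<or> v = r \<or> v \<in> set Q" by auto
      then show "d \<noteq> v \<and> (non_adj E d v \<longleftrightarrow> v = hd ([a, r] @ Q) \<or> v = last ([a, r] @ Q))"
        using aQ[of v] nQ[of v] Q(2,5) dd False x1ne e(7) by auto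
    qed
    from no_antihole[OF this] show False using lQ by simp
  next
    case dx: True
    have dQ: "\<And>v. v \<in> set Q \<Longrightarrow> E d v" using aQ dx by blast
    have c2: "cpath (non_adj E) (([a, r] @ Q) @ [q])"
    proof (rule cpath_appendI[OF c1])
      fix u v assume u: "u \<in> set ([a, r] @ Q)" and v: "v \<in> set [q]"
      have "u = a \<or> u = r \<or> u \<in> set Q" using u by auto
      then show "u \<noteq> v \<and> (non_adj E u v \<longleftrightarrow> u = last ([a, r] @ Q) \<and> v = hd [q])"
        using aQ[of u] nQ[of u] Q(2,5) e Es x1ne v by auto
    qed simp
    show False
    proof (cases "E d q")
      case False
      from c2 have "chole (non_adj E) (d # (([a, r] @ Q) @ [q]))"
      proof (rule choleI)
        fix v assume "v \<in> set (([a, r] @ Q) @ [q])"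
        then have "v = a \<or> v = r \<or> v \<in> set Q \<or> v = q" by auto
        then show "d \<noteq> v \<and> (non_adj E d v \<longleftrightarrow> v = hd (([a, r] @ Q) @ [q]) \<or> v = last (([a, r] @ Q) @ [q]))"
          using dQ[of v] nQ[of v] dd False Es e by auto
      qed simp
      from no_antihole[OF this] show False using lQ by simp
    next
      case True
      have "cpath (non_adj E) ((([a, r] @ Q) @ [q]) @ [b])"
      proof (rule cpath_appendI[OF c2])
        fix u v assume u: "u \<in> set (([a, r] @ Q) @ [q])" and v: "v \<in> set [b]"
        have "u = a \<or> u = r \<or> u \<in> set Q \<or> u = q" using u by auto
        then show "u \<noteq> v \<and> (non_adj E u v \<longleftrightarrow> u = last (([a, r] @ Q) @ [q]) \<and> v = hd [b])"
          using aQ[of u] nQ[of u] e Es v by auto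
      qed simp
      then have "chole (non_adj E) (d # ((([a, r] @ Q) @ [q]) @ [b]))"
      proof (rule choleI)
        fix v assume "v \<in> set ((([a, r] @ Q) @ [q]) @ [b])"
        then have "v = a \<or> v = r \<or> v \<in> set Q \<or> v = q \<or> v = b" by auto
        then show "d \<noteq> v \<and> (non_adj E d v \<longleftrightarrow> v = hd ((([a, r] @ Q) @ [q]) @ [b]) \<or> v = last ((([a, r] @ Q) @ [q]) @ [b]))"
          using dQ[of v] nQ[of v] dd True Es e by auto
      qed simp
      from no_antihole[OF this] show False using lQ by simp
    qed
  qed
qed

text \<open>The induction of \<open>roussel_rubio\<close>, with the hole \<open>a m b\<close> in
  place of the path. That every vertex of \<open>X\<close> sees \<open>m\<close> now follows from
  \<open>no_hat\<close>, and the statement for the smaller set supplies a vertex of \<open>m\<close>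
  complete to it. The opposite attachments that remain fall under \<open>no_square\<close>,
  \<open>antihole_through\<close> or \<open>no_leap\<close>.\<close>

theorem no_complete_pair:
  assumes c: "cpath E (a # m)" "cpath E (m @ [b])" and ab: "E a b" and m: "even (length m)" "m \<noteq> []"
    and X: "finite X" "X \<noteq> {}" "conn (non_adj E) X" "X \<inter> set (a # b # m) = {}"
    and co: "complete_to a X" "complete_to b X" "\<forall>v\<in>set m. \<not> complete_to v X"
    and D: "conn E D" "D \<inter> X = {}" "a \<notin> D" "b \<notin> D" "\<forall>d\<in>D. \<not> E d a \<and> \<not> E d b"
      "\<forall>x\<in>X. \<exists>d\<in>D. E x d" "\<exists>d\<in>D. \<exists>v\<in>set m. d = v \<or> E d v"
  shows False
  using X co D(2,6)
proof (induction "card X" arbitrary: X rule: less_induct)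
  case less
  note X = less.prems(1-4) and co = less.prems(5-7) and DX = less.prems(8,9)
  have am: "\<And>v. v \<in> set m \<Longrightarrow> a \<noteq> v \<and> (E a v \<longleftrightarrow> v = hd m)" and bm: "\<And>v. v \<in> set m \<Longrightarrow> b \<noteq> v \<and> (E v b \<longleftrightarrow> v = last m)"
    using c by (auto simp: cpath_append)
  have nab: "a \<noteq> b" using ab by auto
  have exX: "E x a" "E x b" if "x \<in> X" for x using co that adj_sym unfolding complete_to_def by blast+
  have hat: "\<exists>v\<in>set m. E x v" if x: "x \<in> X" for x
  proof (rule ccontr)
    assume n: "\<not> ?thesis"
    show False
    proof (rule no_hat[OF c ab m exX[OF x] _ D(1) _ D(5) _ D(7)])
      show "\<forall>v\<in>set m. x \<noteq> v \<and> \<not> E x v" using n x X(4) by auto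
      show "D \<inter> {a, b, x} = {}" using D(3,4) DX(1) x by auto
      show "\<exists>d\<in>D. E x d" using DX(2) x by blast
    qed
  qed
  show False
  proof (cases "\<exists>t. X = {t}")
    case True
    then obtain t where t: "X = {t}" by blast
    then show False using hat[of t] co(3) adj_sym[of t] unfolding complete_to_def by auto
  next
    case False
    then obtain x1 x2 where x: "x1 \<in> X" "x2 \<in> X" "x1 \<noteq> x2" "conn (non_adj E) (X - {x1})" "conn (non_adj E) (X - {x2})"
      using conn_remove2[OF symp_non_adj X(1,3,2)] by blast
    have type: "(\<forall>v\<in>set m. E x v \<longleftrightarrow> v = last m) \<and> complete_to (hd m) (X - {x}) \<or>
       (\<forall>v\<in>set m. E x v \<longleftrightarrow> v = hd m) \<and> complete_to (last m) (X - {x})"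
      if xX: "x \<in> X" and cx: "conn (non_adj E) (X - {x})" for x
    proof -
      have ne: "X - {x} \<noteq> {}" using False xX by auto
      have ex: "\<exists>v\<in>set m. complete_to v (X - {x})"
      proof (rule ccontr)
        assume "\<not> ?thesis"
        then have n: "\<forall>v\<in>set m. \<not> complete_to v (X - {x})" by blast
        show False
          by (rule less.hyps[OF _ _ ne cx _ _ _ n])
            (use X xX co DX complete_to_mono[of _ X "X - {x}"] in \<open>auto simp: card_gt_0_iff\<close>)
      qed
      have R: "rr (X - {x})" using roussel_rubio[OF _ ne cx] X(1) by simp
      show ?thesis
      proof (rule attachment_type[OF R c nab m exX[OF xX] _ _ _ _ _ _ ex hat[OF xX]])
        show "complete_to a (X - {x})" "complete_to b (X - {x})" using co complete_to_split[OF xX] by blast+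
        show "set (x # a # b # m) \<inter> (X - {x}) = {}" "x \<notin> set (a # b # m)" using X(4) xX by auto
        show "\<not> complete_to x (X - {x})" using anti_nonneighbor[OF X(3) xX] False by blast
        show "\<forall>v\<in>set m. \<not> (complete_to v (X - {x}) \<and> E x v)"
          using co complete_to_split[OF xX] adj_sym[of x] by blast
      qed
    qed
    obtain q r' where m1: "m = q # r'" using m(2) by (cases m) auto
    then have "r' \<noteq> []" using m(1) by auto
    then obtain n r where mq: "m = q # n @ [r]" using m1 by (metis append_butlast_last_id)
    have en: "even (length n)" using m(1) mq by simp
    have hl: "hd m = q" "last m = r" "q \<noteq> r" using cpath_distinct[OF c(1)] mq by auto
    have key: False if x: "x1 \<in> X" "x2 \<in> X" "x1 \<noteq> x2" and cx: "conn (non_adj E) (X - {x1})" "conn (non_adj E) (X - {x2})" and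
       L: "\<forall>v\<in>set m. E x1 v \<longleftrightarrow> v = r" "complete_to q (X - {x1})" and
       R: "\<forall>v\<in>set m. E x2 v \<longleftrightarrow> v = q" "complete_to r (X - {x2})" for x1 x2
    proof -
      have xm: "x1 \<notin> set m" "x2 \<notin> set m" "x1 \<noteq> a" "x1 \<noteq> b" "x2 \<noteq> a" "x2 \<noteq> b" "q \<notin> X" "r \<notin> X" using x X(4) mq by auto
      have nx: "\<not> E q x1" "\<not> E r x2" using L(1) R(1) mq hl adj_sym[of q x1] adj_sym[of r x2] by auto
      show False
      proof (cases "n = []")
        case True
        then have mqr: "m = [q, r]" using mq by simp
        have e: "E a q" "E q r" "E r b" "\<not> E a r" "\<not> E q b" "a \<noteq> r" "q \<noteq> b"
          using am[of q] am[of r] bm[of q] bm[of r] c(1) mqr hl by auto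
        have Xd: "X \<inter> {a, b, q, r} = {}" "X \<inter> {b, a, r, q} = {}" using X(4) mqr by auto
        have es: "E b r" "E r q" "E q a" "E b a" "\<not> E b q" "\<not> E r a" "b \<noteq> q" "r \<noteq> a" using e ab adj_sym by blast+
        have "q \<notin> D" "r \<notin> D" using D(5) es e by blast+
        \<comment> \<open>Each of \<open>q\<close> and \<open>r\<close> sees \<open>a\<close> or
          \<open>b\<close> and hence lies outside \<open>D\<close>, so \<open>D\<close> is attached
          by an edge to one of them. The two cases are mirror images.\<close>
        then have "(\<exists>d\<in>D. E q d) \<or> (\<exists>d\<in>D. E r d)" using D(7) mqr adj_sym by auto
        then show False
        proof
          assume q: "\<exists>d\<in>D. E q d"
          show False
            using no_square[OF e(1-3) ab e(4-7) X(1,3) x cx(1) Xd(1) co(1,2) L(2) nx(1) R(2) nx(2) D(1) DX(1) D(3-5) _ q] DX(2) x(1) by blast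
        next
          assume r: "\<exists>d\<in>D. E r d"
          have D5: "\<forall>d\<in>D. \<not> E d b \<and> \<not> E d a" using D(5) by blast
          show False
            using no_square[OF es(1-8) X(1,3) x(2,1) x(3)[symmetric] cx(2) Xd(2) co(2,1) R(2) nx(2) L(2) nx(1) D(1) DX(1) D(4,3) D5 _ r] DX(2) x(2) by blast
        qed
      next
        case False
        have "cpath E ((q # n) @ [r])" using c(1) mq by simp
        then have "E q r \<longleftrightarrow> q = last (q # n)" unfolding cpath_append by simp
        moreover have "q \<noteq> last n" using False cpath_distinct[OF c(1)] mq last_in_set[of n] by auto
        ultimately have nqr: "\<not> E q r" using False by simp
        show False
        proof (cases "E x1 x2")
          case True
          then show False using antihole_through[OF X(3) x(1,2) True xm(7) L(2) nx(1) xm(8) R(2) nx(2) hl(3) nqr] by blast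
        next
          case nadj: False
          show False
          proof (rule no_leap[OF _ _ ab en False, of q r x1 x2 D])
            show "cpath E (a # q # n @ [r])" "cpath E ((q # n @ [r]) @ [b])" using c mq by simp_all
            show "E x1 a" "E x1 b" "E x2 a" "E x2 b" using exX x by blast+
            have d: "distinct (q # n @ [r])" using cpath_distinct[OF c(1)] mq by auto
            show "E x1 r" "x1 \<notin> set (q # n)" "\<forall>v\<in>set (q # n). \<not> E x1 v" using L(1) xm mq d by auto
            show "E x2 q" "x2 \<notin> set (n @ [r])" "\<forall>v\<in>set (n @ [r]). \<not> E x2 v" using R(1) xm mq d by auto
            show "x1 \<noteq> x2" "\<not> E x1 x2" using x nadj by auto
            show "conn E D" "\<forall>d\<in>D. \<not> E d a \<and> \<not> E d b" by (fact D)+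
            show "D \<inter> {a, b, x1, x2} = {}" using D(3,4) DX(1) x by auto
            show "\<exists>d\<in>D. E x1 d" "\<exists>d\<in>D. E x2 d" using DX(2) x by blast+
          qed
        qed
      qed
    qed
    have hlm: "q \<in> set m" "r \<in> set m" using mq by auto
    have 1: "E x2 v" if "complete_to v (X - {x1})" for v using that x adj_sym unfolding complete_to_def by auto
    from type[OF x(1,4)] show False unfolding hl
    proof
      assume l: "(\<forall>v\<in>set m. E x1 v \<longleftrightarrow> v = r) \<and> complete_to q (X - {x1})"
      then have "\<not> (\<forall>v\<in>set m. E x2 v \<longleftrightarrow> v = r)" using 1 hlm hl(3) by auto
      then have "(\<forall>v\<in>set m. E x2 v \<longleftrightarrow> v = q) \<and> complete_to r (X - {x2})"
        using type[OF x(2,5)] unfolding hl by satx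
      then show False using key[OF x] l by simp
    next
      assume l: "(\<forall>v\<in>set m. E x1 v \<longleftrightarrow> v = q) \<and> complete_to r (X - {x1})"
      then have "\<not> (\<forall>v\<in>set m. E x2 v \<longleftrightarrow> v = q)" using 1 hlm hl(3) by auto
      then have "(\<forall>v\<in>set m. E x2 v \<longleftrightarrow> v = r) \<and> complete_to q (X - {x2})"
        using type[OF x(2,5)] unfolding hl by satx
      then show False using key[OF x(2,1) x(3)[symmetric] x(5,4)] l by simp
    qed
  qed
qed

end

section \<open>The two sides of an outer path\<close>

context artemis_adj
begin

lemma cpath_common_neighbor:
  assumes "cpath E Q" "v \<in> set Q" "E v (hd Q)" "E v (last Q)"
  shows "length Q = 3 \<or> length Q = 2"
proof (cases Q)
  case Nil
  then show ?thesis using assms by simp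
next
  case (Cons a R)
  have "v \<noteq> a" using assms(3) Cons by auto
  then have vR: "v \<in> set R" using assms(2) Cons by auto
  then have Rne: "R \<noteq> []" by auto
  have "v = hd R" using assms(1,3) Cons vR adj_sym by auto
  then obtain S where S: "R = v # S" using Rne by (cases R) auto
  have Sne: "S \<noteq> []" using assms(4) Cons S by auto
  have cS: "cpath E (v # S)" using assms(1) unfolding Cons S by simp
  have "last S \<in> set S" "E v (last S)" using assms(4) Cons S Sne by simp_all
  then have l: "last S = hd S" using cS unfolding cpath.simps(2)[of E v S] by blast
  obtain x S' where x: "S = x # S'" using Sne by (cases S) auto
  have "x \<notin> set S'" using cpath_distinct[OF cS] x by simp
  then have "S' = []" using l x last_in_set[of S'] by (cases "S' = []") auto
  then show ?thesis using Cons S x by simp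
qed

end

text \<open>Holds only the data, so that the sides and \<open>mid\<close> can also be formed for
  \<open>rev W\<close>, before anything is known about it.\<close>

locale outer_config = artemis_adj E for E :: "'a \<Rightarrow> 'a \<Rightarrow> bool" +
  fixes V T :: "'a set" and W :: "'a list"
  assumes finV: "finite V" and TV: "T \<subseteq> V" "T \<noteq> {}" "conn (non_adj E) T"
begin

definition cn :: "'a set" where "cn = {v \<in> V - T. complete_to v T}"

definition side :: "'a list \<Rightarrow> 'a set" where
  "side P = {v \<in> cn. \<forall>w\<in>set P. E v w \<longleftrightarrow> w = hd P}"

abbreviation A where "A \<equiv> side W"
abbreviation B where "B \<equiv> side (rev W)"

text \<open>These are the common neighbours that might disturb the parity arguments;
  \<open>avoid_T_mid\<close> removes them from every path that matters.\<close>

definition mid :: "'a set" where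
  "mid = {v \<in> cn. (\<exists>w\<in>set W. E v w) \<and> v \<notin> A \<and> v \<notin> B}"

end

text \<open>The conditions describe a shortest outer path of a maximal \<open>T\<close>:
  \<open>nbr_clique\<close> says that \<open>T\<close> cannot be enlarged, the parity of
  \<open>W\<close> comes from Roussel-Rubio, three vertices are reached because a single outside
  vertex sees only a clique, and \<open>mid_complete\<close> comes from
  \<open>mid_complete_side\<close>.\<close>

locale outer_path = outer_config +
  assumes nbr_clique: "\<And>u x y. u \<in> V - T - cn \<Longrightarrow> x \<in> cn \<Longrightarrow> y \<in> cn \<Longrightarrow> E u x \<Longrightarrow> E u y \<Longrightarrow> x \<noteq> y \<Longrightarrow> E x y"
    and W: "cpath E W" "odd (length W)" "3 \<le> length W" "set W \<subseteq> V - T - cn"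
    and AB: "A \<noteq> {}" "B \<noteq> {}"
    and mid_complete: "\<And>v x. v \<in> mid \<Longrightarrow> x \<in> A \<union> B \<Longrightarrow> E v x"
begin

lemma rev_outer_path: "outer_path E V T (rev W)"
proof -
  interpret r: outer_config E V T "rev W" by unfold_locales (fact finV TV)+
  show ?thesis
  proof unfold_locales
    show "\<And>u x y. u \<in> V - T - r.cn \<Longrightarrow> x \<in> r.cn \<Longrightarrow> y \<in> r.cn \<Longrightarrow> E u x \<Longrightarrow> E u y \<Longrightarrow> x \<noteq> y \<Longrightarrow> E x y"
      by (rule nbr_clique)
    show "cpath E (rev W)" using W(1) cpath_rev[OF symE] by blast
    show "odd (length (rev W))" "3 \<le> length (rev W)" "set (rev W) \<subseteq> V - T - r.cn" using W by auto
    show "r.side (rev W) \<noteq> {}" "r.side (rev (rev W)) \<noteq> {}" using AB by simp_all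
    fix v x assume "v \<in> r.mid" "x \<in> r.side (rev W) \<union> r.side (rev (rev W))"
    then show "E v x" using mid_complete[of v x] unfolding r.mid_def mid_def by auto
  qed
qed

lemma mid_rev: "outer_config.mid E V T (rev W) = mid"
proof -
  interpret r: outer_config E V T "rev W" by unfold_locales (fact finV TV)+
  show ?thesis unfolding r.mid_def mid_def by auto
qed

lemma W_ne: "W \<noteq> []" "hd W \<in> set W" "last W \<in> set W" "hd W \<noteq> last W" "tl W \<noteq> []" "butlast W \<noteq> []"
proof -
  obtain x y r where x: "W = x # y # r" using W(3) by (cases W; cases "tl W") auto
  moreover have "r \<noteq> []" using W(3) x by auto
  ultimately show "W \<noteq> []" "hd W \<in> set W" "last W \<in> set W" "tl W \<noteq> []" "butlast W \<noteq> []" by auto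
  show "hd W \<noteq> last W" using x \<open>r \<noteq> []\<close> cpath_distinct[OF W(1)] by auto
qed

lemma A_iff: "a \<in> A \<longleftrightarrow> a \<in> cn \<and> (\<forall>w\<in>set W. E a w \<longleftrightarrow> w = hd W)"
  unfolding side_def by simp

lemma B_iff: "b \<in> B \<longleftrightarrow> b \<in> cn \<and> (\<forall>w\<in>set W. E b w \<longleftrightarrow> w = last W)"
  unfolding side_def using W_ne by (simp add: hd_rev)

lemma cnD: "v \<in> cn \<Longrightarrow> v \<in> V \<and> v \<notin> T \<and> complete_to v T \<and> v \<notin> set W"
  using W(4) unfolding cn_def by auto

lemma cnI: "v \<in> V \<Longrightarrow> v \<notin> T \<Longrightarrow> complete_to v T \<Longrightarrow> v \<in> cn"
  unfolding cn_def by auto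

lemma cnT: "v \<in> cn \<Longrightarrow> t \<in> T \<Longrightarrow> E v t \<and> E t v"
  using cnD adj_sym unfolding complete_to_def by blast

lemma A_hd: "a \<in> A \<Longrightarrow> E a (hd W) \<and> E (hd W) a" using A_iff W_ne adj_sym by blast
lemma B_last: "b \<in> B \<Longrightarrow> E b (last W) \<and> E (last W) b" using B_iff W_ne adj_sym by blast

lemma A_clique: "x \<in> A \<Longrightarrow> y \<in> A \<Longrightarrow> x \<noteq> y \<Longrightarrow> E x y"
  using nbr_clique[of "hd W" x y] A_hd[of x] A_hd[of y] W(4) W_ne A_iff by blast

lemma B_clique: "x \<in> B \<Longrightarrow> y \<in> B \<Longrightarrow> x \<noteq> y \<Longrightarrow> E x y"
  using nbr_clique[of "last W" x y] B_last[of x] B_last[of y] W(4) W_ne B_iff by blast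

lemma AB_ne: "a \<in> A \<Longrightarrow> b \<in> B \<Longrightarrow> a \<noteq> b"
  using A_hd[of a] B_iff[of b] W_ne by auto

text \<open>An edge \<open>a b\<close> would close \<open>W\<close> to a hole with
  \<open>length W + 2\<close> vertices, an odd number.\<close>

lemma AB_nonadj: assumes "a \<in> A" "b \<in> B" shows "\<not> E a b \<and> \<not> E b a"
proof -
  have "\<not> E a b"
  proof
    assume ab: "E a b"
    have "cpath E (W @ [b])"
    proof (rule cpath_appendI[OF W(1)])
      fix u v assume u: "u \<in> set W" and "v \<in> set [b]"
      then show "u \<noteq> v \<and> (E u v \<longleftrightarrow> u = last W \<and> v = hd [b])"
        using B_iff[of b] assms cnD[of b] adj_comm[of u b] by auto
    qed simp
    then have "odd (length (W @ [b]))"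
    proof (rule hole_close)
      fix v assume "v \<in> set (W @ [b])"
      then show "a \<noteq> v \<and> (E a v \<longleftrightarrow> v = hd (W @ [b]) \<or> v = last (W @ [b]))"
        using A_iff[of a] assms cnD[of a] cnD[of b] B_iff[of b] ab AB_ne[OF assms] W_ne by auto
    qed (use W in simp)
    then show False using W by simp
  qed
  then show ?thesis using adj_sym by blast
qed

lemma touch_cases: "v \<in> cn \<Longrightarrow> w \<in> set W \<Longrightarrow> E v w \<or> E w v \<Longrightarrow> v \<in> A \<or> v \<in> B \<or> v \<in> mid"
  unfolding mid_def using adj_sym by blast

text \<open>Every vertex of \<open>T\<close> or \<open>mid\<close> sees both ends of
  \<open>Q\<close>, which \<open>cpath_common_neighbor\<close> forbids from four vertices
  on.\<close>

lemma avoid_T_mid: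
  assumes Q: "cpath E Q" "set Q \<subseteq> V" "4 \<le> length Q" "hd Q \<in> A" "last Q \<in> B"
  shows "set Q \<inter> T = {}" "set Q \<inter> mid = {}"
proof -
  have "\<not> (E v (hd Q) \<and> E v (last Q))" if "v \<in> set Q" for v
    using cpath_common_neighbor[OF Q(1) that] Q(3) by auto
  moreover have "E v (hd Q) \<and> E v (last Q)" if "v \<in> T \<union> mid" for v
    using that cnT[of "hd Q" v] cnT[of "last Q" v] mid_complete[of v] Q A_iff B_iff by blast
  ultimately show "set Q \<inter> T = {}" "set Q \<inter> mid = {}" by blast+
qed

subsection \<open>Odd paths from one side to the other\<close>

text \<open>The stretch from \<open>u\<close> to \<open>v\<close>, closed through \<open>W\<close>,
  is a hole whose only \<open>T\<close>-complete vertices \<open>k\<close> and \<open>k'\<close> are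
  consecutive. It violates \<open>no_complete_pair\<close> for \<open>X = T\<close>, where
  \<open>D\<close> is \<open>hd Q\<close> with \<open>W\<close> less its last vertex. As
  \<open>xs\<close> is nonempty, \<open>hd Q\<close> lies before the stretch and sees nothing of it
  except possibly \<open>u\<close>.\<close>

lemma segment_through_W:
  assumes Q: "cpath E Q" "set Q \<subseteq> V" "set Q \<inter> T = {}" "hd Q \<in> A" "last Q \<in> B"
    and only: "\<forall>v\<in>set Q. v \<in> cn \<and> (\<exists>w\<in>set W. E v w) \<longrightarrow> v = hd Q \<or> v = last Q"
    and s: "Q = xs @ u # ys @ v # zs" "xs \<noteq> []"
    and uv: "\<exists>w\<in>set W. u = w \<or> E u w" "\<exists>w\<in>set W. v = w \<or> E v w" "\<forall>y\<in>set ys. \<forall>w\<in>set W. y \<noteq> w \<and> \<not> E y w"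
    and odd: "odd (ecount (\<lambda>v. complete_to v T) (u # ys @ [v]))"
  shows False
proof -
  let ?a = "hd Q"
  have dQ: "distinct Q" by (rule cpath_distinct[OF Q(1)])
  have axs: "?a \<in> set xs" "?a = hd xs" using s by auto
  have lQ: "last Q = last (v # zs)" unfolding s(1) by simp
  have cpu: "cpath E (xs @ (u # ys @ [v]) @ zs)" using Q(1) s by simp
  then have cuv: "cpath E (u # ys @ [v])" by (rule cpath_infix)
  have na: "?a \<noteq> y \<and> \<not> E ?a y" if y: "y \<in> set (ys @ v # zs)" for y
  proof -
    have "cpath E (xs @ (u # ys @ v # zs))" using Q(1) s by simp
    then have "?a \<noteq> y \<and> (E ?a y \<longleftrightarrow> ?a = last xs \<and> y = hd (u # ys @ v # zs))"
      unfolding cpath_append using axs(1) list.set_intros(2)[OF y, of u] by blast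
    moreover have "y \<noteq> u" using dQ s y by auto
    ultimately show ?thesis by simp
  qed
  have cnQ: "\<And>y. y \<in> set Q \<Longrightarrow> complete_to y T \<Longrightarrow> y \<in> cn" using Q(2,3) cnI by blast
  have sub: "set (u # ys @ [v]) \<subseteq> set Q" unfolding s(1) by auto
  have ua: "u \<noteq> ?a" "u \<noteq> last Q" using dQ s axs lQ by (auto simp: last_in_set)
  \<comment> \<open>By \<open>only\<close>, a vertex of \<open>cn\<close> that touches
    \<open>W\<close> is an end of \<open>Q\<close>; \<open>u\<close> is neither end.\<close>
  have ucn: "u \<notin> cn"
  proof
    assume ucn: "u \<in> cn"
    then have "u \<notin> set W" using cnD by blast
    then show False using uv(1) only[rule_format, of u] ucn ua sub by auto
  qed
  have vcn: "v = last Q" if vc: "v \<in> cn"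
  proof -
    have "v \<notin> set W" using cnD vc by blast
    then show ?thesis using uv(2) only[rule_format, of v] vc na[of v] sub by auto
  qed
  have ysne: "ys \<noteq> []"
  proof
    assume "ys = []"
    then have "complete_to u T" using odd by (auto split: if_splits)
    then show False using cnQ[of u] ucn sub by auto
  qed
  have uW: "u \<notin> set W"
  proof
    assume "u \<in> set W"
    moreover have "E u (hd ys)" using cuv ysne by (cases ys) auto
    ultimately show False using uv(3) ysne adj_sym[of u "hd ys"] hd_in_set by blast
  qed
  have vW: "v \<notin> set W"
  proof
    assume "v \<in> set W"
    moreover have "cpath E ((u # ys) @ [v])" using cuv by simp
    then have "E (last ys) v" unfolding cpath_append using ysne by auto
    ultimately show False using uv(3) ysne last_in_set by blast
  qed
  obtain w1 w2 where w12: "w1 \<in> set W" "E u w1" "w2 \<in> set W" "E v w2" using uv uW vW by blast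
  have cW: "conn E (set W)" by (rule conn_cpath[OF symE W(1)])
  from conn_link[OF irrE cW, of w1 "E u" w2 "E v", OF w12]
  obtain w where w: "cpath E w" "w \<noteq> []" "set w \<subseteq> set W" "E u (hd w)" "E v (last w)"
    "\<forall>y\<in>set w. E u y \<longrightarrow> y = hd w" "\<forall>y\<in>set w. E v y \<longrightarrow> y = last w" by blast
  have ysw: "\<And>y z. y \<in> set ys \<Longrightarrow> z \<in> set w \<Longrightarrow> y \<noteq> z \<and> \<not> E y z" using uv(3) w(3) by blast
  have hole: "chole E ((u # ys @ [v]) @ rev w)"
  proof -
    have cyv: "cpath E (ys @ [v])" using cuv by simp
    have "cpath E ((ys @ [v]) @ rev w)"
    proof (rule cpath_appendI[OF cyv])
      show "cpath E (rev w)" using w(1) cpath_rev[OF symE] by blast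
      fix y z assume y: "y \<in> set (ys @ [v])" and z: "z \<in> set (rev w)"
      show "y \<noteq> z \<and> (E y z \<longleftrightarrow> y = last (ys @ [v]) \<and> z = hd (rev w))"
      proof (cases "y = v")
        case True
        then show ?thesis using z w vW by (auto simp: hd_rev)
      next
        case False
        then show ?thesis using ysw[of y z] y z by auto
      qed
    qed
    then have "chole E (u # ((ys @ [v]) @ rev w))"
    proof (rule choleI)
      show "3 \<le> length ((ys @ [v]) @ rev w)" using ysne w(2) by (cases ys; cases w) auto
      fix y assume y: "y \<in> set ((ys @ [v]) @ rev w)"
      have l: "last ((ys @ [v]) @ rev w) = hd w" "hd ((ys @ [v]) @ rev w) = hd ys" using w(2) ysne by (simp_all add: last_rev)
      show "u \<noteq> y \<and> (E u y \<longleftrightarrow> y = hd ((ys @ [v]) @ rev w) \<or> y = last ((ys @ [v]) @ rev w))"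
        unfolding l
      proof (cases "y \<in> set w")
        case True
        then have "y \<noteq> hd ys" using ysw ysne hd_in_set by blast
        then show "u \<noteq> y \<and> (E u y \<longleftrightarrow> y = hd ys \<or> y = hd w)" using True w(3,4,6) uW by auto
      next
        case False
        then have yy: "y \<in> set (ys @ [v])" using y by auto
        then have "u \<noteq> y \<and> (E u y \<longleftrightarrow> y = hd (ys @ [v]))" using cuv by auto
        moreover have "y \<noteq> hd w" using False w(2) by auto
        ultimately show "u \<noteq> y \<and> (E u y \<longleftrightarrow> y = hd ys \<or> y = hd w)" using ysne by simp
      qed
    qed
    then show ?thesis by simp
  qed
  have wT: "set w \<inter> T = {}" "\<forall>y\<in>set w. \<not> complete_to y T" using w(3) W(4) cnI by blast+
  have R: "rr T" using roussel_rubio[of T] TV finV finite_subset by blast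
  have "\<exists>xs' k k' zs'. u # ys @ [v] = xs' @ k # k' # zs' \<and> complete_to k T \<and> complete_to k' T \<and>
     (\<forall>y\<in>set xs' \<union> set zs'. \<not> complete_to y T)"
  proof (rule hole_odd_complete_edges[OF R hole _ _ _ odd])
    show "set ((u # ys @ [v]) @ rev w) \<inter> T = {}" using wT sub Q(3) by auto
  qed (use w wT in auto)
  then obtain xs' k k' zs' where k: "u # ys @ [v] = xs' @ k # k' # zs'" "complete_to k T" "complete_to k' T"
     "\<forall>y\<in>set xs' \<union> set zs'. \<not> complete_to y T" by blast
  have kk: "y \<in> set ys \<or> y = v \<and> v = last Q" if y: "y = k \<or> y = k'" for y
  proof -
    have yin: "y \<in> set (u # ys @ [v])" unfolding k(1) using y by auto
    then have "y \<in> cn" using cnQ[of y] sub y k by blast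
    then show ?thesis using yin ucn vcn by auto
  qed
  \<comment> \<open>The hole from \<open>k'\<close> to \<open>k\<close> the long way round.\<close>
  let ?m = "zs' @ rev w @ xs'"
  have h1: "chole E ((xs' @ [k]) @ (k' # zs' @ rev w))" using hole unfolding k(1) by simp
  from chole_rotate[OF symE h1] have h2: "chole E ((k' # ?m) @ [k])" by simp
  from chole_rotate[OF symE h2] have h3: "chole E ([k] @ (k' # ?m))" by simp
  have c1: "cpath E (k' # ?m)" using chole_cpath[OF h3] by simp
  have "chole E ([k'] @ (?m @ [k]))" using h2 by simp
  then have c2: "cpath E (?m @ [k])" using chole_cpath by blast
  have "cpath E (xs' @ [k, k'] @ zs')" using cuv unfolding k(1) by simp
  then have "cpath E [k, k']" by (rule cpath_infix)
  then have kadj: "E k' k" using adj_sym by auto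
  have em: "even (length ?m)" using hole_even[OF h3] by simp
  \<comment> \<open>\<open>last W\<close> is left out because one of \<open>k\<close>,
    \<open>k'\<close> may be the end of \<open>Q\<close> in \<open>B\<close>, which sees
    \<open>last W\<close> and no other vertex of \<open>W\<close>. Vertices of \<open>w\<close> may
    belong to both \<open>?D\<close> and the hole.\<close>
  let ?D = "insert ?a (set (butlast W))"
  have bW: "W = butlast W @ [last W]" using W_ne by simp
  have cb: "cpath E (butlast W)" "E (last (butlast W)) (last W)"
    using W(1) W_ne(6) cpath_append[of E "butlast W" "[last W]"] bW by auto
  have sb: "set (butlast W) \<subseteq> set W" by (metis bW set_append Un_upper1)
  have hb: "hd W \<in> set (butlast W)" using W_ne(6) bW by (metis hd_append2 hd_in_set)
  have lb: "last W \<notin> set (butlast W)" using cpath_distinct[OF W(1)] bW by (metis distinct_append disjoint_insert(2) list.set(2) inf_commute)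
  have aW: "?a \<notin> set W" using Q(4) A_iff cnD by blast
  show False
  proof (rule no_complete_pair[OF c1 c2 kadj em])
    show "?m \<noteq> []" using w(2) by simp
    show "finite T" "T \<noteq> {}" "conn (non_adj E) T" using TV finV finite_subset by blast+
    have "set (k' # k # ?m) \<subseteq> set (u # ys @ [v]) \<union> set w" unfolding k(1) by auto
    then show "T \<inter> set (k' # k # ?m) = {}" using sub Q(3) wT by blast
    show "complete_to k' T" "complete_to k T" "\<forall>y\<in>set ?m. \<not> complete_to y T" using k wT by auto
    show "conn E ?D" using conn_insert[OF conn_cpath[OF symE cb(1)] hb] A_hd[OF Q(4)] by blast
    show "?D \<inter> T = {}" using sb W(4) Q(4) A_iff cnD by blast
    have kx: "y \<notin> ?D \<and> (\<forall>d\<in>?D. \<not> E d y)" if y: "y = k \<or> y = k'" for y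
      using kk[OF y]
    proof
      assume yy: "y \<in> set ys"
      have "y \<notin> set W" "\<And>d. d \<in> set W \<Longrightarrow> \<not> E d y" using uv(3) yy adj_sym by blast+
      then show ?thesis using sb na[of y] yy by auto
    next
      assume yv: "y = v \<and> v = last Q"
      then have yB: "y \<in> B" using Q(5) by simp
      then have "y \<notin> set W" using B_iff cnD by blast
      moreover have "\<not> E d y" if "d \<in> set (butlast W)" for d
      proof
        assume "E d y"
        then have "d = last W" using yB B_iff[of y] that sb adj_sym[of d y] by auto
        then show False using that lb by simp
      qed
      ultimately show ?thesis using yv na[of y] sb by auto
    qed
    show "k' \<notin> ?D" "k \<notin> ?D" "\<forall>d\<in>?D. \<not> E d k' \<and> \<not> E d k" using kx by blast+
    show "\<forall>t\<in>T. \<exists>d\<in>?D. E t d" using Q(4) A_iff cnT by blast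
    have "hd w \<in> set W" "hd w \<in> set ?m" using w by auto
    then have "hd w \<in> set (butlast W) \<or> hd w = last W" using bW by (metis Un_iff empty_iff insert_iff list.set set_append)
    then show "\<exists>d\<in>?D. \<exists>y\<in>set ?m. d = y \<or> E d y"
    proof
      assume "hd w \<in> set (butlast W)"
      then show ?thesis using \<open>hd w \<in> set ?m\<close> by blast
    next
      assume "hd w = last W"
      then have "E (last (butlast W)) (hd w)" "last (butlast W) \<in> set (butlast W)" using cb W_ne by auto
      then show ?thesis using \<open>hd w \<in> set ?m\<close> by blast
    qed
  qed
qed

text \<open>If the interior avoided both sides, some stretch between consecutive vertices on or next
  to \<open>W\<close> would carry an odd number of \<open>T\<close>-complete edges. If it is not all
  of \<open>Q\<close>, \<open>segment_through_W\<close> applies in one of the two directions;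
  otherwise \<open>Q\<close> and \<open>W\<close> together form an odd hole.\<close>

lemma odd_path_meets_sides:
  assumes Q: "cpath E Q" "set Q \<subseteq> V" "even (length Q)" "hd Q \<in> A" "last Q \<in> B"
  shows "\<exists>v\<in>set Q. v \<noteq> hd Q \<and> v \<noteq> last Q \<and> v \<in> A \<union> B"
proof (rule ccontr)
  assume no: "\<not> ?thesis"
  let ?L = "\<lambda>v. complete_to v T"
  have Qne: "Q \<noteq> []" using AB_ne[OF Q(4,5)] Q(1)
  proof -
    have "hd Q \<noteq> last Q" using AB_ne[OF Q(4,5)] .
    then show ?thesis using Q AB_nonadj[OF Q(4,5)] A_iff B_iff by (metis AB_ne empty_iff hd_Nil_eq_last)
  qed
  have "length Q \<noteq> 2"
  proof
    assume "length Q = 2"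
    then obtain x y where "Q = [x, y]" by (auto simp: length_Suc_conv numeral_2_eq_2)
    then show False using Q(1) AB_nonadj[OF Q(4,5)] by simp
  qed
  then have l4: "4 \<le> length Q" using Q(3) Qne by (cases Q; cases "tl Q"; cases "tl (tl Q)"; cases "tl (tl (tl Q))") auto
  have QT: "set Q \<inter> T = {}" "set Q \<inter> mid = {}" using avoid_T_mid[OF Q(1,2) l4 Q(4,5)] by auto
  have only: "\<forall>v\<in>set Q. v \<in> cn \<and> (\<exists>w\<in>set W. E v w) \<longrightarrow> v = hd Q \<or> v = last Q"
    using no QT(2) touch_cases by blast
  have R: "rr T" using roussel_rubio[of T] TV finV finite_subset by blast
  have "odd (length Q + ecount ?L Q)"
    by (rule rr_parity_path[OF R Qne _ _ QT(1) Q(1)]) (use Q A_iff B_iff cnD in blast)+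
  then have oe: "odd (ecount ?L Q)" using Q(3) by simp
  let ?M = "\<lambda>v. \<exists>w\<in>set W. v = w \<or> E v w"
  have "?M (hd Q)" "?M (last Q)" using A_hd[OF Q(4)] B_last[OF Q(5)] W_ne by blast+
  from odd_segment[of Q ?M ?L, OF Qne this oe] obtain xs u ys v zs where s: "Q = xs @ u # ys @ v # zs" "?M u" "?M v"
    "\<forall>y\<in>set ys. \<not> ?M y" "odd (ecount ?L (u # ys @ [v]))" by blast
  show False
  proof (cases "xs = []")
    case False
    show False
      by (rule segment_through_W[OF Q(1,2) QT(1) Q(4,5) only s(1) False s(2,3) _ s(5)]) (use s(4) in blast)
  next
    case xs: True
    show False
    proof (cases "zs = []")
      case False
      interpret r: outer_path E V T "rev W" by (rule rev_outer_path)
      have hr: "hd (rev Q) = last Q" "last (rev Q) = hd Q" using Qne by (simp_all add: hd_rev last_rev)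
      have ec: "ecount ?L (rev p) = ecount ?L p" for p
        by (induction p) (auto simp: ecount_append last_rev)
      show False
      proof (rule r.segment_through_W[of "rev Q" "rev zs" v "rev ys" u "rev xs"])
        show "cpath E (rev Q)" using Q(1) cpath_rev[OF symE] by blast
        show "hd (rev Q) \<in> side (rev W)" "last (rev Q) \<in> side (rev (rev W))" using Q hr by simp_all
        show "odd (ecount ?L (v # rev ys @ [u]))" using s(5) ec[of "u # ys @ [v]"] by simp
        show "\<forall>v\<in>set (rev Q). v \<in> cn \<and> (\<exists>w\<in>set (rev W). E v w) \<longrightarrow> v = hd (rev Q) \<or> v = last (rev Q)"
          using only hr by auto
        show "set (rev Q) \<subseteq> V" "set (rev Q) \<inter> T = {}" using Q(2) QT by auto
        show "rev Q = rev zs @ v # rev ys @ u # rev xs" "rev zs \<noteq> []" using s(1) False by auto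
        show "\<exists>w\<in>set (rev W). u = w \<or> E u w" "\<exists>w\<in>set (rev W). v = w \<or> E v w" using s(2,3) by auto
        show "\<forall>y\<in>set (rev ys). \<forall>w\<in>set (rev W). y \<noteq> w \<and> \<not> E y w" using s(4) by auto
      qed
    next
      case True
      then have q: "Q = u # ys @ [v]" using s xs by simp
      have cuv: "cpath E (u # ys @ [v])" using Q(1) q by simp
      have uA: "u \<in> A" "v \<in> B" using Q(4,5) q by simp_all
      have ysne: "ys \<noteq> []" using l4 q by auto
      have uW: "\<And>w. w \<in> set W \<Longrightarrow> u \<noteq> w \<and> v \<noteq> w \<and> (E u w \<longleftrightarrow> w = hd W) \<and> (E v w \<longleftrightarrow> w = last W)"
        using uA A_iff B_iff cnD by blast
      have cyv: "cpath E (ys @ [v])" using cuv by simp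
      have "cpath E ((ys @ [v]) @ rev W)"
      proof (rule cpath_appendI[OF cyv])
        show "cpath E (rev W)" using W(1) cpath_rev[OF symE] by blast
        fix y z assume y: "y \<in> set (ys @ [v])" and z: "z \<in> set (rev W)"
        have hr: "hd (rev W) = last W" "last (ys @ [v]) = v" using W_ne by (simp_all add: hd_rev)
        have vn: "v \<notin> set ys" using cpath_distinct[OF cyv] by simp
        show "y \<noteq> z \<and> (E y z \<longleftrightarrow> y = last (ys @ [v]) \<and> z = hd (rev W))"
          unfolding hr
        proof (cases "y = v")
          case True
          then show "y \<noteq> z \<and> (E y z \<longleftrightarrow> y = v \<and> z = last W)" using z uW[of z] by auto
        next
          case False
          then show "y \<noteq> z \<and> (E y z \<longleftrightarrow> y = v \<and> z = last W)" using s(4) y z by auto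
        qed
      qed
      then have "odd (length ((ys @ [v]) @ rev W))"
      proof (rule hole_close)
        show "3 \<le> length ((ys @ [v]) @ rev W)" using W by simp
        fix y assume y: "y \<in> set ((ys @ [v]) @ rev W)"
        have hr: "hd ((ys @ [v]) @ rev W) = hd ys" "last ((ys @ [v]) @ rev W) = hd W" using W_ne ysne by (simp_all add: last_rev)
        show "u \<noteq> y \<and> (E u y \<longleftrightarrow> y = hd ((ys @ [v]) @ rev W) \<or> y = last ((ys @ [v]) @ rev W))"
          unfolding hr
        proof (cases "y \<in> set W")
          case True
          then have "y \<noteq> hd ys" using s(4) ysne hd_in_set by blast
          then show "u \<noteq> y \<and> (E u y \<longleftrightarrow> y = hd ys \<or> y = hd W)" using uW[OF True] by blast
        next
          case False
          then have "y \<in> set (ys @ [v])" using y by auto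
          then have "u \<noteq> y \<and> (E u y \<longleftrightarrow> y = hd (ys @ [v]))" using cuv unfolding cpath.simps by blast
          moreover have "y \<noteq> hd W" using False W_ne by blast
          ultimately show "u \<noteq> y \<and> (E u y \<longleftrightarrow> y = hd ys \<or> y = hd W)" using ysne by simp
        qed
      qed
      then show False using W(2) Q(3) q by simp
    qed
  qed
qed

subsection \<open>Choosing the ends of the pair\<close>

text \<open>For \<open>a\<close> in the clique \<open>A\<close>, deleting \<open>A\<close> besides
  the neighbours of \<open>a\<close> removes only \<open>a\<close> itself.\<close>

definition free :: "'a \<Rightarrow> 'a set" where
  "free a = V - (T \<union> A \<union> mid \<union> {v. E a v})"

text \<open>The component of \<open>b\<close> in the graph induced on \<open>free a\<close>.\<close>

definition reach :: "'a \<Rightarrow> 'a \<Rightarrow> 'a set" where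
  "reach b a = \<Union>{Y. conn E Y \<and> Y \<subseteq> free a \<and> b \<in> Y}"

lemma reachI: "conn E Y \<Longrightarrow> Y \<subseteq> free a \<Longrightarrow> b \<in> Y \<Longrightarrow> Y \<subseteq> reach b a"
  unfolding reach_def by blast

lemma reach_sub: "reach b a \<subseteq> free a"
  unfolding reach_def by blast

lemma conn_reach: "conn E (reach b a)"
  unfolding reach_def by (rule conn_Union) blast

lemma B_free: assumes "a \<in> A" "b \<in> B" shows "b \<in> free a"
proof -
  have "b \<notin> A" using AB_ne[of b b] assms by blast
  moreover have "b \<notin> mid" using assms mid_def by blast
  ultimately show ?thesis using assms AB_nonadj B_iff cnD unfolding free_def by blast
qed

lemma b_reach: assumes "a \<in> A" "b \<in> B" shows "b \<in> reach b a"
  using reachI[OF conn_single, of b a b] B_free[OF assms] by blast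

text \<open>Two private neighbours, of \<open>a\<close> and of \<open>a'\<close>, that both lead to the other side would close to a
  hole on the edge \<open>aa'\<close> to which the set \<open>T\<close> with the first vertex of \<open>W\<close> is attached.\<close>

lemma reach_asym:
  assumes aa: "a \<in> A" "a' \<in> A" "a \<noteq> a'" and b: "b \<in> B"
    and q: "q \<in> reach b a" "E a' q" and r: "r \<in> reach b a'" "E a r"
  shows False
proof -
  \<comment> \<open>A link from a neighbour of \<open>a'\<close> to \<open>b\<close> inside
    \<open>reach b a\<close> is chosen with its head as the only neighbour of \<open>a'\<close>. The
    rest avoids the neighbours of both vertices and so lies in the component of \<open>b\<close> in
    \<open>free a \<inter> free a'\<close>.\<close>
  have ex: "\<exists>q\<in>free a. E a' q \<and> (\<exists>d\<in>\<Union>{Y. conn E Y \<and> Y \<subseteq> free a \<inter> free a' \<and> b \<in> Y}. E q d)"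
    if aa: "a \<in> A" "a' \<in> A" and q: "q \<in> reach b a" "E a' q" for a a' q
  proof -
    from conn_link[OF irrE conn_reach, of q b a "E a'" b "\<lambda>x. x = b", OF q b_reach[OF aa(1) b] refl]
    obtain Y where Y: "cpath E Y" "Y \<noteq> []" "set Y \<subseteq> reach b a" "E a' (hd Y)" "last Y = b"
      "\<forall>y\<in>set Y. E a' y \<longrightarrow> y = hd Y" by blast
    obtain q' Y' where Y': "Y = q' # Y'" using Y(2) by (cases Y) auto
    have "Y' \<noteq> []" using Y(4,5) Y' AB_nonadj[OF aa(2) b] by auto
    have cY: "conn E (set Y')" using conn_cpath[OF symE, of Y'] Y(1) Y' by simp
    have bY: "b \<in> set Y'" using Y(5) Y' \<open>Y' \<noteq> []\<close> by auto
    have dY: "q' \<notin> set Y'" using cpath_distinct[OF Y(1)] Y' by simp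
    have sY: "set Y' \<subseteq> free a \<inter> free a'"
    proof
      fix y assume y: "y \<in> set Y'"
      then have "y \<in> free a" using Y(3) Y' reach_sub by auto
      moreover have "\<not> E a' y" using Y(6) Y' y dY by auto
      ultimately show "y \<in> free a \<inter> free a'" unfolding free_def by blast
    qed
    have "E q' (hd Y')" "hd Y' \<in> set Y'" using Y(1) Y' \<open>Y' \<noteq> []\<close> by auto
    moreover have "set Y' \<subseteq> \<Union>{Y. conn E Y \<and> Y \<subseteq> free a \<inter> free a' \<and> b \<in> Y}" using cY sY bY by blast
    moreover have "q' \<in> free a" "E a' q'" using Y(3,4) Y' reach_sub by auto
    ultimately show ?thesis by blast
  qed
  define D where "D = \<Union>{Y. conn E Y \<and> Y \<subseteq> free a \<inter> free a' \<and> b \<in> Y}"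
  have D': "D = \<Union>{Y. conn E Y \<and> Y \<subseteq> free a' \<inter> free a \<and> b \<in> Y}" unfolding D_def by (simp add: Int_commute)
  obtain q where q: "q \<in> free a" "E a' q" "\<exists>d\<in>D. E q d" using ex[OF aa(1,2) q] unfolding D_def by blast
  obtain r where r: "r \<in> free a'" "E a r" "\<exists>d\<in>D. E r d" using ex[OF aa(2,1) r] unfolding D' by blast
  have cD: "conn E D" unfolding D_def by (rule conn_Union) blast
  have sD: "D \<subseteq> free a \<inter> free a'" unfolding D_def by blast
  have Df: "\<And>d. d \<in> D \<Longrightarrow> d \<in> V \<and> d \<notin> T \<and> d \<notin> A \<and> d \<notin> mid \<and> \<not> E a d \<and> \<not> E a' d \<and> \<not> E d a \<and> \<not> E d a'"
    using sD adj_sym unfolding free_def by blast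
  \<comment> \<open>\<open>W\<close> without its first vertex hangs on \<open>b\<close> and is seen
    by neither \<open>a\<close> nor \<open>a'\<close>, so it belongs to \<open>D\<close>; through it
    \<open>hd W\<close> is attached to \<open>D\<close>.\<close>
  have bT: "conn E (insert b (set (tl W)))" and "set (tl W) \<subseteq> free a \<inter> free a'"
  proof -
    have tW: "W = hd W # tl W" using W_ne by simp
    then have ct: "cpath E (tl W)" and dW: "hd W \<notin> set (tl W)" "set (tl W) \<subseteq> set W"
      using W(1) cpath_distinct[OF W(1)] by (metis cpath.simps(2), metis distinct.simps(2), metis set_subset_Cons)
    have "last W \<in> set (tl W)" using W_ne by (metis last_in_set last_tl)
    then show "conn E (insert b (set (tl W)))"
      using conn_insert[OF conn_cpath[OF symE ct], of "last W" b] B_last[OF b] by blast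
    show "set (tl W) \<subseteq> free a \<inter> free a'"
    proof
      fix w assume w: "w \<in> set (tl W)"
      then have "w \<in> set W" "w \<noteq> hd W" using dW by auto
      moreover then have "w \<notin> cn" using cnD by blast
      ultimately show "w \<in> free a \<inter> free a'" using aa A_iff W(4) unfolding free_def mid_def by blast
    qed
  qed
  moreover have "b \<in> free a \<inter> free a'" using B_free aa b by blast
  ultimately have "insert b (set (tl W)) \<subseteq> D" unfolding D_def by blast
  then have bD: "b \<in> D" "hd (tl W) \<in> D" using W_ne by auto
  have eaa: "E a' a" "a \<noteq> a'" "\<not> E a a" using A_clique aa by auto
  have nq: "\<not> E a q" "\<not> E q a" "\<not> E a' r" "\<not> E r a'" using q(1) r(1) adj_sym unfolding free_def by blast+
  have qr: "q \<noteq> r" using nq r(2) by blast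
  have cS: "conn E (insert q (insert r D))"
  proof -
    obtain d d' where d: "d \<in> D" "E q d" "d' \<in> D" "E r d'" using q(3) r(3) by blast
    have "conn E (insert r D)" using conn_insert[OF cD d(3,4)] d adj_sym by blast
    then show ?thesis using conn_insert[of E "insert r D" d q] d adj_sym by blast
  qed
  from conn_link[OF irrE cS, of q "E a'" r "E a", OF _ q(2) _ r(2)]
  obtain m where m: "cpath E m" "m \<noteq> []" "set m \<subseteq> insert q (insert r D)" "E a' (hd m)" "E a (last m)"
    "\<forall>y\<in>set m. E a' y \<longrightarrow> y = hd m" "\<forall>y\<in>set m. E a y \<longrightarrow> y = last m" by blast
  have hm: "hd m \<in> set m" "last m \<in> set m" using m(2) by simp_all
  have hq: "hd m = q" "last m = r"
  proof -
    have "\<not> E a' y" if "y \<in> D \<or> y = r" for y using that Df nq by blast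
    then show "hd m = q" using m(3,4) hm by blast
    have "\<not> E a y" if "y \<in> D \<or> y = q" for y using that Df nq by blast
    then show "last m = r" using m(3,5) hm by blast
  qed
  have mf: "\<And>y. y \<in> set m \<Longrightarrow> y \<in> V \<and> y \<notin> T \<and> y \<notin> A \<and> y \<notin> mid \<and> y \<noteq> hd W"
  proof -
    fix y assume "y \<in> set m"
    then have "y = q \<or> y = r \<or> y \<in> D" using m(3) by blast
    then have "(y \<in> free a \<or> y \<in> free a')" using q(1) r(1) sD by blast
    then show "y \<in> V \<and> y \<notin> T \<and> y \<notin> A \<and> y \<notin> mid \<and> y \<noteq> hd W"
      using A_hd[OF aa(1)] A_hd[OF aa(2)] unfolding free_def by blast
  qed
  have c1: "cpath E (a' # m)"
  proof (rule cpath_ConsI[OF m(1)])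
    fix v assume "v \<in> set m"
    then show "a' \<noteq> v \<and> (E a' v \<longleftrightarrow> v = hd m)" using mf[of v] aa m(4,6) by blast
  qed
  have c2: "cpath E (m @ [a])"
  proof (rule cpath_appendI[OF m(1)])
    fix u v assume u: "u \<in> set m" and v: "v \<in> set [a]"
    then show "u \<noteq> v \<and> (E u v \<longleftrightarrow> u = last m \<and> v = hd [a])" using mf[of u] aa m(5,7) adj_sym[of u a] adj_sym[of a u] by auto
  qed simp
  have lm: "2 \<le> length m" using hq qr m(2) by (cases m; cases "tl m") auto
  have "odd (length (a' # m))"
  proof (rule hole_close[OF c1, of a])
    show "3 \<le> length (a' # m)" using lm by simp
    fix v assume "v \<in> set (a' # m)"
    then show "a \<noteq> v \<and> (E a v \<longleftrightarrow> v = hd (a' # m) \<or> v = last (a' # m))"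
      using m(2,5,7) eaa adj_sym[of a' a] mf[of v] aa by auto
  qed
  then have em: "even (length m)" by simp
  \<comment> \<open>\<open>T\<close> alone is not enough, since \<open>m\<close> may contain
    vertices of \<open>cn\<close>. One that also sees \<open>hd W\<close> would be in
    \<open>A\<close>, \<open>B\<close> or \<open>mid\<close>; \<open>free\<close> excludes
    \<open>A\<close> and \<open>mid\<close>, and vertices of \<open>B\<close> see only
    \<open>last W\<close> on \<open>W\<close>.\<close>
  let ?X = "insert (hd W) T"
  have hW: "hd W \<in> V - T - cn" using W(4) W_ne by blast
  have cX: "conn (non_adj E) ?X"
  proof -
    have "\<not> complete_to (hd W) T" using hW cnI by blast
    then obtain t where "t \<in> T" "\<not> E (hd W) t" unfolding complete_to_def by blast
    then show ?thesis using conn_insert[OF TV(3), of t "hd W"] hW adj_sym by blast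
  qed
  have fX: "finite ?X" using TV finV finite_subset by blast
  show False
  proof (rule no_complete_pair[OF c1 c2 eaa(1) em m(2) fX _ cX _ _ _ _ cD])
    show "?X \<inter> set (a' # a # m) = {}" using mf aa A_iff cnD W_ne hW by auto
    show "complete_to a' ?X" "complete_to a ?X" using aa A_iff cnD A_hd unfolding complete_to_def by blast+
    show "\<forall>v\<in>set m. \<not> complete_to v ?X"
    proof (intro ballI notI)
      fix v assume v: "v \<in> set m" "complete_to v ?X"
      then have vc: "v \<in> cn" "E v (hd W)" using mf[of v] cnI[of v] unfolding complete_to_def by auto
      then have "v \<in> B" using touch_cases[of v "hd W"] mf[OF v(1)] W_ne by blast
      then show False using vc B_iff W_ne by auto
    qed
    show "D \<inter> ?X = {}" using Df A_hd[OF aa(1)] by blast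
    show "a' \<notin> D" "a \<notin> D" using Df aa by blast+
    show "\<forall>d\<in>D. \<not> E d a' \<and> \<not> E d a" using Df by blast
    have "E (hd W) (hd (tl W))" using W(1) W_ne by (cases W) auto
    then show "\<forall>x\<in>?X. \<exists>d\<in>D. E x d" using bD cnT[of b] b B_iff by blast
    show "\<exists>d\<in>D. \<exists>v\<in>set m. d = v \<or> E d v" using q(3) hm hq adj_sym by blast
  qed blast
qed

text \<open>Fix \<open>b\<close> in \<open>B\<close> and take \<open>a\<close> with the smallest
  \<open>reach b a\<close>. If a path from \<open>a\<close> to \<open>B\<close> meets
  \<open>A\<close> again, this happens in its second vertex \<open>a'\<close>, and the rest lies in
  \<open>reach b a\<close>, because \<open>B\<close> is a clique. By \<open>reach_asym\<close>
  nothing in \<open>reach b a'\<close> sees \<open>a\<close>, so \<open>reach b a'\<close> is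
  contained in \<open>reach b a\<close>, and properly, since it lacks the successor of
  \<open>a'\<close>.\<close>

theorem extremal_vertex:
  shows "\<exists>a\<in>A. \<forall>Q. cpath E Q \<and> Q \<noteq> [] \<and> set Q \<subseteq> V - T - mid \<and> hd Q = a \<and> last Q \<in> B \<longrightarrow> set Q \<inter> A \<subseteq> {a}"
proof -
  obtain b where b: "b \<in> B" using AB by blast
  obtain a where a: "a \<in> A" "\<forall>a'\<in>A. card (reach b a) \<le> card (reach b a')"
    using ex_has_least_nat[of "\<lambda>a. a \<in> A" _ "\<lambda>a. card (reach b a)"] AB(1) by blast
  show ?thesis
  proof (rule bexI[OF _ a(1)], intro allI impI subsetI, rule ccontr)
    fix Q a' assume Q: "cpath E Q \<and> Q \<noteq> [] \<and> set Q \<subseteq> V - T - mid \<and> hd Q = a \<and> last Q \<in> B"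
      and a': "a' \<in> set Q \<inter> A" "a' \<notin> {a}"
    obtain R where R: "Q = a # R" using Q by (cases Q) auto
    have "E a a'" using A_clique a(1) a' by blast
    then have "a' = hd R" "R \<noteq> []" using Q R a' by auto
    then obtain S where S: "Q = a # a' # S" using R by (cases R) auto
    have Sne: "S \<noteq> []" using Q S AB_ne[of a' a'] a' by auto
    have dS: "a' \<notin> set S" using Q S cpath_distinct[of E Q] by auto
    have aS: "\<And>v. v \<in> set S \<Longrightarrow> v \<noteq> a \<and> \<not> E a v" using Q S dS by auto
    have sS: "set S \<subseteq> free a"
    proof
      fix v assume v: "v \<in> set S"
      then have "v \<notin> A" using aS A_clique a(1) by blast
      then show "v \<in> free a" using v aS[OF v] Q S unfolding free_def by auto
    qed
    have cS: "conn E (set S)" using conn_cpath[OF symE, of S] Q S by simp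
    have lS: "last S \<in> set S" "last S \<in> B" using Sne Q S by auto
    have "conn E (insert b (set S))"
    proof (cases "b = last S")
      case True
      then have "insert b (set S) = set S" using lS by blast
      then show ?thesis using cS by simp
    next
      case False
      then show ?thesis using conn_insert[OF cS lS(1), of b] B_clique[OF b lS(2)] adj_sym by blast
    qed
    then have "insert b (set S) \<subseteq> reach b a" using reachI[of "insert b (set S)" a b] sS B_free[OF a(1) b] by blast
    then have h: "hd S \<in> reach b a" "E a' (hd S)" using Sne Q S by auto
    have "\<not> E a r" if "r \<in> reach b a'" for r
      using reach_asym[OF a(1) _ _ b h(1) h(2) that] a' by blast
    then have "reach b a' \<subseteq> free a" using reach_sub[of b a'] unfolding free_def by blast
    then have "reach b a' \<subseteq> reach b a" using reachI[OF conn_reach] b_reach[of a' b] a' b by blast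
    moreover have "hd S \<notin> reach b a'" using reach_sub[of b a'] h(2) unfolding free_def by blast
    ultimately have "reach b a' \<subset> reach b a" using h(1) by blast
    moreover have "finite (reach b a)" using reach_sub[of b a] finV unfolding free_def by (meson Diff_subset finite_subset)
    ultimately have "card (reach b a') < card (reach b a)" by (rule psubset_card_mono[rotated])
    then show False using a(2) a'(1) by auto
  qed
qed

end

section \<open>Quasi-prisms\<close>

context artemis_adj
begin

definition quasi_prism_lists :: "'a list \<Rightarrow> 'a list \<Rightarrow> 'a list \<Rightarrow> 'a list \<Rightarrow> bool" where
  "quasi_prism_lists s1 s2 s3 s4 \<longleftrightarrow>
     cpath E s1 \<and> cpath E s2 \<and> cpath E s3 \<and> cpath E s4 \<and>
     s1 \<noteq> [] \<and> s2 \<noteq> [] \<and> 2 \<le> length s3 \<and> 2 \<le> length s4 \<and>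
     (\<forall>u\<in>set s1. \<forall>v\<in>set s2. u \<noteq> v \<and> \<not> E u v) \<and>
     (\<forall>u\<in>set s1. \<forall>v\<in>set s3. u \<noteq> v \<and> (E u v \<longleftrightarrow> u = last s1 \<and> v = hd s3)) \<and>
     (\<forall>u\<in>set s1. \<forall>v\<in>set s4. u \<noteq> v \<and> (E u v \<longleftrightarrow> u = last s1 \<and> v = hd s4)) \<and>
     (\<forall>u\<in>set s2. \<forall>v\<in>set s3. u \<noteq> v \<and> (E u v \<longleftrightarrow> u = last s2 \<and> v = last s3)) \<and>
     (\<forall>u\<in>set s2. \<forall>v\<in>set s4. u \<noteq> v \<and> (E u v \<longleftrightarrow> u = last s2 \<and> v = last s4)) \<and>
     cross E s3 s4"

lemma quasi_prismD:
  assumes "quasi_prism_lists s1 s2 s3 s4"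
  shows "cpath E s1" "cpath E s2" "cpath E s3" "cpath E s4" "s1 \<noteq> []" "s2 \<noteq> []" "2 \<le> length s3" "2 \<le> length s4"
    "\<forall>u\<in>set s1. \<forall>v\<in>set s2. u \<noteq> v \<and> \<not> E u v"
    "\<forall>u\<in>set s1. \<forall>v\<in>set s3. u \<noteq> v \<and> (E u v \<longleftrightarrow> u = last s1 \<and> v = hd s3)"
    "\<forall>u\<in>set s1. \<forall>v\<in>set s4. u \<noteq> v \<and> (E u v \<longleftrightarrow> u = last s1 \<and> v = hd s4)"
    "\<forall>u\<in>set s2. \<forall>v\<in>set s3. u \<noteq> v \<and> (E u v \<longleftrightarrow> u = last s2 \<and> v = last s3)"
    "\<forall>u\<in>set s2. \<forall>v\<in>set s4. u \<noteq> v \<and> (E u v \<longleftrightarrow> u = last s2 \<and> v = last s4)"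
    "cross E s3 s4"
  using assms unfolding quasi_prism_lists_def by - (elim conjE, assumption)+

lemma crossD:
  "cross E s3 s4 \<Longrightarrow> u \<in> set s3 \<Longrightarrow> v \<in> set s4 \<Longrightarrow>
     u \<noteq> v \<and> (E u v \<longleftrightarrow> u = hd s3 \<and> v = hd s4 \<or> u = last s3 \<and> v = last s4)"
  unfolding cross_def by (drule (1) bspec, drule (1) bspec)

lemma quasi_prism_swap:
  assumes q: "quasi_prism_lists s1 s2 s3 s4" shows "quasi_prism_lists s1 s2 s4 s3"
proof -
  have "cross E s4 s3"
    unfolding cross_def
  proof (intro ballI)
    fix u v assume "u \<in> set s4" "v \<in> set s3"
    from crossD[OF quasi_prismD(14)[OF q] this(2,1)]
    show "u \<noteq> v \<and> (E u v \<longleftrightarrow> u = hd s4 \<and> v = hd s3 \<or> u = last s4 \<and> v = last s3)"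
      using adj_comm[of u v] by auto
  qed
  then show ?thesis unfolding quasi_prism_lists_def by (intro conjI quasi_prismD[OF q])
qed

lemma quasi_prism_flip:
  assumes q: "quasi_prism_lists s1 s2 s3 s4" shows "quasi_prism_lists s2 s1 (rev s3) (rev s4)"
proof -
  have "cross E (rev s3) (rev s4)"
    unfolding cross_def hd_rev last_rev set_rev using crossD[OF quasi_prismD(14)[OF q]] by auto
  moreover have "\<forall>u\<in>set s2. \<forall>v\<in>set s1. u \<noteq> v \<and> \<not> E u v"
    using quasi_prismD(9)[OF q] adj_sym by blast
  moreover have "2 \<le> length (rev s3)" "2 \<le> length (rev s4)" using quasi_prismD(7,8)[OF q] by simp_all
  ultimately show ?thesis unfolding quasi_prism_lists_def hd_rev last_rev set_rev cpath_rev[OF symE]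
    by (intro conjI quasi_prismD[OF q])
qed

text \<open>This path and the corresponding one through \<open>s4\<close> cover the quasi-prism, so
  facts about long paths between its ends carry over to it.\<close>

lemma quasi_prism_path:
  assumes q: "quasi_prism_lists s1 s2 s3 s4"
  shows "cpath E (s1 @ s3 @ rev s2)"
proof -
  have ne: "s1 \<noteq> []" "s2 \<noteq> []" "s3 \<noteq> []" using quasi_prismD(5-7)[OF q] by auto
  have "cpath E (rev s2)" using quasi_prismD(2)[OF q] cpath_rev[OF symE, of s2] by simp
  then have c: "cpath E (s3 @ rev s2)"
  proof (rule cpath_appendI[OF quasi_prismD(3)[OF q]])
    fix u v assume u: "u \<in> set s3" and v: "v \<in> set (rev s2)"
    then have "v \<noteq> u \<and> (E v u \<longleftrightarrow> v = last s2 \<and> u = last s3)"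
      using quasi_prismD(12)[OF q, rule_format, of v u] by simp
    then show "u \<noteq> v \<and> (E u v \<longleftrightarrow> u = last s3 \<and> v = hd (rev s2))"
      unfolding hd_rev using adj_comm[of u v] by auto
  qed
  show ?thesis
  proof (rule cpath_appendI[OF quasi_prismD(1)[OF q] c])
    fix u v assume u: "u \<in> set s1" and v: "v \<in> set (s3 @ rev s2)"
    have hs: "hd (s3 @ rev s2) = hd s3" using ne by simp
    show "u \<noteq> v \<and> (E u v \<longleftrightarrow> u = last s1 \<and> v = hd (s3 @ rev s2))"
      unfolding hs
    proof (cases "v \<in> set s3")
      case True
      then show "u \<noteq> v \<and> (E u v \<longleftrightarrow> u = last s1 \<and> v = hd s3)" using quasi_prismD(10)[OF q, rule_format, OF u] by simp
    next
      case False
      then have "v \<in> set s2" "v \<noteq> hd s3" using v ne by auto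
      then show "u \<noteq> v \<and> (E u v \<longleftrightarrow> u = last s1 \<and> v = hd s3)" using quasi_prismD(9)[OF q, rule_format, OF u, of v] by simp
    qed
  qed
qed

text \<open>Lists count vertices, so an odd length means an even number of edges.\<close>

definition special_in :: "'a set \<Rightarrow> 'a \<Rightarrow> 'a \<Rightarrow> bool" where
  "special_in V a b \<longleftrightarrow> a \<in> V \<and> b \<in> V \<and> a \<noteq> b \<and>
     (\<forall>p. cpath E p \<and> p \<noteq> [] \<and> set p \<subseteq> V \<and> hd p = a \<and> last p = b \<longrightarrow> odd (length p)) \<and>
     \<not> (\<exists>s1 s2 s3 s4. quasi_prism_lists s1 s2 s3 s4 \<and> set s1 \<union> set s2 \<union> set s3 \<union> set s4 \<subseteq> V \<and>
        hd s1 = a \<and> hd s2 = b \<and> (2 \<le> length s1 \<or> 2 \<le> length s2))"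

text \<open>Otherwise a shortest antipath \<open>Q\<close> in \<open>T\<close> from a non-neighbour
  of \<open>x\<close> to a non-neighbour of \<open>y\<close> has at least two vertices, and
  \<open>z\<close>, \<open>x\<close>, \<open>Q\<close>, \<open>y\<close> form an antihole with at
  least five.\<close>

lemma common_nonneighbor:
  assumes T: "conn (non_adj E) T" "x \<notin> T" "y \<notin> T" "E x y" "\<not> complete_to x T" "\<not> complete_to y T"
    and z: "complete_to z T" "z \<notin> T" "\<not> E z x" "\<not> E z y" "z \<noteq> x" "z \<noteq> y"
  shows "\<exists>t\<in>T. \<not> E t x \<and> \<not> E t y"
proof (rule ccontr)
  assume n: "\<not> ?thesis"
  obtain t1 t2 where "t1 \<in> T" "\<not> E x t1" "t2 \<in> T" "\<not> E y t2" using T(5,6) unfolding complete_to_def by blast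
  from conn_link[OF irreflp_non_adj T(1), of t1 "\<lambda>t. \<not> E x t" t2 "\<lambda>t. \<not> E y t", OF this]
  obtain Q where Q: "cpath (non_adj E) Q" "Q \<noteq> []" "set Q \<subseteq> T" "\<not> E x (hd Q)" "\<not> E y (last Q)"
    "\<forall>t\<in>set Q. \<not> E x t \<longrightarrow> t = hd Q" "\<forall>t\<in>set Q. \<not> E y t \<longrightarrow> t = last Q" by blast
  have hQ: "hd Q \<in> set Q" "last Q \<in> set Q" using Q(2) by simp_all
  have "hd Q \<noteq> last Q"
  proof
    assume "hd Q = last Q"
    then have "\<not> E (hd Q) x" "\<not> E (hd Q) y" using Q(4,5) adj_sym by auto
    then show False using n Q(3) hQ by blast
  qed
  then have lQ: "2 \<le> length Q" using Q(2) by (cases Q; cases "tl Q") auto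
  have "cpath (non_adj E) (Q @ [y])"
  proof (rule cpath_appendI[OF Q(1)])
    fix u v assume u: "u \<in> set Q" and v: "v \<in> set [y]"
    then show "u \<noteq> v \<and> (non_adj E u v \<longleftrightarrow> u = last Q \<and> v = hd [y])"
      using Q(3,5,7) T(3) adj_comm[of u y] by auto
  qed simp
  then have c: "cpath (non_adj E) (x # (Q @ [y]))"
  proof (rule cpath_ConsI)
    fix v assume v: "v \<in> set (Q @ [y])"
    have h: "hd (Q @ [y]) = hd Q" using Q(2) by simp
    have "x \<noteq> y" using T(4) by auto
    show "x \<noteq> v \<and> (non_adj E x v \<longleftrightarrow> v = hd (Q @ [y]))"
      unfolding h
    proof (cases "v \<in> set Q")
      case True
      then have "x \<noteq> v" "\<not> E x v \<longleftrightarrow> v = hd Q" using Q(3,4,6) T(2) by auto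
      then show "x \<noteq> v \<and> (non_adj E x v \<longleftrightarrow> v = hd Q)" by blast
    next
      case False
      then have "v = y" "y \<noteq> hd Q" using v hQ(1) by auto
      then show "x \<noteq> v \<and> (non_adj E x v \<longleftrightarrow> v = hd Q)" using T(4) \<open>x \<noteq> y\<close> by auto
    qed
  qed
  then have "chole (non_adj E) (z # (x # (Q @ [y])))"
  proof (rule choleI)
    show "3 \<le> length (x # (Q @ [y]))" using lQ by simp
    fix v assume v: "v \<in> set (x # (Q @ [y]))"
    have h: "hd (x # (Q @ [y])) = x" "last (x # (Q @ [y])) = y" by simp_all
    show "z \<noteq> v \<and> (non_adj E z v \<longleftrightarrow> v = hd (x # (Q @ [y])) \<or> v = last (x # (Q @ [y])))"
      unfolding h
    proof (cases "v \<in> set Q")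
      case True
      then have "E z v" "v \<noteq> x" "v \<noteq> y" using z(1) Q(3) T(2,3) unfolding complete_to_def by auto
      then show "z \<noteq> v \<and> (non_adj E z v \<longleftrightarrow> v = x \<or> v = y)" by auto
    next
      case False
      then have "v = x \<or> v = y" using v by auto
      then show "z \<noteq> v \<and> (non_adj E z v \<longleftrightarrow> v = x \<or> v = y)" using z(3-6) by auto
    qed
  qed
  from no_antihole[OF this] show False using lQ by simp
qed

lemma cpath_crosses:
  assumes "cpath E m" "m \<noteq> []" "hd m \<in> X" "last m \<notin> X"
  shows "\<exists>u\<in>set m \<inter> X. \<exists>v\<in>set m - X. E u v"
proof -
  have "hd m \<in> set m" "last m \<in> set m" using assms(2) by simp_all
  then have "set m \<inter> X \<noteq> {}" "set m \<inter> X \<noteq> set m" using assms(3,4) by blast+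
  then have "\<exists>y\<in>set m \<inter> X. \<exists>z\<in>set m - set m \<inter> X. E y z"
    using conn_cpath[OF symE assms(1)] unfolding conn_def by (meson inf_le1)
  then show ?thesis by blast
qed

text \<open>A shortest link through \<open>S\<close> has at least two vertices, because no vertex of
  \<open>S\<close> sees both \<open>p\<close> and \<open>d\<close>; the edge \<open>p d\<close>
  closes it to a hole.\<close>

lemma linked_hole:
  assumes S: "conn E S" "p \<notin> S" "d \<notin> S" "E p d" "\<exists>s\<in>S. E p s" "\<exists>s\<in>S. E d s" "\<forall>s\<in>S. \<not> (E p s \<and> E d s)"
  obtains m where "cpath E (p # m)" "cpath E (m @ [d])" "even (length m)" "m \<noteq> []" "set m \<subseteq> S" "E p (hd m)" "E d (last m)"
proof -
  obtain s1 s2 where "s1 \<in> S" "E p s1" "s2 \<in> S" "E d s2" using S(5,6) by blast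
  from conn_link[OF irrE S(1), of s1 "E p" s2 "E d", OF this]
  obtain m where m: "cpath E m" "m \<noteq> []" "set m \<subseteq> S" "E p (hd m)" "E d (last m)"
    "\<forall>y\<in>set m. E p y \<longrightarrow> y = hd m" "\<forall>y\<in>set m. E d y \<longrightarrow> y = last m" by blast
  have hm: "hd m \<in> set m" "last m \<in> set m" using m(2) by simp_all
  have "hd m \<noteq> last m"
  proof
    assume "hd m = last m"
    then have "E p (hd m)" "E d (hd m)" using m(4,5) by simp_all
    then show False using S(7) m(3) hm by blast
  qed
  then have lm: "2 \<le> length m" using m(2) by (cases m; cases "tl m") auto
  have c1: "cpath E (p # m)"
  proof (rule cpath_ConsI[OF m(1)])
    fix v assume "v \<in> set m"
    then show "p \<noteq> v \<and> (E p v \<longleftrightarrow> v = hd m)" using m(3,4,6) S(2) by blast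
  qed
  have c2: "cpath E (m @ [d])"
  proof (rule cpath_appendI[OF m(1)])
    fix u v assume "u \<in> set m" "v \<in> set [d]"
    then show "u \<noteq> v \<and> (E u v \<longleftrightarrow> u = last m \<and> v = hd [d])" using m(3,5,7) S(3) adj_comm[of u d] by auto
  qed simp
  have "odd (length (p # m))"
  proof (rule hole_close[OF c1, of d])
    show "3 \<le> length (p # m)" using lm by simp
    fix v assume v: "v \<in> set (p # m)"
    have l: "last (p # m) = last m" using m(2) by simp
    have "d \<noteq> p" using S(4) by auto
    moreover have "p \<noteq> last m" using hm(2) m(3) S(2) by blast
    ultimately show "d \<noteq> v \<and> (E d v \<longleftrightarrow> v = hd (p # m) \<or> v = last (p # m))"
      unfolding l using v m(3,5,7) S(3) adj_sym[OF S(4)] by auto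
  qed
  then show ?thesis using that[OF c1 c2 _ m(2,3,4,5)] by simp
qed

end

section \<open>Excluding strict quasi-prisms between the two sides\<close>

context outer_path
begin

lemma conn_W: "conn E (set W)" by (rule conn_cpath[OF symE W(1)])

text \<open>The last vertex \<open>p\<close> of \<open>s1\<close> and the heads \<open>c\<close>,
  \<open>d\<close> of \<open>s3\<close>, \<open>s4\<close> form a triangle. Since \<open>s1\<close>
  has another vertex, any connection from \<open>s1\<close> to \<open>s2\<close> that avoids
  \<open>p\<close> and the neighbours of \<open>c\<close> and \<open>d\<close> contradicts
  \<open>no_hat\<close>. \<open>W\<close> is such a connection if \<open>c\<close> and
  \<open>d\<close> are both in \<open>cn\<close>, and a vertex of \<open>T\<close> is one if neither
  is; the remaining case is \<open>mixed\<close>.\<close>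

lemma no_strict_quasi_prism:
  assumes q: "quasi_prism_lists s1 s2 s3 s4" and l1: "2 \<le> length s1"
    and ab: "hd s1 \<in> A" "hd s2 \<in> B"
    and S: "set s1 \<union> set s2 \<union> set s3 \<union> set s4 \<subseteq> V - T - mid"
      "(set s1 \<union> set s2 \<union> set s3 \<union> set s4) \<inter> A \<subseteq> {hd s1}" "(set s1 \<union> set s2 \<union> set s3 \<union> set s4) \<inter> B \<subseteq> {hd s2}"
  shows False
proof -
  define a where "a = hd s1"
  define b where "b = hd s2"
  define p where "p = last s1"
  define s where "s = butlast s1"
  have ne: "s1 \<noteq> []" "s2 \<noteq> []" by (fact quasi_prismD(5,6)[OF q])+
  have s1: "s1 = s @ [p]" "s \<noteq> []" "hd s = a" "a \<in> set s"
  proof -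
    show "s1 = s @ [p]" using ne by (simp add: s_def p_def)
    then show "s \<noteq> []" using l1 by auto
    then show "hd s = a" "a \<in> set s" using \<open>s1 = s @ [p]\<close> unfolding a_def by auto
  qed
  have cs1: "cpath E s1" "cpath E s2" "cpath E s3" "cpath E s4" by (fact quasi_prismD(1-4)[OF q])+
  have cs: "cpath E s" using cs1(1) unfolding s1(1) cpath_append by blast
  have ps: "p \<notin> set s" "a \<noteq> p" "E (last s) p" "E p (last s)"
    using cpath_distinct[OF cs1(1)] cs1(1) s1 adj_sym unfolding s1(1) cpath_append by auto
  have bs2: "b \<in> set s2" "last s2 \<in> set s2" using ne unfolding b_def by auto
  have aA: "a \<in> A" "b \<in> B" using ab a_def b_def by auto
  have Wc: "\<And>w. w \<in> set W \<Longrightarrow> w \<in> V \<and> w \<notin> T \<and> w \<notin> cn" using W(4) by blast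
  text \<open>The two long paths enter symmetrically, so everything is done for an arbitrary order of them.\<close>
  have basic: "\<exists>c d s3' s4'. s3 = c # s3' \<and> s4 = d # s4' \<and> s3' \<noteq> [] \<and> s4' \<noteq> [] \<and> last s3 = last s3' \<and> last s4 = last s4' \<and>
      E c d \<and> c \<noteq> d \<and> E p c \<and> E p d \<and> E (last s2) (last s3') \<and> E (last s2) (last s4') \<and> c \<noteq> p \<and> d \<noteq> p \<and>
      (\<forall>v\<in>set s. v \<noteq> c \<and> v \<noteq> d \<and> \<not> E v c \<and> \<not> E v d) \<and>
      (\<forall>v\<in>set s2. v \<noteq> c \<and> v \<noteq> d \<and> v \<noteq> p \<and> \<not> E v c \<and> \<not> E v d \<and> \<not> E v p) \<and>
      (\<forall>v\<in>set s3'. v \<noteq> c \<and> v \<noteq> d \<and> v \<noteq> p \<and> \<not> E v d \<and> \<not> E v p) \<and>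
      (\<forall>v\<in>set s4'. v \<noteq> c \<and> v \<noteq> d \<and> v \<noteq> p \<and> \<not> E v c \<and> \<not> E v p) \<and>
      E c (hd s3') \<and> E d (hd s4') \<and> (\<forall>u\<in>set s. \<forall>v\<in>set s2 \<union> set s3' \<union> set s4'. \<not> E u v)"
    if q: "quasi_prism_lists s1 s2 s3 s4" for s3 s4
  proof -
    have l: "2 \<le> length s3" "2 \<le> length s4" by (fact quasi_prismD(7,8)[OF q])+
    obtain c s3' where s3: "s3 = c # s3'" using l by (cases s3) auto
    obtain d s4' where s4: "s4 = d # s4'" using l by (cases s4) auto
    have ne': "s3' \<noteq> []" "s4' \<noteq> []" using l s3 s4 by auto
    have "distinct s3" "distinct s4" by (fact cpath_distinct[OF quasi_prismD(3)[OF q]] cpath_distinct[OF quasi_prismD(4)[OF q]])+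
    then have d3: "c \<notin> set s3'" "c \<noteq> last s3'" and d4: "d \<notin> set s4'" "d \<noteq> last s4'"
      using s3 s4 ne' last_in_set by auto
    have lp: "last s1 = p" "hd s3 = c" "hd s4 = d" "last s3 = last s3'" "last s4 = last s4'"
      using s3 s4 ne' by (simp_all add: p_def)
    have R12: "\<And>u v. u \<in> set s1 \<Longrightarrow> v \<in> set s2 \<Longrightarrow> u \<noteq> v \<and> \<not> E u v \<and> \<not> E v u"
      using quasi_prismD(9)[OF q] adj_sym by blast
    have R13: "\<And>u v. u \<in> set s1 \<Longrightarrow> v \<in> set s3 \<Longrightarrow> u \<noteq> v \<and> (E u v \<longleftrightarrow> u = p \<and> v = c)"
      by (rule quasi_prismD(10)[OF q, unfolded lp, THEN bspec, THEN bspec])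
    have R14: "\<And>u v. u \<in> set s1 \<Longrightarrow> v \<in> set s4 \<Longrightarrow> u \<noteq> v \<and> (E u v \<longleftrightarrow> u = p \<and> v = d)"
      by (rule quasi_prismD(11)[OF q, unfolded lp, THEN bspec, THEN bspec])
    have R23: "\<And>u v. u \<in> set s2 \<Longrightarrow> v \<in> set s3 \<Longrightarrow> u \<noteq> v \<and> (E u v \<longleftrightarrow> u = last s2 \<and> v = last s3')"
      by (rule quasi_prismD(12)[OF q, unfolded lp, THEN bspec, THEN bspec])
    have R24: "\<And>u v. u \<in> set s2 \<Longrightarrow> v \<in> set s4 \<Longrightarrow> u \<noteq> v \<and> (E u v \<longleftrightarrow> u = last s2 \<and> v = last s4')"
      by (rule quasi_prismD(13)[OF q, unfolded lp, THEN bspec, THEN bspec])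
    have R34: "\<And>u v. u \<in> set s3 \<Longrightarrow> v \<in> set s4 \<Longrightarrow> u \<noteq> v \<and> (E u v \<longleftrightarrow> u = c \<and> v = d \<or> u = last s3' \<and> v = last s4')"
      by (rule crossD[OF quasi_prismD(14)[OF q], unfolded lp])
    have in_s: "p \<in> set s1" "\<And>v. v \<in> set s \<Longrightarrow> v \<in> set s1 \<and> v \<noteq> p" "c \<in> set s3" "d \<in> set s4"
      "\<And>v. v \<in> set s3' \<Longrightarrow> v \<in> set s3" "\<And>v. v \<in> set s4' \<Longrightarrow> v \<in> set s4" using s1 ps s3 s4 by auto
    have l34: "last s3' \<in> set s3'" "last s4' \<in> set s4'" using ne' by auto
    show ?thesis
    proof (rule exI[of _ c], rule exI[of _ d], rule exI[of _ s3'], rule exI[of _ s4'], intro conjI)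
      show "s3 = c # s3'" "s4 = d # s4'" "s3' \<noteq> []" "s4' \<noteq> []" "last s3 = last s3'" "last s4 = last s4'"
        using s3 s4 ne' by auto
      show "E c d" "c \<noteq> d" using R34[OF in_s(3,4)] by auto
      show "E p c" "E p d" using R13[OF in_s(1,3)] R14[OF in_s(1,4)] by auto
      show "E (last s2) (last s3')" "E (last s2) (last s4')"
        using R23[OF bs2(2) in_s(5)[OF l34(1)]] R24[OF bs2(2) in_s(6)[OF l34(2)]] by auto
      show "c \<noteq> p" "d \<noteq> p" using R13[OF in_s(1,3)] R14[OF in_s(1,4)] by auto
      show "\<forall>v\<in>set s. v \<noteq> c \<and> v \<noteq> d \<and> \<not> E v c \<and> \<not> E v d"
        using R13[OF _ in_s(3)] R14[OF _ in_s(4)] in_s(2) by blast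
      show "\<forall>v\<in>set s2. v \<noteq> c \<and> v \<noteq> d \<and> v \<noteq> p \<and> \<not> E v c \<and> \<not> E v d \<and> \<not> E v p"
        using R23[OF _ in_s(3)] R24[OF _ in_s(4)] R12[OF in_s(1)] d3 d4 by blast
      show "\<forall>v\<in>set s3'. v \<noteq> c \<and> v \<noteq> d \<and> v \<noteq> p \<and> \<not> E v d \<and> \<not> E v p"
        using R34[OF _ in_s(4)] R13[OF in_s(1)] in_s(5) d3 d4 adj_sym by blast
      show "\<forall>v\<in>set s4'. v \<noteq> c \<and> v \<noteq> d \<and> v \<noteq> p \<and> \<not> E v c \<and> \<not> E v p"
        using R34[OF in_s(3)] R14[OF in_s(1)] in_s(6) d3 d4 adj_sym by blast
      have "cpath E (c # s3')" "cpath E (d # s4')" using quasi_prismD(3,4)[OF q] unfolding s3 s4 by simp_all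
      then show "E c (hd s3')" "E d (hd s4')" using ne' hd_in_set unfolding cpath.simps by blast+
      show "\<forall>u\<in>set s. \<forall>v\<in>set s2 \<union> set s3' \<union> set s4'. \<not> E u v"
        using R12 R13 R14 in_s by blast
    qed
  qed
  text \<open>\<open>p\<close> is a hat on the hole formed by the two long paths.\<close>
  have hat: False
    if q: "quasi_prism_lists s1 s2 (c # s3') (d # s4')" "s3' \<noteq> []" "s4' \<noteq> []"
      and D: "conn E D" "D \<inter> {c, d, p} = {}" "\<forall>x\<in>D. \<not> E x c \<and> \<not> E x d" "last s \<in> D" "last s2 \<in> D" for c d s3' s4' D
  proof -
    have b: "E c d" "c \<noteq> d" "E p c" "E p d" "E (last s2) (last s3')"
      "\<forall>v\<in>set s3'. v \<noteq> c \<and> v \<noteq> d \<and> v \<noteq> p \<and> \<not> E v d \<and> \<not> E v p"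
      "\<forall>v\<in>set s4'. v \<noteq> c \<and> v \<noteq> d \<and> v \<noteq> p \<and> \<not> E v c \<and> \<not> E v p" using basic[OF q(1)] by auto
    have R34: "\<And>u v. u \<in> set (c # s3') \<Longrightarrow> v \<in> set (d # s4') \<Longrightarrow> u \<noteq> v \<and> (E u v \<longleftrightarrow> u = c \<and> v = d \<or> u = last s3' \<and> v = last s4')"
      using crossD[OF quasi_prismD(14)[OF q(1)]] q(2,3) by simp
    have c34: "cpath E (c # s3')" "cpath E (d # s4')" by (fact quasi_prismD(3,4)[OF q(1)])+
    have r4: "cpath E (rev s4')" "cpath E (rev s4' @ [d])"
      using c34(2) cpath_rev[OF symE, of "d # s4'"] cpath_rev[OF symE, of s4'] by auto
    have c1: "cpath E ((c # s3') @ rev s4')"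
    proof (rule cpath_appendI[OF c34(1) r4(1)])
      fix u v assume u: "u \<in> set (c # s3')" and v: "v \<in> set (rev s4')"
      then show "u \<noteq> v \<and> (E u v \<longleftrightarrow> u = last (c # s3') \<and> v = hd (rev s4'))"
        using R34[OF u, of v] b(7) q(2,3) by (auto simp: hd_rev)
    qed
    have "cpath E s3'" using c34(1) by simp
    then have c2: "cpath E (s3' @ (rev s4' @ [d]))"
    proof (rule cpath_appendI[OF _ r4(2)])
      fix u v assume u: "u \<in> set s3'" and v: "v \<in> set (rev s4' @ [d])"
      have h: "hd (rev s4' @ [d]) = last s4'" using q(3) by (simp add: hd_rev)
      show "u \<noteq> v \<and> (E u v \<longleftrightarrow> u = last s3' \<and> v = hd (rev s4' @ [d]))"
        unfolding h using R34[of u v] u v b(6) by auto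
    qed
    have "odd (length ((c # s3') @ rev s4'))"
    proof (rule hole_close[OF c1, of d])
      show "3 \<le> length ((c # s3') @ rev s4')" using q(2,3) by (cases s3'; cases s4') auto
      fix v assume v: "v \<in> set ((c # s3') @ rev s4')"
      have h: "hd ((c # s3') @ rev s4') = c" "last ((c # s3') @ rev s4') = hd s4'" using q(3) by (simp_all add: last_rev)
      have "v = c \<or> v \<in> set s3' \<or> v \<in> set s4'" using v by auto
      then show "d \<noteq> v \<and> (E d v \<longleftrightarrow> v = hd ((c # s3') @ rev s4') \<or> v = last ((c # s3') @ rev s4'))"
        unfolding h
      proof (elim disjE)
        assume "v = c" then show "d \<noteq> v \<and> (E d v \<longleftrightarrow> v = c \<or> v = hd s4')" using b(1,2) adj_sym by blast
      next
        assume v3: "v \<in> set s3'"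
        have "hd s4' \<in> set (d # s4')" "hd s4' \<noteq> v"
          using q(3) R34[of v "hd s4'"] v3 by auto
        then show "d \<noteq> v \<and> (E d v \<longleftrightarrow> v = c \<or> v = hd s4')" using v3 b(6) adj_sym by blast
      next
        assume v4: "v \<in> set s4'"
        then show "d \<noteq> v \<and> (E d v \<longleftrightarrow> v = c \<or> v = hd s4')" using c34(2) b(7) unfolding cpath.simps(2)[of E d] by blast
      qed
    qed
    then have em: "even (length (s3' @ rev s4'))" by simp
    show False
    proof (rule no_hat[of c "s3' @ rev s4'" d p D])
      show "cpath E (c # s3' @ rev s4')" "cpath E ((s3' @ rev s4') @ [d])" using c1 c2 by simp_all
      show "E c d" "E p c" "E p d" by fact+
      show "even (length (s3' @ rev s4'))" "s3' @ rev s4' \<noteq> []" using em q(2) by auto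
      show "\<forall>v\<in>set (s3' @ rev s4'). p \<noteq> v \<and> \<not> E p v" using b(6,7) adj_sym by auto
      show "conn E D" "D \<inter> {c, d, p} = {}" "\<forall>x\<in>D. \<not> E x c \<and> \<not> E x d" by fact+
      show "\<exists>x\<in>D. E p x" using D(4) ps(4) by blast
      have "last s3' \<in> set (s3' @ rev s4')" using q(2) by simp
      then show "\<exists>x\<in>D. \<exists>v\<in>set (s3' @ rev s4'). x = v \<or> E x v" using D(5) b(5) by blast
    qed
  qed
  have cns: "conn E (set s)" "conn E (set s2)" using conn_cpath[OF symE] cs cs1 by blast+
  have ls: "last s \<in> set s" using s1 by simp
  have hatW: False
    if q: "quasi_prism_lists s1 s2 (c # s3') (d # s4')" "s3' \<noteq> []" "s4' \<noteq> []"
      and Wcd: "\<forall>w\<in>set W. w \<noteq> c \<and> w \<noteq> d \<and> \<not> E w c \<and> \<not> E w d" for c d s3' s4'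
  proof -
    have b: "E c d" "c \<noteq> d" "E p c" "E p d" "\<forall>v\<in>set s. v \<noteq> c \<and> v \<noteq> d \<and> \<not> E v c \<and> \<not> E v d"
      "\<forall>v\<in>set s2. v \<noteq> c \<and> v \<noteq> d \<and> v \<noteq> p \<and> \<not> E v c \<and> \<not> E v d \<and> \<not> E v p" using basic[OF q(1)] by auto
    have pW: "p \<notin> set W" using Wcd b(3) by blast
    have c1: "conn E (set s \<union> set W)"
      using conn_Un_edge[OF cns(1) conn_W, of a "hd W"] s1 W_ne A_hd[OF aA(1)] by blast
    have "conn E ((set s \<union> set W) \<union> set s2)"
      using conn_Un_edge[OF c1 cns(2), of "last W" b] bs2 W_ne B_last[OF aA(2)] by blast
    from hat[OF q this] show False using b Wcd pW ps(1) ls bs2 by blast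
  qed
  have hatt: False
    if q: "quasi_prism_lists s1 s2 (c # s3') (d # s4')" "s3' \<noteq> []" "s4' \<noteq> []"
      and t: "t \<in> T" "\<not> E t c" "\<not> E t d" "c \<notin> T" "d \<notin> T" for c d s3' s4' t
  proof -
    have b: "E c d" "c \<noteq> d" "E p c" "E p d" "\<forall>v\<in>set s. v \<noteq> c \<and> v \<noteq> d \<and> \<not> E v c \<and> \<not> E v d"
      "\<forall>v\<in>set s2. v \<noteq> c \<and> v \<noteq> d \<and> v \<noteq> p \<and> \<not> E v c \<and> \<not> E v d \<and> \<not> E v p" using basic[OF q(1)] by auto
    have pT: "p \<noteq> t" using t b(3) by blast
    have ta: "E a t" "E t a" "E b t" "E t b" using cnT[of a t] cnT[of b t] aA A_iff B_iff t(1) by blast+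
    have c1: "conn E (set s \<union> {t})"
      using conn_Un_edge[OF cns(1) conn_single, of a t] s1 ta by blast
    have "conn E ((set s \<union> {t}) \<union> set s2)"
      using conn_Un_edge[OF c1 cns(2), of t b] bs2 ta by blast
    from hat[OF q this] show False using b t pT ps(1) ls bs2 by blast
  qed
  let ?U = "set s1 \<union> set s2 \<union> set s3 \<union> set s4"
  \<comment> \<open>A vertex of \<open>cn\<close> that touches \<open>W\<close> is in
    \<open>A\<close>, \<open>B\<close> or \<open>mid\<close>, and of these the quasi-prism contains
    only \<open>a\<close> and \<open>b\<close>.\<close>
  have Nf: "x \<noteq> w \<and> \<not> E x w \<and> \<not> E w x" if "x \<in> ?U" "x \<in> cn" "x \<noteq> a" "x \<noteq> b" "w \<in> set W" for x w
    using touch_cases[of x w] that S Wc[of w] unfolding a_def b_def by blast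
  have aT: "\<And>t. t \<in> T \<Longrightarrow> E a t \<and> E t a \<and> E b t \<and> E t b" using cnT[of a] cnT[of b] aA A_iff B_iff by blast
  have abcn: "a \<in> cn" "b \<in> cn" "complete_to a T" "complete_to b T" "a \<notin> T" "b \<notin> T" using aA A_iff B_iff cnD by blast+
  have finT: "finite T" using TV finV finite_subset by blast
  \<comment> \<open>As \<open>c\<close> does not touch \<open>W\<close>, the vertex \<open>d\<close>
    sees \<open>W\<close> by \<open>hatW\<close>. If \<open>p\<close> is in \<open>cn\<close>, the
    edge \<open>p c\<close> is the complete pair of a hole; if not, \<open>p\<close> and
    \<open>d\<close> have a common non-neighbour \<open>t\<close> in \<open>T\<close>.\<close>
  have mixed: False
    if q: "quasi_prism_lists s1 s2 (c # s3') (d # s4')" "s3' \<noteq> []" "s4' \<noteq> []"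
      and U: "set (c # s3') \<union> set (d # s4') \<subseteq> ?U" and cd: "c \<in> cn" "d \<notin> cn" for c d s3' s4'
  proof -
    have b1: "E c d" "c \<noteq> d" "E p c" "E p d" "E (last s2) (last s3')" "E (last s2) (last s4')" "E c (hd s3')" "E d (hd s4')"
      "c \<noteq> p" "d \<noteq> p" using basic[OF q(1)] by auto
    have bs: "\<And>v. v \<in> set s \<Longrightarrow> v \<noteq> c \<and> v \<noteq> d \<and> \<not> E v c \<and> \<not> E v d \<and> \<not> E c v \<and> \<not> E d v"
      and b2: "\<And>v. v \<in> set s2 \<Longrightarrow> v \<noteq> c \<and> v \<noteq> d \<and> v \<noteq> p \<and> \<not> E v c \<and> \<not> E v d \<and> \<not> E v p \<and> \<not> E c v \<and> \<not> E d v \<and> \<not> E p v"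
      and b3: "\<And>v. v \<in> set s3' \<Longrightarrow> v \<noteq> c \<and> v \<noteq> d \<and> v \<noteq> p \<and> \<not> E v d \<and> \<not> E v p \<and> \<not> E d v \<and> \<not> E p v"
      and b4: "\<And>v. v \<in> set s4' \<Longrightarrow> v \<noteq> c \<and> v \<noteq> d \<and> v \<noteq> p \<and> \<not> E v c \<and> \<not> E v p \<and> \<not> E c v \<and> \<not> E p v"
    proof -
      note sy = adj_sym[of c] adj_sym[of d] adj_sym[of p]
      have "\<forall>v\<in>set s. v \<noteq> c \<and> v \<noteq> d \<and> \<not> E v c \<and> \<not> E v d" using basic[OF q(1)] by auto
      then show "\<And>v. v \<in> set s \<Longrightarrow> v \<noteq> c \<and> v \<noteq> d \<and> \<not> E v c \<and> \<not> E v d \<and> \<not> E c v \<and> \<not> E d v" using sy by blast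
      have "\<forall>v\<in>set s2. v \<noteq> c \<and> v \<noteq> d \<and> v \<noteq> p \<and> \<not> E v c \<and> \<not> E v d \<and> \<not> E v p" using basic[OF q(1)] by auto
      then show "\<And>v. v \<in> set s2 \<Longrightarrow> v \<noteq> c \<and> v \<noteq> d \<and> v \<noteq> p \<and> \<not> E v c \<and> \<not> E v d \<and> \<not> E v p \<and> \<not> E c v \<and> \<not> E d v \<and> \<not> E p v"
        using sy by blast
      have "\<forall>v\<in>set s3'. v \<noteq> c \<and> v \<noteq> d \<and> v \<noteq> p \<and> \<not> E v d \<and> \<not> E v p" using basic[OF q(1)] by auto
      then show "\<And>v. v \<in> set s3' \<Longrightarrow> v \<noteq> c \<and> v \<noteq> d \<and> v \<noteq> p \<and> \<not> E v d \<and> \<not> E v p \<and> \<not> E d v \<and> \<not> E p v" using sy by blast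
      have "\<forall>v\<in>set s4'. v \<noteq> c \<and> v \<noteq> d \<and> v \<noteq> p \<and> \<not> E v c \<and> \<not> E v p" using basic[OF q(1)] by auto
      then show "\<And>v. v \<in> set s4' \<Longrightarrow> v \<noteq> c \<and> v \<noteq> d \<and> v \<noteq> p \<and> \<not> E v c \<and> \<not> E v p \<and> \<not> E c v \<and> \<not> E p v" using sy by blast
    qed
    have sep: "\<forall>u\<in>set s. \<forall>v\<in>set s2 \<union> set s3' \<union> set s4'. \<not> E u v" using basic[OF q(1)] by auto
    have inU: "c \<in> ?U" "d \<in> ?U" "p \<in> ?U" "set s \<subseteq> ?U" using U s1 by auto
    have VT: "\<And>v. v \<in> ?U \<Longrightarrow> v \<in> V \<and> v \<notin> T" using S(1) by blast
    have cab: "c \<noteq> a" "c \<noteq> b" "d \<noteq> a" "d \<noteq> b" "p \<noteq> a" "p \<noteq> b" using bs[OF s1(4)] b2[OF bs2(1)] ps by auto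
    have cW: "\<And>w. w \<in> set W \<Longrightarrow> c \<noteq> w \<and> \<not> E c w \<and> \<not> E w c" using Nf[OF inU(1) cd(1) cab(1,2)] by blast
    have dW: "d \<notin> set W" "p \<notin> set W" using cW b1(1,3) by blast+
    have exdW: "\<exists>w\<in>set W. E d w"
    proof (rule ccontr)
      assume n: "\<not> ?thesis"
      have "\<forall>w\<in>set W. w \<noteq> c \<and> w \<noteq> d \<and> \<not> E w c \<and> \<not> E w d" using n cW dW adj_sym by blast
      then show False using hatW[OF q] by blast
    qed
    have dT: "\<not> complete_to d T" using cd(2) cnI VT[OF inU(2)] by blast
    have c3': "conn E (set s3')" "conn E (set s4')"
      using conn_cpath[OF symE, of s3'] conn_cpath[OF symE, of s4'] quasi_prismD(3,4)[OF q(1)] by simp_all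
    have l34: "last s3' \<in> set s3'" "last s4' \<in> set s4'" "hd s3' \<in> set s3'" "hd s4' \<in> set s4'" using q by simp_all
    show False
    proof (cases "p \<in> cn")
      case pcn: True
      have pW: "\<And>w. w \<in> set W \<Longrightarrow> p \<noteq> w \<and> \<not> E p w \<and> \<not> E w p" using Nf[OF inU(3) pcn cab(5,6)] by blast
      let ?S = "((set s \<union> set W) \<union> set s2) \<union> set s3'"
      have c1: "conn E (set s \<union> set W)"
        using conn_Un_edge[OF cns(1) conn_W, of a "hd W"] s1 W_ne A_hd[OF aA(1)] by blast
      have c2: "conn E ((set s \<union> set W) \<union> set s2)"
        using conn_Un_edge[OF c1 cns(2), of "last W" b] bs2 W_ne B_last[OF aA(2)] by blast
      have c3: "conn E ?S"
        using conn_Un_edge[OF c2 c3'(1), of "last s2" "last s3'"] bs2 l34 b1(5) adj_sym by blast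
      obtain m where m: "cpath E (p # m)" "cpath E (m @ [c])" "even (length m)" "m \<noteq> []" "set m \<subseteq> ?S" "E p (hd m)" "E c (last m)"
      proof (rule linked_hole[OF c3, of p c])
        show "p \<notin> ?S" using ps(1) dW(2) b2 b3 by blast
        show "c \<notin> ?S" using bs b2 b3 cW by blast
        show "E p c" by (rule b1(3))
        show "\<exists>s\<in>?S. E p s" using ps(4) ls by blast
        show "\<exists>s\<in>?S. E c s" using b1(7) l34 by blast
        show "\<forall>s\<in>?S. \<not> (E p s \<and> E c s)" using bs b2 b3 cW by blast
      qed blast
      have hm: "hd m \<in> set m" "last m \<in> set m" using m(4) by simp_all
      \<comment> \<open>The hole passes from \<open>p\<close> into \<open>s\<close> and ends outside
        \<open>s\<close>. Within \<open>?S\<close> the only edges leaving \<open>s\<close> go to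
        \<open>W\<close>, so the hole contains vertices of \<open>W\<close>.\<close>
      have h1: "hd m \<in> set s" using m(5,6) hm pW b2 b3 by blast
      have h2: "last m \<notin> set s" using m(7) bs by blast
      have cm: "cpath E m" using m(1) by simp
      obtain u v where uv: "u \<in> set m" "u \<in> set s" "v \<in> set m" "v \<notin> set s" "E u v"
        using cpath_crosses[OF cm m(4) h1 h2] by blast
      then have vW: "v \<in> set W" using m(5) sep by blast
      \<comment> \<open>On the hole, apart from \<open>p\<close> and \<open>c\<close>, only vertices
        of \<open>W\<close> can see \<open>d\<close>, and these are not
        \<open>T\<close>-complete.\<close>
      let ?X = "insert d T"
      have cX: "conn (non_adj E) ?X"
      proof -
        obtain t where "t \<in> T" "\<not> E d t" using dT unfolding complete_to_def by blast
        then show ?thesis using conn_insert[OF TV(3), of t d] VT[OF inU(2)] adj_sym by blast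
      qed
      have ST: "\<And>v. v \<in> ?S \<Longrightarrow> v \<notin> T" using Wc VT inU(4) U by auto
      show False
      proof (rule no_complete_pair[OF m(1,2) b1(3) m(3,4) _ _ cX, of "insert b (set W)"])
        show "finite ?X" using finT by simp
        have "set m \<inter> T = {}" using m(5) ST by blast
        moreover have "d \<notin> set m" using m(5) bs b2 b3 dW by blast
        ultimately show "?X \<inter> set (p # c # m) = {}" using VT[OF inU(1)] VT[OF inU(3)] b1 by auto
        show "complete_to p ?X" "complete_to c ?X" using cnD[OF pcn] cnD[OF cd(1)] b1 unfolding complete_to_def by auto
        show "\<forall>v\<in>set m. \<not> complete_to v ?X"
        proof (intro ballI notI)
          fix v assume v: "v \<in> set m" "complete_to v ?X"
          then have "E v d" "complete_to v T" unfolding complete_to_def by auto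
          then have "v \<in> set W" using v(1) m(5) bs b2 b3 by blast
          then show False using Wc cnI \<open>complete_to v T\<close> by blast
        qed
        show "conn E (insert b (set W))" using conn_insert[OF conn_W, of "last W" b] W_ne B_last[OF aA(2)] by blast
        show "insert b (set W) \<inter> ?X = {}" using Wc dW cab abcn by blast
        show "p \<notin> insert b (set W)" "c \<notin> insert b (set W)" using dW cab cW by blast+
        show "\<forall>x\<in>insert b (set W). \<not> E x p \<and> \<not> E x c" using pW cW b2[OF bs2(1)] by blast
        show "\<forall>x\<in>?X. \<exists>y\<in>insert b (set W). E x y" using aT exdW by blast
        show "\<exists>x\<in>insert b (set W). \<exists>v\<in>set m. x = v \<or> E x v" using uv vW by blast
      qed blast
    next
      case pcn: False
      have pT: "\<not> complete_to p T" using pcn cnI VT[OF inU(3)] by blast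
      obtain t where t: "t \<in> T" "\<not> E t p" "\<not> E t d"
        using common_nonneighbor[OF TV(3) _ _ b1(4) pT dT abcn(4,6)] VT[OF inU(3)] VT[OF inU(2)] b2[OF bs2(1)] by blast
      have tc: "E t c" "E c t" using cnT[OF cd(1) t(1)] by blast+
      have tn: "t \<noteq> c" "t \<noteq> d" "t \<noteq> p" "t \<notin> set W" "t \<notin> ?U" "t \<noteq> b"
        using VT t(1) inU Wc abcn by blast+
      \<comment> \<open>Inside \<open>?S\<close>, the path \<open>F\<close> leads from
        \<open>t\<close> to the first vertex \<open>?f\<close> that sees \<open>p\<close> or
        \<open>d\<close>; \<open>c\<close> sees only \<open>t\<close> on it.\<close>
      let ?S = "insert t (insert b (set W))"
      have cS: "conn E ?S"
        using conn_insert[OF conn_insert[OF conn_W, of "last W" b], of b t] W_ne B_last[OF aA(2)] aT[OF t(1)] by blast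
      obtain w where w: "w \<in> set W" "E d w" using exdW by blast
      have "\<exists>F. cpath E F \<and> F \<noteq> [] \<and> set F \<subseteq> ?S \<and> hd F = t \<and> (E (last F) p \<or> E (last F) d) \<and>
        (\<forall>y\<in>set F. y = t \<longrightarrow> y = hd F) \<and> (\<forall>y\<in>set F. E y p \<or> E y d \<longrightarrow> y = last F)"
        using conn_link[OF irrE cS, of t "\<lambda>x. x = t" w "\<lambda>x. E x p \<or> E x d"] w adj_sym by blast
      then obtain F where F: "cpath E F" "F \<noteq> []" "set F \<subseteq> ?S" "hd F = t" "E (last F) p \<or> E (last F) d"
        "\<forall>y\<in>set F. E y p \<or> E y d \<longrightarrow> y = last F" by blast
      obtain F' where F': "F = t # F'" using F(2,4) by (cases F) auto
      have F'ne: "F' \<noteq> []" using F(5) F' t by auto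
      have tF: "t \<notin> set F'" using cpath_distinct[OF F(1)] F' by simp
      have sF: "set F' \<subseteq> insert b (set W)" using F(3) F' tF by auto
      let ?f = "last F"
      have fF: "?f = last F'" "?f \<in> set F'" "?f \<in> set F" using F'ne F' by auto
      have nF: "\<And>y. y \<in> set F \<Longrightarrow> y \<noteq> c \<and> y \<noteq> d \<and> y \<noteq> p"
        using F(3) tn cab dW cW by blast
      have cF: "\<And>y. y \<in> set F \<Longrightarrow> (E c y \<longleftrightarrow> y = t)"
        using F' sF tc cW b2[OF bs2(1)] tF by auto
      have c1: "cpath E (c # F)"
      proof (rule cpath_ConsI[OF F(1)])
        fix v assume "v \<in> set F"
        then show "c \<noteq> v \<and> (E c v \<longleftrightarrow> v = hd F)" using cF[of v] nF[of v] F(4) by blast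
      qed
      have c2: "cpath E (F @ [x])" and ev: "even (length F)" if x: "x = d \<or> x = p" "E ?f x" "E x c" for x
      proof -
        have xF: "\<And>y. y \<in> set F \<Longrightarrow> y \<noteq> x \<and> (E y x \<longleftrightarrow> y = ?f) \<and> (E x y \<longleftrightarrow> y = ?f)"
          using nF F(6) x adj_sym by metis
        show "cpath E (F @ [x])"
          by (rule cpath_appendI[OF F(1)]) (use xF in auto)
        have "odd (length (c # F))"
        proof (rule hole_close[OF c1, of x])
          show "3 \<le> length (c # F)" using F' F'ne by (cases F') auto
          fix v assume v: "v \<in> set (c # F)"
          have h: "hd (c # F) = c" "last (c # F) = ?f" using F(2) by simp_all
          have "x \<noteq> c" using x(3) by auto
          moreover have "c \<noteq> ?f" using nF[OF fF(3)] by blast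
          ultimately show "x \<noteq> v \<and> (E x v \<longleftrightarrow> v = hd (c # F) \<or> v = last (c # F))"
            unfolding h using v xF[of v] x(3) by auto
        qed
        then show "even (length F)" by simp
      qed
      have dc: "E d c" "E d p" "E c p" using b1 adj_sym by blast+
      have tF2: "t \<in> set F" using F' by simp
      show False
      proof (cases "E ?f p \<and> E ?f d")
        case False
        then consider "E ?f d" "\<not> E ?f p" | "E ?f p" "\<not> E ?f d" using F(5) by blast
        then show False
        proof cases
          case 1
          \<comment> \<open>\<open>p\<close> is a hat on the hole \<open>c F d\<close>, attached
            through \<open>s\<close>, which contains the neighbour \<open>a\<close> of
            \<open>t\<close>.\<close>
          have "\<forall>y\<in>set F. \<not> E y p" using F(6) 1 by blast
          then have pF: "\<forall>v\<in>set F. p \<noteq> v \<and> \<not> E p v" using nF adj_sym by blast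
          show False
          proof (rule no_hat[OF c1 c2[OF _ 1(1) dc(1)] b1(1) ev[OF _ 1(1) dc(1)] F(2) b1(3,4) pF cns(1)])
            show "set s \<inter> {c, d, p} = {}" using bs ps(1) by blast
            show "\<forall>x\<in>set s. \<not> E x c \<and> \<not> E x d" using bs by blast
            show "\<exists>x\<in>set s. E p x" using ps(4) ls by blast
            show "\<exists>x\<in>set s. \<exists>v\<in>set F. x = v \<or> E x v" using s1(4) aT[OF t(1)] tF2 by blast
          qed simp_all
        next
          case 2
          \<comment> \<open>\<open>d\<close> is a hat on the hole \<open>c F p\<close>, attached
            through \<open>s4'\<close> and \<open>s2\<close>, which contain the neighbour
            \<open>b\<close> of \<open>t\<close>.\<close>
          have "\<forall>y\<in>set F. \<not> E y d" using F(6) 2 by blast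
          then have dF: "\<forall>v\<in>set F. d \<noteq> v \<and> \<not> E d v" using nF adj_sym by blast
          have cD: "conn E (set s4' \<union> set s2)"
            using conn_Un_edge[OF c3'(2) cns(2), of "last s4'" "last s2"] bs2 l34 b1(6) adj_sym by blast
          show False
          proof (rule no_hat[OF c1 c2[OF _ 2(1) b1(3)] dc(3) ev[OF _ 2(1) b1(3)] F(2) dc(1,2) dF cD])
            show "(set s4' \<union> set s2) \<inter> {c, p, d} = {}" using b2 b4 by blast
            show "\<forall>x\<in>set s4' \<union> set s2. \<not> E x c \<and> \<not> E x p" using b2 b4 by blast
            show "\<exists>x\<in>set s4' \<union> set s2. E d x" using b1(8) l34 by blast
            show "\<exists>x\<in>set s4' \<union> set s2. \<exists>v\<in>set F. x = v \<or> E x v" using bs2(1) aT[OF t(1)] tF2 by blast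
          qed simp_all
        qed
      next
        case both: True
        \<comment> \<open>A hole through the edge \<open>p d\<close> is sought in
          \<open>?S2\<close>. It starts in \<open>s\<close> and can leave \<open>s\<close> only
          through \<open>t\<close>.\<close>
        let ?S2 = "(insert t (set s) \<union> set s2) \<union> set s4'"
        have d1: "conn E (insert t (set s))" using conn_insert[OF cns(1) s1(4), of t] aT[OF t(1)] by blast
        have d2: "conn E (insert t (set s) \<union> set s2)"
          using conn_Un_edge[OF d1 cns(2), of t b] bs2 aT[OF t(1)] by blast
        have d3: "conn E ?S2"
          using conn_Un_edge[OF d2 c3'(2), of "last s2" "last s4'"] bs2 l34 b1(6) adj_sym by blast
        have nocom: "\<forall>s\<in>?S2. \<not> (E p s \<and> E d s)" using bs b2 b4 t adj_sym by blast
        obtain m where m: "cpath E (p # m)" "cpath E (m @ [d])" "even (length m)" "m \<noteq> []" "set m \<subseteq> ?S2" "E p (hd m)" "E d (last m)"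
        proof (rule linked_hole[OF d3, of p d])
          show "p \<notin> ?S2" using ps(1) tn b2 b4 by blast
          show "d \<notin> ?S2" using bs tn b2 b4 by blast
          show "E p d" by (rule b1(4))
          show "\<exists>s\<in>?S2. E p s" using ps(4) ls by blast
          show "\<exists>s\<in>?S2. E d s" using b1(8) l34 by blast
          show "\<forall>s\<in>?S2. \<not> (E p s \<and> E d s)" by (rule nocom)
        qed blast
        have hm: "hd m \<in> set m" "last m \<in> set m" using m(4) by simp_all
        have h1: "hd m \<in> set s" using m(5,6) hm t(2) b2 b4 adj_sym by blast
        have h2: "last m \<notin> set s" using m(7) bs by blast
        have cm: "cpath E m" using m(1) by simp
        obtain u v where uv: "u \<in> set m" "u \<in> set s" "v \<in> set m" "v \<notin> set s" "E u v"
          using cpath_crosses[OF cm m(4) h1 h2] by blast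
        then have tm: "t \<in> set m" using m(5) sep by blast
        \<comment> \<open>Two nonadjacent vertices, both seeing \<open>p\<close> and
          \<open>d\<close>. Elsewhere on the hole only \<open>t\<close> sees \<open>c\<close>, so
          only \<open>t\<close> can be complete to the pair.\<close>
        let ?X = "{c, ?f}"
        have fc: "c \<noteq> ?f" "\<not> E c ?f" "?f \<noteq> p" "?f \<noteq> d"
          using nF[OF fF(3)] cF[OF fF(3)] tF fF(2) by blast+
        have cX: "conn (non_adj E) ?X" using conn_edge[of "non_adj E" c ?f] fc adj_sym[of ?f c] by auto
        have Ef: "E p ?f" "E d ?f" using both adj_sym by blast+
        have fS: "?f \<notin> ?S2" using nocom Ef by blast
        have cS2: "c \<notin> ?S2" using bs tn b2 b4 by blast
        have Xm: "set m \<inter> ?X = {}" using m(5) fS cS2 by blast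
        have co: "complete_to p ?X" "complete_to d ?X" using Ef dc b1 unfolding complete_to_def by auto
        have onlyt: "\<And>v. v \<in> set m \<Longrightarrow> complete_to v ?X \<Longrightarrow> v = t"
          using m(5) bs b2 b4 unfolding complete_to_def by blast
        show False
        proof (cases "E t ?f")
          case False
          \<comment> \<open>If \<open>t\<close> misses \<open>?f\<close>, the hole has no complete
            vertices besides \<open>p\<close> and \<open>d\<close>, and \<open>F\<close> without
            \<open>?f\<close> attaches \<open>c\<close> and \<open>?f\<close> to it.\<close>
          have lF: "F' = butlast F' @ [?f]" using F'ne fF(1) by simp
          have "butlast F' \<noteq> []"
          proof
            assume "butlast F' = []"
            then obtain x where x: "F' = [x]" using lF by auto
            then have "F = [t, x]" using F' by simp
            then show False using F(1) False by simp
          qed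
          then have bl: "butlast F = t # butlast F'" "F = butlast F @ [?f]" using F' F'ne by simp_all
          have "cpath E (butlast F @ [?f])" using F(1) bl(2) by simp
          then have cb: "cpath E (butlast F)" "E (last (butlast F)) ?f"
            unfolding cpath_append using bl(1) by simp_all
          have "distinct (butlast F @ [?f])" using cpath_distinct[OF F(1)] bl(2) by simp
          then have fnb: "?f \<notin> set (butlast F)" by simp
          have sb: "set (butlast F) \<subseteq> set F" by (auto dest: in_set_butlastD)
          show False
          proof (rule no_complete_pair[OF m(1,2) b1(4) m(3,4) _ _ cX, of "set (butlast F)"])
            show "finite ?X" "?X \<noteq> {}" by simp_all
            show "?X \<inter> set (p # d # m) = {}" using Xm fc b1 by auto
            show "complete_to p ?X" "complete_to d ?X" by (fact co)+
            show "\<forall>v\<in>set m. \<not> complete_to v ?X" using onlyt False unfolding complete_to_def by blast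
            show "conn E (set (butlast F))" by (rule conn_cpath[OF symE cb(1)])
            show "set (butlast F) \<inter> ?X = {}" using sb nF fnb by blast
            show "p \<notin> set (butlast F)" "d \<notin> set (butlast F)" using sb nF by blast+
            show "\<forall>x\<in>set (butlast F). \<not> E x p \<and> \<not> E x d" using F(6) sb fnb by blast
            have "t \<in> set (butlast F)" "last (butlast F) \<in> set (butlast F)" using bl(1) by simp_all
            then show "\<forall>x\<in>?X. \<exists>y\<in>set (butlast F). E x y" "\<exists>x\<in>set (butlast F). \<exists>v\<in>set m. x = v \<or> E x v"
              using tc tm adj_sym[OF cb(2)] by blast+
          qed
        next
          case tf: True
          \<comment> \<open>If \<open>t\<close> sees \<open>?f\<close>, Roussel-Rubio makes the
            parts of \<open>m\<close> before and after \<open>t\<close> odd, and then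
            \<open>m\<close> would be odd.\<close>
          obtain m1 m2 where mm: "m = m1 @ t # m2" using tm by (meson split_list)
          have dm: "t \<notin> set m1" "t \<notin> set m2" using cpath_distinct[OF cm] mm by auto
          have R: "rr ?X" using roussel_rubio[of ?X] cX by simp
          have ct: "complete_to t ?X" using tf tc unfolding complete_to_def by simp
          have n1: "\<forall>y\<in>set m1. \<not> complete_to y ?X" "\<forall>y\<in>set m2. \<not> complete_to y ?X" using onlyt dm mm by auto
          have pd: "p \<notin> ?X" "d \<notin> ?X" "t \<notin> ?X" using fc b1 tn tF fF by auto
          have "cpath E ((p # m1 @ [t]) @ m2)" using m(1) mm by simp
          then have q1: "cpath E (p # m1 @ [t])" using cpath_infix[of E "[]" "p # m1 @ [t]" m2] by simp
          have "cpath E (m1 @ (t # m2 @ [d]))" using m(2) mm by simp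
          then have q2: "cpath E (t # m2 @ [d])" using cpath_infix[of E m1 "t # m2 @ [d]" "[]"] by simp
          have "m1 = [] \<or> odd (length m1)"
            by (rule rr_segment[OF R q1 _ co(1) ct n1(1)]) (use Xm mm pd in auto)
          moreover have "m1 \<noteq> []" using m(6) mm t(2) adj_sym by auto
          moreover have "m2 = [] \<or> odd (length m2)"
            by (rule rr_segment[OF R q2 _ ct co(2) n1(2)]) (use Xm mm pd in auto)
          moreover have "m2 \<noteq> []" using m(7) mm t(3) adj_sym by auto
          ultimately show False using m(3) mm by simp
        qed
      qed
    qed
  qed
  obtain c s3' where s3: "s3 = c # s3'" "s3' \<noteq> []" using quasi_prismD(7)[OF q] by (cases s3; cases "tl s3") auto
  obtain d s4' where s4: "s4 = d # s4'" "s4' \<noteq> []" using quasi_prismD(8)[OF q] by (cases s4; cases "tl s4") auto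
  have q1: "quasi_prism_lists s1 s2 (c # s3') (d # s4')" using q s3 s4 by simp
  have q2: "quasi_prism_lists s1 s2 (d # s4') (c # s3')" by (rule quasi_prism_swap[OF q1])
  have b: "E c d" "\<forall>v\<in>set s. v \<noteq> c \<and> v \<noteq> d \<and> \<not> E v c \<and> \<not> E v d"
    "\<forall>v\<in>set s2. v \<noteq> c \<and> v \<noteq> d \<and> v \<noteq> p \<and> \<not> E v c \<and> \<not> E v d \<and> \<not> E v p"
    using basic[OF q1] by auto
  have nab: "a \<noteq> c" "a \<noteq> d" "b \<noteq> c" "b \<noteq> d" "\<not> E a c" "\<not> E a d" using b(2,3) s1(4) bs2(1) by blast+
  have inU: "c \<in> ?U" "d \<in> ?U" using s3 s4 by auto
  consider "c \<in> cn" "d \<in> cn" | "c \<in> cn" "d \<notin> cn" | "c \<notin> cn" "d \<in> cn" | "c \<notin> cn" "d \<notin> cn" by blast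
  then show False
  proof cases
    case 1
    have "\<forall>w\<in>set W. w \<noteq> c \<and> w \<noteq> d \<and> \<not> E w c \<and> \<not> E w d"
      using Nf[OF inU(1) 1(1)] Nf[OF inU(2) 1(2)] nab by metis
    then show False using hatW[OF q1 s3(2) s4(2)] by blast
  next
    case 2
    then show False using mixed[OF q1 s3(2) s4(2) _ 2] s3 s4 by auto
  next
    case 3
    then show False using mixed[OF q2 s4(2) s3(2) _ 3(2,1)] s3 s4 by auto
  next
    case 4
    have nT: "c \<notin> T" "d \<notin> T" "\<not> complete_to c T" "\<not> complete_to d T"
      using 4 cnI S(1) inU by blast+
    obtain t where "t \<in> T" "\<not> E t c" "\<not> E t d"
      using common_nonneighbor[OF TV(3) nT(1,2) b(1) nT(3,4) abcn(3,5)] nab by blast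
    then show False using hatt[OF q1 s3(2) s4(2)] nT by blast
  qed
qed

end

section \<open>Existence of a special even pair\<close>

context outer_path
begin

text \<open>Both ends are taken from \<open>extremal_vertex\<close>, one from each side. Long
  chordless paths between them meet \<open>A\<close> and \<open>B\<close> only in their ends, which
  \<open>odd_path_meets_sides\<close> forbids for an even number of vertices. A strict quasi-prism
  is covered by two such paths and falls under \<open>no_strict_quasi_prism\<close>, after
  \<open>quasi_prism_flip\<close> if it is \<open>s2\<close> that has two vertices.\<close>

theorem special_pair: "\<exists>a\<in>A. \<exists>b\<in>B. special_in V a b"
proof -
  interpret r: outer_path E V T "rev W" by (rule rev_outer_path)
  obtain a where a: "a \<in> A" "\<And>Q. cpath E Q \<Longrightarrow> Q \<noteq> [] \<Longrightarrow> set Q \<subseteq> V - T - mid \<Longrightarrow> hd Q = a \<Longrightarrow> last Q \<in> B \<Longrightarrow> set Q \<inter> A \<subseteq> {a}"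
    using extremal_vertex by blast
  obtain b where b: "b \<in> B" "\<And>Q. cpath E Q \<Longrightarrow> Q \<noteq> [] \<Longrightarrow> set Q \<subseteq> V - T - mid \<Longrightarrow> hd Q = b \<Longrightarrow> last Q \<in> A \<Longrightarrow> set Q \<inter> B \<subseteq> {b}"
    using r.extremal_vertex unfolding mid_rev rev_rev_ident by blast
  have meet: "set Q \<subseteq> V - T - mid \<and> set Q \<inter> A \<subseteq> {a} \<and> set Q \<inter> B \<subseteq> {b}"
    if Q: "cpath E Q" "set Q \<subseteq> V" "4 \<le> length Q" "hd Q = a" "last Q = b" for Q
  proof -
    have ne: "Q \<noteq> []" using Q(3) by auto
    have AB: "hd Q \<in> A" "last Q \<in> B" using a(1) b(1) Q(4,5) by simp_all
    have sub: "set Q \<subseteq> V - T - mid" using avoid_T_mid[OF Q(1-3) AB] Q(2) by blast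
    have cr: "cpath E (rev Q)" using Q(1) cpath_rev[OF symE, of Q] by simp
    have "set Q \<inter> A \<subseteq> {a}" using a(2)[OF Q(1) ne sub Q(4) AB(2)] .
    moreover have "set (rev Q) \<inter> B \<subseteq> {b}"
      using b(2)[OF cr] ne sub Q(5) AB(1) by (simp add: hd_rev last_rev)
    ultimately show ?thesis using sub by simp
  qed
  have abV: "a \<in> V" "b \<in> V" using a(1) b(1) A_iff B_iff cnD by blast+
  have odd: "odd (length Q)" if Q: "cpath E Q" "Q \<noteq> []" "set Q \<subseteq> V" "hd Q = a" "last Q = b" for Q
  proof (rule ccontr)
    assume "\<not> odd (length Q)"
    then have e: "even (length Q)" by simp
    have AB: "hd Q \<in> A" "last Q \<in> B" using a(1) b(1) Q(4,5) by simp_all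
    have "length Q \<noteq> 2"
    proof
      assume "length Q = 2"
      then obtain x y where "Q = [x, y]" by (auto simp: length_Suc_conv numeral_2_eq_2)
      then show False using Q(1) AB_nonadj[OF AB] by simp
    qed
    then have l4: "4 \<le> length Q" using e Q(2) by (cases Q; cases "tl Q"; cases "tl (tl Q)"; cases "tl (tl (tl Q))") auto
    show False using odd_path_meets_sides[OF Q(1,3) e AB] meet[OF Q(1,3) l4 Q(4,5)] Q(4,5) by blast
  qed
  have "\<not> (quasi_prism_lists s1 s2 s3 s4 \<and> set s1 \<union> set s2 \<union> set s3 \<union> set s4 \<subseteq> V \<and>
        hd s1 = a \<and> hd s2 = b \<and> (2 \<le> length s1 \<or> 2 \<le> length s2))" for s1 s2 s3 s4
  proof
    assume "quasi_prism_lists s1 s2 s3 s4 \<and> set s1 \<union> set s2 \<union> set s3 \<union> set s4 \<subseteq> V \<and>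
        hd s1 = a \<and> hd s2 = b \<and> (2 \<le> length s1 \<or> 2 \<le> length s2)"
    then have q: "quasi_prism_lists s1 s2 s3 s4" and V: "set s1 \<union> set s2 \<union> set s3 \<union> set s4 \<subseteq> V"
      and h: "hd s1 = a" "hd s2 = b" and l: "2 \<le> length s1 \<or> 2 \<le> length s2" by blast+
    have ne: "s1 \<noteq> []" "s2 \<noteq> []" "2 \<le> length s3" "2 \<le> length s4" by (fact quasi_prismD(5-8)[OF q])+
    have P: "set (s1 @ s @ rev s2) \<subseteq> V - T - mid \<and> set (s1 @ s @ rev s2) \<inter> A \<subseteq> {a} \<and> set (s1 @ s @ rev s2) \<inter> B \<subseteq> {b}"
      if s: "quasi_prism_lists s1 s2 s s'" "2 \<le> length s" "set s \<subseteq> V" for s s'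
    proof (rule meet[OF quasi_prism_path[OF s(1)]])
      show "set (s1 @ s @ rev s2) \<subseteq> V" using V s(3) by auto
      have "1 \<le> length s1" "1 \<le> length s2" using ne(1,2) by (cases s1; cases s2; auto)+
      then show "4 \<le> length (s1 @ s @ rev s2)" using s(2) by simp
      show "hd (s1 @ s @ rev s2) = a" "last (s1 @ s @ rev s2) = b" using ne h by (simp_all add: last_rev)
    qed
    have "set (s1 @ s3 @ rev s2) \<subseteq> V - T - mid \<and> set (s1 @ s3 @ rev s2) \<inter> A \<subseteq> {a} \<and> set (s1 @ s3 @ rev s2) \<inter> B \<subseteq> {b}"
      using P[OF q ne(3)] V by blast
    moreover have "set (s1 @ s4 @ rev s2) \<subseteq> V - T - mid \<and> set (s1 @ s4 @ rev s2) \<inter> A \<subseteq> {a} \<and> set (s1 @ s4 @ rev s2) \<inter> B \<subseteq> {b}"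
      using P[OF quasi_prism_swap[OF q] ne(4)] V by blast
    ultimately have U: "set s1 \<union> set s2 \<union> set s3 \<union> set s4 \<subseteq> V - T - mid"
      "(set s1 \<union> set s2 \<union> set s3 \<union> set s4) \<inter> A \<subseteq> {a}" "(set s1 \<union> set s2 \<union> set s3 \<union> set s4) \<inter> B \<subseteq> {b}" by auto
    from l show False
    proof
      assume "2 \<le> length s1"
      then show False using no_strict_quasi_prism[OF q] a(1) b(1) U h by blast
    next
      assume l2: "2 \<le> length s2"
      have eq: "set s2 \<union> set s1 \<union> set (rev s3) \<union> set (rev s4) = set s1 \<union> set s2 \<union> set s3 \<union> set s4" by auto
      show False
        by (rule r.no_strict_quasi_prism[OF quasi_prism_flip[OF q] l2])
          (unfold eq mid_rev rev_rev_ident, use a(1) b(1) U h in simp_all)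
    qed
  qed
  then have "special_in V a b" unfolding special_in_def using abV AB_ne[OF a(1) b(1)] odd by blast
  then show ?thesis using a(1) b(1) by blast
qed

end

section \<open>What the minimality of the outer path gives\<close>

context outer_config
begin

text \<open>A shortest outer path makes every further common neighbour of \<open>T\<close> attached to it
  complete to the two sides.\<close>

lemma mid_complete_side:
  assumes W: "cpath E W" "set W \<subseteq> V - T - cn" "W \<noteq> []"
    and short: "\<And>x y P. x \<in> cn \<Longrightarrow> y \<in> cn \<Longrightarrow> cpath E (x # P @ [y]) \<Longrightarrow> P \<noteq> [] \<Longrightarrow> set P \<subseteq> V - T - cn \<Longrightarrow> length W \<le> length P"
    and v: "v \<in> mid" "x \<in> A"
  shows "E v x"
proof (rule ccontr)
  assume n: "\<not> E v x"
  have vc: "v \<in> cn" "\<exists>w\<in>set W. E v w" "v \<notin> A" "v \<notin> B" using v(1) unfolding mid_def by auto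
  have xc: "x \<in> cn" "\<And>w. w \<in> set W \<Longrightarrow> E x w \<longleftrightarrow> w = hd W" using v(2) unfolding side_def by auto
  obtain us k vs where s: "W = us @ k # vs" "E v k" "\<forall>u\<in>set us. \<not> E v u" using split_list_first_prop[OF vc(2)] by blast
  have cW: "\<And>w. w \<in> set W \<Longrightarrow> w \<notin> cn" using W(2) by blast
  have "cpath E ([] @ (us @ [k]) @ vs)" using W(1) s by simp
  then have ck: "cpath E (us @ [k])" by (rule cpath_infix)
  have sub: "set (us @ [k]) \<subseteq> set W" unfolding s(1) by auto
  have hk: "hd (us @ [k]) = hd W" unfolding s(1) by (simp add: hd_append)
  have kn: "k \<notin> set us" using cpath_distinct[OF ck] by simp
  have cx: "cpath E (x # (us @ [k]))"
  proof (rule cpath_ConsI[OF ck])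
    fix w assume "w \<in> set (us @ [k])"
    then have "w \<in> set W" using sub by blast
    then show "x \<noteq> w \<and> (E x w \<longleftrightarrow> w = hd (us @ [k]))" unfolding hk using xc cW by blast
  qed
  have "cpath E ((x # (us @ [k])) @ [v])"
  proof (rule cpath_appendI[OF cx])
    fix u w assume u: "u \<in> set (x # (us @ [k]))" and w: "w \<in> set [v]"
    have l: "last (x # (us @ [k])) = k" by simp
    have "u = x \<or> u \<in> set us \<or> u = k" using u by auto
    then show "u \<noteq> w \<and> (E u w \<longleftrightarrow> u = last (x # (us @ [k])) \<and> w = hd [v])"
      unfolding l
    proof (elim disjE)
      assume "u = x"
      moreover have "x \<noteq> v" using vc(3) v(2) by blast
      moreover have "x \<noteq> k" using xc(1) cW sub by auto
      ultimately show "u \<noteq> w \<and> (E u w \<longleftrightarrow> u = k \<and> w = hd [v])" using w n adj_sym[of x v] by auto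
    next
      assume us: "u \<in> set us"
      then have "u \<noteq> v" "u \<noteq> k" "\<not> E u v" using s(3) kn adj_sym[of u v] cW[of u] vc(1) s(1) by auto
      then show "u \<noteq> w \<and> (E u w \<longleftrightarrow> u = k \<and> w = hd [v])" using w by auto
    next
      assume "u = k"
      moreover have "k \<noteq> v" using s(2) by auto
      ultimately show "u \<noteq> w \<and> (E u w \<longleftrightarrow> u = k \<and> w = hd [v])" using w adj_sym[OF s(2)] by auto
    qed
  qed simp
  then have "length W \<le> length (us @ [k])"
    using short[OF xc(1) vc(1), of "us @ [k]"] sub W(2) by auto
  then have "vs = []" unfolding s(1) by simp
  then have Wk: "W = us @ [k]" using s(1) by simp
  have "v \<in> B" unfolding side_def using vc(1) s(2,3) kn Wk by (auto simp: hd_rev)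
  then show False using vc(4) by blast
qed

end

section \<open>Reduction to an outer path and induction on the vertex set\<close>

context artemis_adj
begin

definition common :: "'a set \<Rightarrow> 'a set \<Rightarrow> 'a set" where
  "common V T = {v \<in> V - T. complete_to v T}"

lemma special_pair_outer:
  assumes V: "finite V" "T \<subseteq> V" "T \<noteq> {}" "conn (non_adj E) T"
    and cl: "\<And>u x y. u \<in> V - T - common V T \<Longrightarrow> x \<in> common V T \<Longrightarrow> y \<in> common V T \<Longrightarrow> E u x \<Longrightarrow> E u y \<Longrightarrow> x \<noteq> y \<Longrightarrow> E x y"
    and P: "x0 \<in> common V T" "y0 \<in> common V T" "cpath E (x0 # P @ [y0])" "P \<noteq> []" "set P \<subseteq> V - T - common V T"
  shows "\<exists>a\<in>common V T. \<exists>b\<in>common V T. special_in V a b"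
proof -
  let ?O = "\<lambda>P. P \<noteq> [] \<and> set P \<subseteq> V - T - common V T \<and> (\<exists>x\<in>common V T. \<exists>y\<in>common V T. cpath E (x # P @ [y]))"
  have "?O P" using P by blast
  then obtain W where W: "?O W" "\<And>P. ?O P \<Longrightarrow> length W \<le> length P"
    using ex_has_least_nat[of ?O P length] by blast
  then obtain x y where xy: "x \<in> common V T" "y \<in> common V T" "cpath E (x # W @ [y])" by blast
  interpret c: outer_config E V T W by unfold_locales (fact V)+
  interpret r: outer_config E V T "rev W" by unfold_locales (fact V)+
  have cn: "c.cn = common V T" unfolding c.cn_def common_def ..
  have Wn: "W \<noteq> []" "set W \<subseteq> V - T - c.cn" using W(1) cn by auto
  have cW: "cpath E W" using cpath_infix[of E "[x]" W "[y]"] xy(3) by simp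
  have ct: "complete_to x T" "complete_to y T" "x \<notin> T" "y \<notin> T" using xy unfolding common_def by auto
  have nWT: "\<forall>w\<in>set W. \<not> complete_to w T" using Wn unfolding c.cn_def by blast
  have rT: "rr T" using roussel_rubio[of T] V finite_subset by blast
  \<comment> \<open>\<open>W\<close> is the interior of a path with \<open>T\<close>-complete ends,
    and none of its own vertices is \<open>T\<close>-complete.\<close>
  have "W = [] \<or> odd (length W)"
    by (rule rr_segment[OF rT xy(3) _ ct(1,2) nWT]) (use ct Wn in auto)
  then have oW: "odd (length W)" using Wn by simp
  have xW: "\<And>w. w \<in> set W \<Longrightarrow> x \<noteq> w \<and> (E x w \<longleftrightarrow> w = hd W)" "x \<noteq> y" "\<not> E x y"
  proof -
    have c1: "cpath E ((x # W) @ [y])" using xy(3) by simp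
    then have "cpath E (x # W)" unfolding cpath_append by blast
    then show "\<And>w. w \<in> set W \<Longrightarrow> x \<noteq> w \<and> (E x w \<longleftrightarrow> w = hd W)" unfolding cpath.simps by blast
    have "x \<noteq> y \<and> (E x y \<longleftrightarrow> x = last (x # W) \<and> y = hd [y])" using c1 unfolding cpath_append by simp
    moreover have "x \<noteq> last W" using Wn(1) \<open>\<And>w. w \<in> set W \<Longrightarrow> x \<noteq> w \<and> (E x w \<longleftrightarrow> w = hd W)\<close>[of "last W"] by simp
    ultimately show "x \<noteq> y" "\<not> E x y" using Wn(1) by simp_all
  qed
  have yW: "\<And>w. w \<in> set W \<Longrightarrow> w \<noteq> y \<and> (E y w \<longleftrightarrow> w = last W)"
  proof -
    fix w assume w: "w \<in> set W"
    have "cpath E ([x] @ (W @ [y]))" using xy(3) by simp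
    then have "cpath E (W @ [y])" unfolding cpath_append[of E "[x]"] by blast
    then have "w \<noteq> y \<and> (E w y \<longleftrightarrow> w = last W \<and> y = hd [y])" unfolding cpath_append using w by simp
    then show "w \<noteq> y \<and> (E y w \<longleftrightarrow> w = last W)" using adj_comm[of y w] by simp
  qed
  \<comment> \<open>A single outside vertex would see the nonadjacent common neighbours
    \<open>x\<close> and \<open>y\<close>, against \<open>cl\<close>.\<close>
  have "length W \<noteq> 1"
  proof
    assume "length W = 1"
    then obtain w where "W = [w]" by (metis length_0_conv length_Suc_conv One_nat_def)
    then have "E w x" "E w y" "w \<in> V - T - common V T" using xW(1) yW Wn adj_sym cn by auto
    then show False using cl[of w x y] xy xW by blast
  qed
  then have lW: "3 \<le> length W" using oW Wn(1) by (cases W; cases "tl W"; cases "tl (tl W)") auto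
  have xA: "x \<in> c.A" unfolding c.side_def cn using xy xW(1) by blast
  have yB: "y \<in> c.B" unfolding c.side_def cn using xy yW Wn(1) by (simp add: hd_rev)
  have short: "length W \<le> length P" if "x \<in> c.cn" "y \<in> c.cn" "cpath E (x # P @ [y])" "P \<noteq> []" "set P \<subseteq> V - T - c.cn" for x y P
    using W(2)[of P] that unfolding cn by blast
  have rm: "r.mid = c.mid" unfolding r.mid_def c.mid_def by auto
  have mid: "E v z" if v: "v \<in> c.mid" and z: "z \<in> c.A \<union> c.B" for v z
    using z
  proof
    assume "z \<in> c.A"
    show ?thesis by (rule c.mid_complete_side[OF cW Wn(2,1) _ v \<open>z \<in> c.A\<close>]) (rule short)
  next
    assume z: "z \<in> c.B"
    have cr: "cpath E (rev W)" using cW cpath_rev[OF symE, of W] by simp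
    have sr: "set (rev W) \<subseteq> V - T - c.cn" "rev W \<noteq> []" using Wn by auto
    have vr: "v \<in> r.mid" using v rm by simp
    show ?thesis by (rule r.mid_complete_side[OF cr sr _ vr z], unfold length_rev) (rule short)
  qed
  interpret p: outer_path E V T W
  proof unfold_locales
    show "\<And>u x y. u \<in> V - T - c.cn \<Longrightarrow> x \<in> c.cn \<Longrightarrow> y \<in> c.cn \<Longrightarrow> E u x \<Longrightarrow> E u y \<Longrightarrow> x \<noteq> y \<Longrightarrow> E x y"
      unfolding cn by (rule cl)
    show "c.A \<noteq> {}" "c.B \<noteq> {}" using xA yB by blast+
    show "\<And>v x. v \<in> c.mid \<Longrightarrow> x \<in> c.A \<union> c.B \<Longrightarrow> E v x" by (rule mid)
  qed (fact cW oW lW Wn)+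
  show ?thesis using p.special_pair p.A_iff p.B_iff cn by blast
qed

text \<open>A chordless path between \<open>a\<close> and \<open>b\<close> through a vertex of
  \<open>T\<close> has three vertices. Any other path that leaves the common neighbourhood contains,
  around an outside vertex, a stretch of the kind excluded by \<open>no\<close>. The two paths
  covering a quasi-prism have at least four vertices, so it stays inside as well.\<close>

lemma special_lift:
  assumes no: "\<And>x y P. x \<in> common V T \<Longrightarrow> y \<in> common V T \<Longrightarrow> cpath E (x # P @ [y]) \<Longrightarrow> P \<noteq> [] \<Longrightarrow> \<not> set P \<subseteq> V - T - common V T"
    and ab: "a \<in> common V T" "b \<in> common V T" and sp: "special_in (common V T) a b"
  shows "special_in V a b"
proof -
  let ?C = "common V T"
  have inC: "length p = 3 \<or> set p \<subseteq> ?C" if p: "cpath E p" "p \<noteq> []" "set p \<subseteq> V" "hd p = a" "last p = b" for p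
  proof (cases "set p \<inter> T = {}")
    case False
    then obtain t where t: "t \<in> set p" "t \<in> T" by blast
    then have "E t a" "E t b" "t \<noteq> a" "t \<noteq> b" using ab adj_sym unfolding common_def complete_to_def by blast+
    then have "length p = 3 \<or> length p = 2" using cpath_common_neighbor[OF p(1) t(1)] p(4,5) by simp
    moreover have "length p \<noteq> 2"
    proof
      assume "length p = 2"
      then obtain x y where "p = [x, y]" by (auto simp: length_Suc_conv numeral_2_eq_2)
      then show False using t(1) \<open>t \<noteq> a\<close> \<open>t \<noteq> b\<close> p by auto
    qed
    ultimately show ?thesis by blast
  next
    case True
    have "set p \<subseteq> ?C"
    proof (rule ccontr)
      assume "\<not> set p \<subseteq> ?C"
      then obtain v where v: "v \<in> set p" "v \<notin> ?C" by blast
      then obtain xs zs where s: "p = xs @ v # zs" by (meson split_list)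
      have "xs \<noteq> []" "zs \<noteq> []" using s v p(4,5) ab by auto
      then have "hd xs = a" "last zs = b" "hd xs \<in> set xs" "last zs \<in> set zs" using s p(4,5) by auto
      then have ex: "\<exists>x\<in>set xs. x \<in> ?C" "\<exists>z\<in>set zs. z \<in> ?C" using ab by auto
      obtain xs1 u ys1 where 1: "xs = xs1 @ u # ys1" "u \<in> ?C" "\<forall>y\<in>set ys1. y \<notin> ?C"
        using split_list_last_prop[OF ex(1)] by blast
      obtain ys2 w zs2 where 2: "zs = ys2 @ w # zs2" "w \<in> ?C" "\<forall>y\<in>set ys2. y \<notin> ?C"
        using split_list_first_prop[OF ex(2)] by blast
      have "cpath E (xs1 @ (u # (ys1 @ v # ys2) @ [w]) @ zs2)" using p(1) s 1 2 by simp
      then have c: "cpath E (u # (ys1 @ v # ys2) @ [w])" by (rule cpath_infix)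
      have "set (ys1 @ v # ys2) \<subseteq> V - T - ?C" using p(3) True s 1 2 v by auto
      then show False using no[OF 1(2) 2(2) c] by simp
    qed
    then show ?thesis by blast
  qed
  show ?thesis
    unfolding special_in_def
  proof (intro conjI allI impI)
    show "a \<in> V" "b \<in> V" using ab unfolding common_def by auto
    show "a \<noteq> b" using sp unfolding special_in_def by blast
    show "odd (length p)" if "cpath E p \<and> p \<noteq> [] \<and> set p \<subseteq> V \<and> hd p = a \<and> last p = b" for p
    proof (cases "length p = 3")
      case True then show ?thesis by simp
    next
      case False
      then have "set p \<subseteq> ?C" using inC[of p] that by blast
      then show ?thesis using sp that unfolding special_in_def by blast
    qed
    show "\<not> (\<exists>s1 s2 s3 s4. quasi_prism_lists s1 s2 s3 s4 \<and> set s1 \<union> set s2 \<union> set s3 \<union> set s4 \<subseteq> V \<and>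
        hd s1 = a \<and> hd s2 = b \<and> (2 \<le> length s1 \<or> 2 \<le> length s2))"
    proof
    assume "\<exists>s1 s2 s3 s4. quasi_prism_lists s1 s2 s3 s4 \<and> set s1 \<union> set s2 \<union> set s3 \<union> set s4 \<subseteq> V \<and>
        hd s1 = a \<and> hd s2 = b \<and> (2 \<le> length s1 \<or> 2 \<le> length s2)"
    then obtain s1 s2 s3 s4 where q: "quasi_prism_lists s1 s2 s3 s4" and V: "set s1 \<union> set s2 \<union> set s3 \<union> set s4 \<subseteq> V"
      and h: "hd s1 = a" "hd s2 = b" "2 \<le> length s1 \<or> 2 \<le> length s2" by blast
    have ne: "s1 \<noteq> []" "s2 \<noteq> []" "2 \<le> length s3" "2 \<le> length s4" by (fact quasi_prismD(5-8)[OF q])+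
    have P: "set (s1 @ s @ rev s2) \<subseteq> ?C"
      if s: "quasi_prism_lists s1 s2 s s'" "2 \<le> length s" "set s \<subseteq> V" for s s'
    proof -
      have "1 \<le> length s1" "1 \<le> length s2" using ne(1,2) by (cases s1; cases s2; auto)+
      then have "length (s1 @ s @ rev s2) \<noteq> 3" using s(2) by simp
      moreover have "set (s1 @ s @ rev s2) \<subseteq> V" using V s(3) by auto
      moreover have "hd (s1 @ s @ rev s2) = a" "last (s1 @ s @ rev s2) = b" "s1 @ s @ rev s2 \<noteq> []" using ne h by (simp_all add: last_rev)
      ultimately show ?thesis using inC[OF quasi_prism_path[OF s(1)]] by blast
    qed
    have "set (s1 @ s3 @ rev s2) \<subseteq> ?C" using P[OF q ne(3)] V by blast
    moreover have "set (s1 @ s4 @ rev s2) \<subseteq> ?C" using P[OF quasi_prism_swap[OF q] ne(4)] V by blast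
    ultimately have "set s1 \<union> set s2 \<union> set s3 \<union> set s4 \<subseteq> ?C" by auto
    then show False using sp q h unfolding special_in_def by blast
    qed
  qed
qed

text \<open>The induction hypothesis is used for \<open>?C\<close> with a single vertex
  \<open>v\<close> that has nonadjacent neighbours in \<open>?C\<close>: a singleton is
  anticonnected, and \<open>?C\<close> is smaller than \<open>V\<close> because \<open>X\<close> is
  nonempty. Without such a \<open>v\<close>, adjacency or equality is transitive on
  \<open>?C\<close>.\<close>

theorem special_pair_exists:
  assumes "finite V" "T \<subseteq> V" "T \<noteq> {}" "conn (non_adj E) T"
    and "x \<in> common V T" "y \<in> common V T" "x \<noteq> y" "\<not> E x y"
  shows "\<exists>a\<in>common V T. \<exists>b\<in>common V T. special_in V a b"
  using assms
proof (induction "card V" arbitrary: V T x y rule: less_induct)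
  case less
  let ?P = "\<lambda>X. T \<subseteq> X \<and> X \<subseteq> V \<and> conn (non_adj E) X \<and> (\<exists>x\<in>common V X. \<exists>y\<in>common V X. x \<noteq> y \<and> \<not> E x y)"
  have "finite {X. ?P X}" using less.prems(1) by (auto intro: finite_subset[of _ "Pow V"])
  moreover have "T \<in> {X. ?P X}" using less.prems by blast
  ultimately have "\<exists>X\<in>{X. ?P X}. \<forall>Z\<in>{X. ?P X}. X \<subseteq> Z \<longrightarrow> X = Z"
    by (intro finite_has_maximal) auto
  then obtain X where X0: "X \<in> {X. ?P X}" "\<forall>Z\<in>{X. ?P X}. X \<subseteq> Z \<longrightarrow> X = Z" ..
  have X: "T \<subseteq> X" "X \<subseteq> V" "conn (non_adj E) X" "\<exists>x\<in>common V X. \<exists>y\<in>common V X. x \<noteq> y \<and> \<not> E x y" using X0(1) by auto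
  have Xne: "X \<noteq> {}" using X(1) less.prems(3) by blast
  have max: "X = Z" if "T \<subseteq> Z" "Z \<subseteq> V" "conn (non_adj E) Z" "\<exists>x\<in>common V Z. \<exists>y\<in>common V Z. x \<noteq> y \<and> \<not> E x y" "X \<subseteq> Z" for Z
    using X0(2) that by simp
  let ?C = "common V X"
  have sub: "?C \<subseteq> common V T" using X(1) complete_to_mono unfolding common_def by blast
  \<comment> \<open>An outside vertex seeing nonadjacent \<open>x\<close> and \<open>y\<close> could
    be added to \<open>X\<close>: it misses a vertex of \<open>X\<close>, so anticonnectedness
    survives.\<close>
  have cl: "E x y" if u: "u \<in> V - X - ?C" and xy: "x \<in> ?C" "y \<in> ?C" "E u x" "E u y" "x \<noteq> y" for u x y
  proof (rule ccontr)
    assume n: "\<not> E x y"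
    have "\<not> complete_to u X" using u unfolding common_def by blast
    then obtain t where t: "t \<in> X" "\<not> E u t" unfolding complete_to_def by blast
    then have "u \<noteq> t" using u by blast
    then have "conn (non_adj E) (insert u X)"
      using conn_insert[OF X(3) t(1), of u] t(2) adj_sym by blast
    moreover have "x \<in> common V (insert u X)" "y \<in> common V (insert u X)"
      using xy adj_sym u unfolding common_def complete_to_def by auto
    ultimately have "X = insert u X" using max[of "insert u X"] X(1,2) u xy(5) n by blast
    then show False using u by blast
  qed
  have "\<exists>a\<in>?C. \<exists>b\<in>?C. special_in V a b"
  proof (cases "\<exists>x\<in>?C. \<exists>y\<in>?C. \<exists>P. cpath E (x # P @ [y]) \<and> P \<noteq> [] \<and> set P \<subseteq> V - X - ?C")
    case True
    then obtain x y P where P: "x \<in> ?C" "y \<in> ?C" "cpath E (x # P @ [y])" "P \<noteq> []" "set P \<subseteq> V - X - ?C" by blast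
    show ?thesis by (rule special_pair_outer[OF less.prems(1) X(2) Xne X(3) _ P]) (rule cl)
  next
    case False
    have lift: "special_in V a b" if "a \<in> ?C" "b \<in> ?C" "special_in ?C a b" for a b
      using special_lift[OF _ that] False by blast
    have fC: "finite ?C" "card ?C < card V"
    proof -
      have ps: "?C \<subset> V" using X(2) Xne unfolding common_def by blast
      show "card ?C < card V" by (rule psubset_card_mono[OF less.prems(1) ps])
      show "finite ?C" by (rule finite_subset[OF psubset_imp_subset[OF ps] less.prems(1)])
    qed
    show ?thesis
    proof (cases "\<exists>v\<in>?C. \<exists>y\<in>?C. \<exists>z\<in>?C. E v y \<and> E v z \<and> y \<noteq> z \<and> \<not> E y z")
      case True
      then obtain v y z where v: "v \<in> ?C" "y \<in> ?C" "z \<in> ?C" "E v y" "E v z" "y \<noteq> z" "\<not> E y z" by blast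
      have yz: "y \<in> common ?C {v}" "z \<in> common ?C {v}"
        using v adj_sym unfolding common_def[of ?C] complete_to_def by auto
      have "{v} \<subseteq> ?C" "{v} \<noteq> {}" using v(1) by auto
      from less.hyps[OF fC(2,1) this conn_single yz v(6,7)]
      obtain a b where ab: "a \<in> common ?C {v}" "b \<in> common ?C {v}" "special_in ?C a b" by blast
      have "common ?C {v} \<subseteq> ?C" unfolding common_def[of ?C] by blast
      then show ?thesis using lift[OF _ _ ab(3)] ab(1,2) by blast
    next
      case nP3: False
      obtain x y where xy: "x \<in> ?C" "y \<in> ?C" "x \<noteq> y" "\<not> E x y" using X(4) by blast
      \<comment> \<open>A path between \<open>x\<close> and \<open>y\<close> would begin with three
        vertices whose middle one has nonadjacent neighbours. So there is none, and the pair is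
        special vacuously.\<close>
      have nop: False if p: "cpath E p" "p \<noteq> []" "set p \<subseteq> ?C" "hd p = x" "last p = y" for p
      proof -
        obtain r where r: "p = x # r" using p(2,4) by (cases p) auto
        have "r \<noteq> []" using r p(5) xy(3) by auto
        then obtain u r' where r': "r = u # r'" by (cases r) auto
        have xu: "E x u" using p(1) r r' by simp
        then have "r' \<noteq> []" using p(5) r r' xy(4) by auto
        then obtain w r'' where w: "r' = w # r''" by (cases r') auto
        have c: "cpath E (x # u # w # r'')" using p(1) r r' w by simp
        then have "E u w" "x \<noteq> w" "\<not> E x w" by auto
        moreover have "x \<in> ?C" "u \<in> ?C" "w \<in> ?C" using p(3) r r' w by auto
        ultimately show False using nP3 xu adj_sym by blast
      qed
      have "special_in ?C x y"
        unfolding special_in_def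
      proof (intro conjI allI impI)
        show "x \<in> ?C" "y \<in> ?C" "x \<noteq> y" using xy by auto
        show "\<And>p. cpath E p \<and> p \<noteq> [] \<and> set p \<subseteq> ?C \<and> hd p = x \<and> last p = y \<Longrightarrow> odd (length p)" using nop by blast
        show "\<not> (\<exists>s1 s2 s3 s4. quasi_prism_lists s1 s2 s3 s4 \<and> set s1 \<union> set s2 \<union> set s3 \<union> set s4 \<subseteq> ?C \<and>
          hd s1 = x \<and> hd s2 = y \<and> (2 \<le> length s1 \<or> 2 \<le> length s2))"
        proof
          assume "\<exists>s1 s2 s3 s4. quasi_prism_lists s1 s2 s3 s4 \<and> set s1 \<union> set s2 \<union> set s3 \<union> set s4 \<subseteq> ?C \<and>
            hd s1 = x \<and> hd s2 = y \<and> (2 \<le> length s1 \<or> 2 \<le> length s2)"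
          then obtain s1 s2 s3 s4 where q: "quasi_prism_lists s1 s2 s3 s4" and V: "set s1 \<union> set s2 \<union> set s3 \<union> set s4 \<subseteq> ?C"
            and h: "hd s1 = x" "hd s2 = y" by blast
          have ne: "s1 \<noteq> []" "s2 \<noteq> []" by (fact quasi_prismD(5,6)[OF q])+
          show False
            by (rule nop[OF quasi_prism_path[OF q]]) (use ne h V in \<open>auto simp: last_rev\<close>)
        qed
      qed
      then show ?thesis using lift[OF xy(1,2)] xy by blast
    qed
  qed
  then show ?case using sub by blast
qed

end

section \<open>From vertex lists to graphs\<close>

lemma cpath_edges:
  assumes "symp F" "irreflp F" "cpath F p"
  shows "{{u, v} | u v. u \<in> set p \<and> v \<in> set p \<and> F u v} = {{p ! i, p ! Suc i} | i. Suc i < length p}"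
proof (intro equalityI subsetI)
  fix e assume "e \<in> {{u, v} | u v. u \<in> set p \<and> v \<in> set p \<and> F u v}"
  then obtain i j where ij: "e = {p ! i, p ! j}" "i < length p" "j < length p" "F (p ! i) (p ! j)"
    by (auto simp: in_set_conv_nth)
  have "i \<noteq> j" using ij(4) irreflpD[OF assms(2)] by auto
  then have "j = Suc i \<or> i = Suc j"
    using cpath_nth[OF assms(3), of i j] cpath_nth[OF assms(3), of j i] ij sympD[OF assms(1) ij(4)]
    by (cases "i < j") auto
  then show "e \<in> {{p ! i, p ! Suc i} | i. Suc i < length p}" using ij by auto
next
  fix e assume "e \<in> {{p ! i, p ! Suc i} | i. Suc i < length p}"
  then obtain i where "e = {p ! i, p ! Suc i}" "Suc i < length p" by blast
  moreover then have "F (p ! i) (p ! Suc i)" using cpath_nth[OF assms(3), of i "Suc i"] by simp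
  ultimately show "e \<in> {{u, v} | u v. u \<in> set p \<and> v \<in> set p \<and> F u v}"
    by (metis (mono_tags, lifting) Suc_lessD mem_Collect_eq nth_mem)
qed

lemma chole_nth:
  assumes "chole F p" "i < j" "j < length p"
  shows "F (p ! i) (p ! j) \<longleftrightarrow> j = Suc i \<or> (i = 0 \<and> Suc j = length p)"
proof -
  obtain x q where p: "p = x # q" using assms(1) by (cases p) auto
  have q: "cpath F q" "3 \<le> length q" "\<And>v. v \<in> set q \<Longrightarrow> F x v \<longleftrightarrow> v = hd q \<or> v = last q"
    using assms(1) p by auto
  obtain j' where j: "j = Suc j'" "j' < length q" using assms p by (cases j) auto
  have d: "distinct q" by (rule cpath_distinct[OF q(1)])
  show ?thesis
  proof (cases i)
    case 0
    have "q \<noteq> []" using q(2) by auto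
    then have "hd q = q ! 0" "last q = q ! (length q - 1)" by (simp_all add: hd_conv_nth last_conv_nth)
    moreover have "q ! j' = q ! 0 \<longleftrightarrow> j' = 0" "q ! j' = q ! (length q - 1) \<longleftrightarrow> j' = length q - 1"
    proof -
      have "0 < length q" "length q - 1 < length q" using q(2) by linarith+
      then show "q ! j' = q ! 0 \<longleftrightarrow> j' = 0" "q ! j' = q ! (length q - 1) \<longleftrightarrow> j' = length q - 1"
        using nth_eq_iff_index_eq[OF d j(2)] by simp_all
    qed
    ultimately have "F x (q ! j') \<longleftrightarrow> j' = 0 \<or> j' = length q - 1" using q(3)[of "q ! j'"] j(2) by simp
    then show ?thesis using 0 j p q(2) by auto
  next
    case (Suc i')
    then show ?thesis using cpath_nth[OF q(1), of i' j'] assms(2) j p by auto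
  qed
qed

lemma chole_edges:
  assumes "symp F" "irreflp F" "chole F p"
  shows "{{u, v} | u v. u \<in> set p \<and> v \<in> set p \<and> F u v} = {{p ! i, p ! (Suc i mod length p)} | i. i < length p}"
proof (intro equalityI subsetI)
  fix e assume "e \<in> {{u, v} | u v. u \<in> set p \<and> v \<in> set p \<and> F u v}"
  then obtain i0 j0 where ij0: "e = {p ! i0, p ! j0}" "i0 < length p" "j0 < length p" "F (p ! i0) (p ! j0)"
    by (auto simp: in_set_conv_nth)
  have "i0 \<noteq> j0" using ij0(4) irreflpD[OF assms(2)] by auto
  then obtain i j where ij: "e = {p ! i, p ! j}" "i < j" "j < length p" "F (p ! i) (p ! j)"
    using ij0 sympD[OF assms(1) ij0(4)] by (metis insert_commute linorder_neqE_nat)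
  from chole_nth[OF assms(3) ij(2,3)] ij(4) have "j = Suc i \<or> (i = 0 \<and> Suc j = length p)" by blast
  then show "e \<in> {{p ! i, p ! (Suc i mod length p)} | i. i < length p}"
  proof
    assume "j = Suc i"
    then have "Suc i mod length p = j" "i < length p" using ij(3) by auto
    then show ?thesis using ij(1) by blast
  next
    assume "i = 0 \<and> Suc j = length p"
    then have "e = {p ! j, p ! (Suc j mod length p)}" using ij(1) by auto
    then show ?thesis using ij(3) by blast
  qed
next
  fix e assume "e \<in> {{p ! i, p ! (Suc i mod length p)} | i. i < length p}"
  then obtain i where i: "e = {p ! i, p ! (Suc i mod length p)}" "i < length p" by blast
  have l4: "4 \<le> length p" using assms(3) by (cases p) auto
  have "F (p ! i) (p ! (Suc i mod length p))"
  proof (cases "Suc i = length p")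
    case True
    then have "F (p ! 0) (p ! i)" using chole_nth[OF assms(3), of 0 i] i l4 by auto
    then show ?thesis using True sympD[OF assms(1)] by auto
  next
    case False
    then have "Suc i < length p" using i by simp
    then show ?thesis using chole_nth[OF assms(3), of i "Suc i"] by simp
  qed
  moreover have "0 < length p" using l4 by linarith
  then have "p ! (Suc i mod length p) \<in> set p" by (intro nth_mem mod_less_divisor)
  ultimately show "e \<in> {{u, v} | u v. u \<in> set p \<and> v \<in> set p \<and> F u v}" using i nth_mem[OF i(2)] by blast
qed

text \<open>Needed because \<open>odd_hole\<close> counts edges and \<open>hole_even\<close> counts
  vertices. Two indices giving the same edge would be cyclic successors of each other, impossible
  from three vertices on.\<close>

lemma card_cycle_edges:
  assumes "distinct p" "3 \<le> length p"
  shows "card {{p ! i, p ! (Suc i mod length p)} | i. i < length p} = length p"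
proof -
  let ?n = "length p"
  let ?f = "\<lambda>i. {p ! i, p ! (Suc i mod ?n)}"
  have "inj_on ?f {..<?n}"
  proof (rule inj_onI, rule ccontr)
    fix i j assume ij: "i \<in> {..<?n}" "j \<in> {..<?n}" "?f i = ?f j" "i \<noteq> j"
    have m: "Suc i mod ?n < ?n" "Suc j mod ?n < ?n" using assms(2) by (intro mod_less_divisor, linarith)+
    have "p ! i \<noteq> p ! j" using nth_eq_iff_index_eq[OF assms(1)] ij by simp
    then have "p ! i = p ! (Suc j mod ?n)" "p ! j = p ! (Suc i mod ?n)" using ij(3) by (auto simp: doubleton_eq_iff)
    then have e: "i = Suc j mod ?n" "j = Suc i mod ?n" using nth_eq_iff_index_eq[OF assms(1)] ij m by auto
    have w: "Suc k mod ?n = (if Suc k = ?n then 0 else Suc k)" if "k < ?n" for k using that by auto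
    have l: "i < ?n" "j < ?n" using ij(1,2) by simp_all
    have ieq: "i = (if Suc j = ?n then 0 else Suc j)" by (rule trans[OF e(1) w[OF l(2)]])
    have jeq: "j = (if Suc i = ?n then 0 else Suc i)" by (rule trans[OF e(2) w[OF l(1)]])
    show False
    proof (cases "Suc i = ?n")
      case True
      have j: "j = 0" by (rule trans[OF jeq if_P[OF True]])
      have "Suc j \<noteq> ?n" using j assms(2) by linarith
      then have "i = Suc j" by (intro trans[OF ieq] if_not_P)
      then show False using True j assms(2) by linarith
    next
      case nt: False
      have j: "j = Suc i" by (rule trans[OF jeq if_not_P[OF nt]])
      show False
      proof (cases "Suc j = ?n")
        case True
        have "i = 0" by (rule trans[OF ieq if_P[OF True]])
        then show False using True j assms(2) by linarith
      next
        case False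
        have "i = Suc j" by (rule trans[OF ieq if_not_P[OF False]])
        then show False using j by linarith
      qed
    qed
  qed
  then have "card (?f ` {..<?n}) = ?n" by (simp add: card_image)
  moreover have "?f ` {..<?n} = {?f i | i. i < ?n}" by auto
  ultimately show ?thesis by simp
qed

text \<open>Serves to place a hole inside the graph: lists range over the whole type, but adjacency
  holds only between vertices of the graph.\<close>

lemma chole_neighbor:
  assumes "symp F" "chole F p" "v \<in> set p"
  obtains w where "w \<in> set p" "F v w"
proof -
  obtain xs ys where p: "p = xs @ v # ys" using assms(3) by (meson split_list)
  then have "chole F ((v # ys) @ xs)" using chole_rotate[OF assms(1)] assms(2) by blast
  then have h: "3 \<le> length (ys @ xs)" "\<forall>w\<in>set (ys @ xs). F v w \<longleftrightarrow> w = hd (ys @ xs) \<or> w = last (ys @ xs)" by auto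
  then have "hd (ys @ xs) \<in> set (ys @ xs)" by (intro hd_in_set) auto
  then show ?thesis using h(2) p that[of "hd (ys @ xs)"] by auto
qed

lemma contains_induced: "S \<subseteq> verts G \<Longrightarrow> contains G (induced G S)"
  unfolding contains_def isomorphic_def by (intro exI[of _ S] conjI exI[of _ id]) auto

lemma is_path_cpath:
  assumes "is_path G p"
  shows "cpath (\<lambda>u v. {u, v} \<in> edges G) p" "p \<noteq> []" "set p \<subseteq> verts G"
proof -
  have p: "set p \<subseteq> verts G" "p \<noteq> []" "distinct p"
    "{e \<in> edges G. e \<subseteq> set p} = {{p ! i, p ! Suc i} | i. Suc i < length p}"
    using assms unfolding is_path_def path_graph_def induced_def by auto
  show "p \<noteq> []" "set p \<subseteq> verts G" by (fact p)+
  show "cpath (\<lambda>u v. {u, v} \<in> edges G) p"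
  proof (rule cpathI_nth[OF p(3)])
    fix i j assume ij: "i < j" "j < length p"
    have "{p ! i, p ! j} \<in> edges G \<longleftrightarrow> {p ! i, p ! j} \<in> {e \<in> edges G. e \<subseteq> set p}" using ij by simp
    also have "\<dots> \<longleftrightarrow> (\<exists>k. {p ! i, p ! j} = {p ! k, p ! Suc k} \<and> Suc k < length p)" unfolding p(4) by blast
    also have "\<dots> \<longleftrightarrow> j = Suc i"
    proof
      assume "\<exists>k. {p ! i, p ! j} = {p ! k, p ! Suc k} \<and> Suc k < length p"
      then obtain k where k: "{p ! i, p ! j} = {p ! k, p ! Suc k}" "Suc k < length p" by blast
      then have "(p ! i = p ! k \<and> p ! j = p ! Suc k) \<or> (p ! i = p ! Suc k \<and> p ! j = p ! k)" by (auto simp: doubleton_eq_iff)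
      then have "(i = k \<and> j = Suc k) \<or> (i = Suc k \<and> j = k)" using nth_eq_iff_index_eq[OF p(3)] ij k(2) by auto
      then show "j = Suc i" using ij(1) by auto
    next
      assume "j = Suc i"
      then show "\<exists>k. {p ! i, p ! j} = {p ! k, p ! Suc k} \<and> Suc k < length p" using ij by blast
    qed
    finally show "{p ! i, p ! j} \<in> edges G \<longleftrightarrow> j = Suc i" .
  qed
qed

section \<open>Translation between a simple graph and its adjacency relation\<close>

context
  fixes G :: "'a ugraph"
  assumes simple: "simple_graph G"
begin

abbreviation adj :: "'a \<Rightarrow> 'a \<Rightarrow> bool" where "adj \<equiv> \<lambda>u v. {u, v} \<in> edges G"

lemma edges_simple: "e \<in> edges G \<Longrightarrow> e \<subseteq> verts G \<and> card e = 2"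
  using simple unfolding simple_graph_def by blast

lemma symp_adj: "symp adj"
  by (rule sympI) (simp add: insert_commute)

lemma irreflp_adj: "irreflp adj"
proof (rule irreflpI)
  fix x show "\<not> {x, x} \<in> edges G" using edges_simple[of "{x, x}"] by auto
qed

lemma induced_edges: "edges (induced G S) = {{u, v} | u v. u \<in> S \<and> v \<in> S \<and> adj u v}"
proof (intro equalityI subsetI)
  fix e assume "e \<in> edges (induced G S)"
  then have e: "e \<in> edges G" "e \<subseteq> S" unfolding induced_def by auto
  then obtain u v where "e = {u, v}" using edges_simple by (meson card_2_iff)
  then show "e \<in> {{u, v} | u v. u \<in> S \<and> v \<in> S \<and> adj u v}" using e by auto
qed (auto simp: induced_def)

lemma cpath_is_path:
  assumes "cpath adj p" "p \<noteq> []" "set p \<subseteq> S" "S \<subseteq> verts G"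
  shows "is_path (induced G S) p"
proof -
  have "edges (induced (induced G S) (set p)) = edges (induced G (set p))"
    using assms(3) unfolding induced_def by auto
  also have "\<dots> = {{p ! i, p ! Suc i} | i. Suc i < length p}"
    unfolding induced_edges by (rule cpath_edges[OF symp_adj irreflp_adj assms(1)])
  finally show ?thesis
    using assms cpath_distinct[OF assms(1)] unfolding is_path_def path_graph_def by (auto simp: induced_def)
qed

text \<open>A walk in the complement from inside \<open>Y\<close> to outside must use an edge across
  the cut.\<close>

lemma anticonnected_conn:
  assumes "anticonnected (induced G T)"
  shows "conn (non_adj adj) T"
  unfolding conn_def
proof (intro allI impI)
  fix Y assume Y: "Y \<subseteq> T" "Y \<noteq> {} \<and> Y \<noteq> T"
  let ?r = "\<lambda>x y. {x, y} \<in> edges (complement (induced G T))"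
  obtain y z where yz: "y \<in> Y" "z \<in> T - Y" using Y by blast
  then have "?r\<^sup>*\<^sup>* y z"
    using assms Y unfolding anticonnected_def connected_graph_def complement_def induced_def by auto
  then have "z \<notin> Y \<longrightarrow> (\<exists>u\<in>Y. \<exists>w. w \<notin> Y \<and> ?r u w)"
    using yz(1) by (induction rule: rtranclp_induct) blast+
  then obtain u w where uw: "u \<in> Y" "w \<notin> Y" "?r u w" using yz(2) by blast
  then have "{u, w} \<subseteq> T" "{u, w} \<notin> edges G" "u \<noteq> w" unfolding complement_def induced_def by auto
  then show "\<exists>y\<in>Y. \<exists>z\<in>T - Y. non_adj adj y z" using uw by blast
qed

context
  assumes art: "artemis G"
begin

lemma no_contained: "S \<subseteq> verts G \<Longrightarrow> H = induced G S \<Longrightarrow> \<not> odd_hole H \<and> \<not> long_antihole H \<and> \<not> prism H"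
  using art contains_induced unfolding artemis_def by blast

lemma adj_verts: "adj u v \<Longrightarrow> u \<in> verts G \<and> v \<in> verts G"
  using edges_simple[of "{u, v}"] by auto

lemma chole_even_adj:
  assumes "chole adj p" shows "even (length p)"
proof (rule ccontr)
  assume o: "odd (length p)"
  have l: "4 \<le> length p" using assms by (cases p) auto
  have V: "set p \<subseteq> verts G"
  proof
    fix v assume "v \<in> set p"
    then obtain w where "adj v w" using chole_neighbor[OF symp_adj assms] by blast
    then show "v \<in> verts G" using adj_verts by blast
  qed
  have d: "distinct p" by (rule chole_distinct[OF assms])
  have e: "edges (induced G (set p)) = {{p ! i, p ! (Suc i mod length p)} | i. i < length p}"
    unfolding induced_edges by (rule chole_edges[OF symp_adj irreflp_adj assms])
  then have "cycle_graph p (induced G (set p))"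
    unfolding cycle_graph_def using l d by (auto simp: induced_def)
  moreover have "card (verts (induced G (set p))) \<ge> 4" using l d by (simp add: induced_def distinct_card)
  moreover have "odd (card (edges (induced G (set p))))" unfolding e using card_cycle_edges[OF d] l o by simp
  ultimately have "odd_hole (induced G (set p))" unfolding odd_hole_def hole_def by blast
  then show False using no_contained[OF V refl] by blast
qed

lemma antihole_short:
  assumes p: "chole (non_adj adj) p" shows "length p < 5"
proof (rule ccontr)
  assume "\<not> ?thesis"
  then have l: "5 \<le> length p" by simp
  have s: "symp (non_adj adj)" by (rule sympI) (auto simp: insert_commute)
  have ir: "irreflp (non_adj adj)" by (rule irreflpI) auto
  have d: "distinct p" by (rule chole_distinct[OF p])
  \<comment> \<open>A vertex outside \<open>G\<close> is nonadjacent to everything, so an actual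
    edge has to be exhibited: \<open>v\<close> sees the vertex two places further on, which is
    neither of its two neighbours in the antihole.\<close>
  have V: "set p \<subseteq> verts G"
  proof
    fix v assume v: "v \<in> set p"
    obtain xs ys where "p = xs @ v # ys" using v by (meson split_list)
    then have "chole (non_adj adj) (xs @ (v # ys))" "length ((v # ys) @ xs) = length p" using p by simp_all
    then have c: "chole (non_adj adj) ((v # ys) @ xs)" "length ((v # ys) @ xs) = length p"
      by (blast intro: chole_rotate[OF s])+
    then obtain a b c' r where r: "ys @ xs = a # b # c' # r"
      using l by (cases "ys @ xs"; cases "tl (ys @ xs)"; cases "tl (tl (ys @ xs))") auto
    have c: "chole (non_adj adj) (v # a # b # c' # r)" using c(1) r by (simp only: append_Cons)
    then have "distinct (v # a # b # c' # r)" by (rule chole_distinct)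
    then have n: "b \<noteq> a" "b \<noteq> last (a # b # c' # r)" "v \<noteq> b" by auto
    have "\<forall>w\<in>set (a # b # c' # r). v \<noteq> w \<and> (non_adj adj v w \<longleftrightarrow> w = hd (a # b # c' # r) \<or> w = last (a # b # c' # r))"
      using c unfolding chole.simps(2) by blast
    from this[THEN bspec, of b]
    have "non_adj adj v b \<longleftrightarrow> b = hd (a # b # c' # r) \<or> b = last (a # b # c' # r)" by auto
    then have "adj v b" using n by simp
    then show "v \<in> verts G" using adj_verts by blast
  qed
  define H where "H = induced G (set p)"
  define K where "K = complement H"
  have vH: "verts H = set p" "verts K = set p" unfolding H_def K_def induced_def complement_def by auto
  have eH: "edges H \<subseteq> {e. e \<subseteq> set p \<and> card e = 2}" unfolding H_def induced_def using edges_simple by auto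
  have "edges K = {{u, v} | u v. u \<in> set p \<and> v \<in> set p \<and> non_adj adj u v}"
  proof (intro equalityI subsetI)
    fix e assume "e \<in> edges K"
    then have e: "e \<subseteq> set p" "card e = 2" "e \<notin> edges H" unfolding K_def complement_def using vH by auto
    then obtain u v where "e = {u, v}" "u \<noteq> v" by (meson card_2_iff)
    then show "e \<in> {{u, v} | u v. u \<in> set p \<and> v \<in> set p \<and> non_adj adj u v}"
      using e unfolding H_def induced_def by auto
  next
    fix e assume "e \<in> {{u, v} | u v. u \<in> set p \<and> v \<in> set p \<and> non_adj adj u v}"
    then show "e \<in> edges K" unfolding K_def H_def complement_def induced_def by auto
  qed
  then have "edges K = {{p ! i, p ! (Suc i mod length p)} | i. i < length p}"
    using chole_edges[OF s ir p] by simp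
  then have "cycle_graph p K" unfolding cycle_graph_def using l d vH by simp
  moreover have "card (verts K) = length p" using d vH by (simp add: distinct_card)
  ultimately have "hole K" unfolding hole_def using l by auto
  moreover have "H = complement K"
  proof (rule ugraph.equality)
    show "verts H = verts (complement K)" using vH by (simp add: complement_def)
    show "edges H = edges (complement K)" using eH vH by (auto simp: K_def complement_def)
  qed simp
  ultimately have "antihole H" unfolding antihole_def by blast
  then have "long_antihole H" unfolding long_antihole_def using l d vH by (simp add: distinct_card)
  then show False using no_contained[OF V H_def] by blast
qed

lemma prism_free:
  "\<not> prism_lists adj p q r"
proof
  assume "prism_lists adj p q r"
  then have c: "cpath adj p" "cpath adj q" "cpath adj r" and l: "2 \<le> length p" "2 \<le> length q" "2 \<le> length r"
    and x: "cross adj p q" "cross adj p r" "cross adj q r" unfolding prism_lists_def by blast+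
  let ?S = "set p \<union> set q \<union> set r"
  have ne: "p \<noteq> []" "q \<noteq> []" "r \<noteq> []" using l by auto
  \<comment> \<open>On a path with at least two vertices every vertex has a neighbour and therefore
    belongs to \<open>G\<close>.\<close>
  have V1: "set s \<subseteq> verts G" if s: "cpath adj s" "2 \<le> length s" for s
  proof
    fix v assume "v \<in> set s"
    then obtain i where i: "i < length s" "v = s ! i" by (auto simp: in_set_conv_nth)
    show "v \<in> verts G"
    proof (cases "Suc i < length s")
      case True
      then show ?thesis using cpath_nth[OF s(1), of i "Suc i"] adj_verts i by auto
    next
      case False
      then obtain j where "i = Suc j" using i s(2) by (cases i) auto
      then show ?thesis using cpath_nth[OF s(1), of j i] adj_verts i by auto
    qed
  qed
  have V: "?S \<subseteq> verts G" using V1 c l by blast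
  define H where "H = induced G ?S"
  have sub: "edges (induced H X) = edges (induced G X)" if "X \<subseteq> ?S" for X
    using that unfolding H_def induced_def by auto
  have X: "\<And>s t u v. cross adj s t \<Longrightarrow> u \<in> set s \<Longrightarrow> v \<in> set t \<Longrightarrow> u \<noteq> v \<and> (adj u v \<longleftrightarrow> u = hd s \<and> v = hd t \<or> u = last s \<and> v = last t)"
    unfolding cross_def by (drule (1) bspec, drule (1) bspec)
  let ?R = "edges (induced G (set p)) \<union> edges (induced G (set q)) \<union> edges (induced G (set r)) \<union>
       {{hd p, hd q}, {hd p, hd r}, {hd q, hd r}} \<union> {{last p, last q}, {last p, last r}, {last q, last r}}"
  have eH: "edges H = ?R"
  proof (intro equalityI subsetI)
    fix e assume "e \<in> edges H"
    then obtain u v where e: "e = {u, v}" "u \<in> ?S" "v \<in> ?S" "adj u v" unfolding H_def induced_edges by blast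
    have vu: "adj v u" using sympD[OF symp_adj e(4)] .
    have in1: "{u, v} \<in> edges (induced G (set s))" if "u \<in> set s" "v \<in> set s" for s
      unfolding induced_edges using that e(4) by blast
    have in2: "{u, v} = {hd s, hd t} \<or> {u, v} = {last s, last t}"
      if "cross adj s t" "u \<in> set s \<and> v \<in> set t \<or> v \<in> set s \<and> u \<in> set t" for s t
      using X[OF that(1)] that(2) e(4) vu by blast
    consider "u \<in> set p" "v \<in> set p" | "u \<in> set q" "v \<in> set q" | "u \<in> set r" "v \<in> set r"
      | "u \<in> set p \<and> v \<in> set q \<or> v \<in> set p \<and> u \<in> set q" | "u \<in> set p \<and> v \<in> set r \<or> v \<in> set p \<and> u \<in> set r"
      | "u \<in> set q \<and> v \<in> set r \<or> v \<in> set q \<and> u \<in> set r" using e(2,3) by blast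
    then show "e \<in> ?R"
    proof cases
      case 4
      from in2[OF x(1) this] show ?thesis unfolding e(1) by (elim disjE) simp_all
    next
      case 5
      from in2[OF x(2) this] show ?thesis unfolding e(1) by (elim disjE) simp_all
    next
      case 6
      from in2[OF x(3) this] show ?thesis unfolding e(1) by (elim disjE) simp_all
    next
      case 1 then show ?thesis using in1[of p] e(1) by simp
    next
      case 2 then show ?thesis using in1[of q] e(1) by simp
    next
      case 3 then show ?thesis using in1[of r] e(1) by simp
    qed
  next
    have hl: "hd p \<in> set p" "hd q \<in> set q" "hd r \<in> set r" "last p \<in> set p" "last q \<in> set q" "last r \<in> set r" using ne by auto
    have cr: "adj (hd s) (hd t)" "adj (last s) (last t)" if "cross adj s t" "s \<noteq> []" "t \<noteq> []" for s t
      using X[OF that(1), of "hd s" "hd t"] X[OF that(1), of "last s" "last t"] that(2,3) by simp_all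
    fix e assume "e \<in> ?R"
    then show "e \<in> edges H"
      unfolding H_def induced_edges using cr[OF x(1) ne(1,2)] cr[OF x(2) ne(1,3)] cr[OF x(3) ne(2,3)] hl by blast
  qed
  have sp: "set p \<subseteq> ?S" and sq: "set q \<subseteq> ?S" and sr: "set r \<subseteq> ?S" by auto
  have "prism H"
    unfolding prism_def
  proof (rule exI[of _ p], rule exI[of _ q], rule exI[of _ r], intro conjI)
    show "is_path H p" unfolding H_def by (rule cpath_is_path[OF c(1) ne(1) _ V]) blast
    show "is_path H q" unfolding H_def by (rule cpath_is_path[OF c(2) ne(2) _ V]) blast
    show "is_path H r" unfolding H_def by (rule cpath_is_path[OF c(3) ne(3) _ V]) blast
    show "1 \<le> path_length p" "1 \<le> path_length q" "1 \<le> path_length r" using l unfolding path_length_def by auto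
    show "verts H = ?S" unfolding H_def induced_def by simp
    show "set p \<inter> set q = {}" "set p \<inter> set r = {}" "set q \<inter> set r = {}" using X[OF x(1)] X[OF x(2)] X[OF x(3)] by blast+
    show "edges H = edges (induced H (set p)) \<union> edges (induced H (set q)) \<union> edges (induced H (set r)) \<union>
       {{hd p, hd q}, {hd p, hd r}, {hd q, hd r}} \<union> {{last p, last q}, {last p, last r}, {last q, last r}}"
      unfolding eH sub[OF sp] sub[OF sq] sub[OF sr] by (rule refl)
  qed
  then show False using no_contained[OF V H_def] by blast
qed

lemma artemis_adj: "artemis_adj adj"
  by unfold_locales (fact symp_adj irreflp_adj chole_even_adj antihole_short prism_free)+

lemma quasi_prism_lists_of:
  assumes S: "S \<subseteq> verts G" and q: "quasi_prism (induced G S) s1 s2 s3 s4"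
  shows "artemis_adj.quasi_prism_lists adj s1 s2 s3 s4" "set s1 \<union> set s2 \<union> set s3 \<union> set s4 = S"
proof -
  interpret a: artemis_adj adj by (rule artemis_adj)
  let ?H = "induced G S"
  have vS: "set s1 \<union> set s2 \<union> set s3 \<union> set s4 = S" using q unfolding quasi_prism_def induced_def by auto
  then show "set s1 \<union> set s2 \<union> set s3 \<union> set s4 = S" .
  have p: "is_path ?H s1" "is_path ?H s2" "is_path ?H s3" "is_path ?H s4" using q unfolding quasi_prism_def by blast+
  have dj: "set s1 \<inter> set s2 = {}" "set s1 \<inter> set s3 = {}" "set s1 \<inter> set s4 = {}"
     "set s2 \<inter> set s3 = {}" "set s2 \<inter> set s4 = {}" "set s3 \<inter> set s4 = {}" using q unfolding quasi_prism_def by blast+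
  have ne: "s1 \<noteq> []" "s2 \<noteq> []" "s3 \<noteq> []" "s4 \<noteq> []" using is_path_cpath(2) p by blast+
  have cp: "cpath adj s" if "is_path ?H s" "set s \<subseteq> S" for s
  proof -
    have "cpath (\<lambda>u v. {u, v} \<in> edges ?H) s" using is_path_cpath(1)[OF that(1)] .
    moreover have "{u, v} \<in> edges ?H \<longleftrightarrow> adj u v" if "u \<in> set s" "v \<in> set s" for u v
      using that \<open>set s \<subseteq> S\<close> unfolding induced_def by auto
    ultimately show ?thesis using cpath_cong[of s "\<lambda>u v. {u, v} \<in> edges ?H" adj] by blast
  qed
  define P where "P = {{last s1, hd s3}, {last s1, hd s4}, {hd s3, hd s4}, {last s2, last s3}, {last s2, last s4}, {last s3, last s4}}"
  have eq: "edges ?H = edges (induced ?H (set s1)) \<union> edges (induced ?H (set s2)) \<union>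
       edges (induced ?H (set s3)) \<union> edges (induced ?H (set s4)) \<union> P"
    using q unfolding quasi_prism_def P_def by - (elim conjE, assumption)
  have hl: "last s1 \<in> set s1" "last s2 \<in> set s2" "hd s3 \<in> set s3" "last s3 \<in> set s3" "hd s4 \<in> set s4" "last s4 \<in> set s4"
    using ne by auto
  \<comment> \<open>Between different paths only the six edges of the two triangles are
    left.\<close>
  have key: "adj u v \<longleftrightarrow> {u, v} \<in> P"
    if uv: "u \<in> S" "v \<in> S" "\<And>s. s \<in> {s1, s2, s3, s4} \<Longrightarrow> \<not> (u \<in> set s \<and> v \<in> set s)" for u v
  proof -
    have "adj u v \<longleftrightarrow> {u, v} \<in> edges ?H" using uv(1,2) unfolding induced_def by auto
    moreover have "{u, v} \<notin> edges (induced ?H (set s))" if "s \<in> {s1, s2, s3, s4}" for s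
      using uv(3)[OF that] unfolding induced_def by auto
    ultimately show ?thesis using eq by blast
  qed
  have P_iff: "{u, v} \<in> P \<longleftrightarrow> (u = last s1 \<and> v = hd s3 \<or> u = hd s3 \<and> v = last s1) \<or> (u = last s1 \<and> v = hd s4 \<or> u = hd s4 \<and> v = last s1) \<or>
     (u = hd s3 \<and> v = hd s4 \<or> u = hd s4 \<and> v = hd s3) \<or> (u = last s2 \<and> v = last s3 \<or> u = last s3 \<and> v = last s2) \<or>
     (u = last s2 \<and> v = last s4 \<or> u = last s4 \<and> v = last s2) \<or> (u = last s3 \<and> v = last s4 \<or> u = last s4 \<and> v = last s3)" for u v
    unfolding P_def by (simp add: doubleton_eq_iff)
  show "a.quasi_prism_lists s1 s2 s3 s4"
    unfolding a.quasi_prism_lists_def cross_def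
  proof (intro conjI)
    show "cpath adj s1" "cpath adj s2" "cpath adj s3" "cpath adj s4" using cp p vS by auto
    show "s1 \<noteq> []" "s2 \<noteq> []" by (fact ne)+
    show "2 \<le> length s3" "2 \<le> length s4" using q unfolding quasi_prism_def path_length_def by auto
    show "\<forall>u\<in>set s1. \<forall>v\<in>set s2. u \<noteq> v \<and> \<not> adj u v"
    proof (intro ballI)
      fix u v assume uv: "u \<in> set s1" "v \<in> set s2"
      have "adj u v \<longleftrightarrow> {u, v} \<in> P" by (rule key) (use uv dj vS in auto)
      moreover have "\<not> {u, v} \<in> P" unfolding P_iff using uv dj hl by blast
      ultimately show "u \<noteq> v \<and> \<not> adj u v" using uv dj by blast
    qed
    show "\<forall>u\<in>set s1. \<forall>v\<in>set s3. u \<noteq> v \<and> (adj u v \<longleftrightarrow> u = last s1 \<and> v = hd s3)"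
    proof (intro ballI)
      fix u v assume uv: "u \<in> set s1" "v \<in> set s3"
      have "adj u v \<longleftrightarrow> {u, v} \<in> P" by (rule key) (use uv dj vS in auto)
      moreover have "{u, v} \<in> P \<longleftrightarrow> u = last s1 \<and> v = hd s3" unfolding P_iff using uv dj hl by blast
      ultimately show "u \<noteq> v \<and> (adj u v \<longleftrightarrow> u = last s1 \<and> v = hd s3)" using uv dj by blast
    qed
    show "\<forall>u\<in>set s1. \<forall>v\<in>set s4. u \<noteq> v \<and> (adj u v \<longleftrightarrow> u = last s1 \<and> v = hd s4)"
    proof (intro ballI)
      fix u v assume uv: "u \<in> set s1" "v \<in> set s4"
      have "adj u v \<longleftrightarrow> {u, v} \<in> P" by (rule key) (use uv dj vS in auto)
      moreover have "{u, v} \<in> P \<longleftrightarrow> u = last s1 \<and> v = hd s4" unfolding P_iff using uv dj hl by blast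
      ultimately show "u \<noteq> v \<and> (adj u v \<longleftrightarrow> u = last s1 \<and> v = hd s4)" using uv dj by blast
    qed
    show "\<forall>u\<in>set s2. \<forall>v\<in>set s3. u \<noteq> v \<and> (adj u v \<longleftrightarrow> u = last s2 \<and> v = last s3)"
    proof (intro ballI)
      fix u v assume uv: "u \<in> set s2" "v \<in> set s3"
      have "adj u v \<longleftrightarrow> {u, v} \<in> P" by (rule key) (use uv dj vS in auto)
      moreover have "{u, v} \<in> P \<longleftrightarrow> u = last s2 \<and> v = last s3" unfolding P_iff using uv dj hl by blast
      ultimately show "u \<noteq> v \<and> (adj u v \<longleftrightarrow> u = last s2 \<and> v = last s3)" using uv dj by blast
    qed
    show "\<forall>u\<in>set s2. \<forall>v\<in>set s4. u \<noteq> v \<and> (adj u v \<longleftrightarrow> u = last s2 \<and> v = last s4)"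
    proof (intro ballI)
      fix u v assume uv: "u \<in> set s2" "v \<in> set s4"
      have "adj u v \<longleftrightarrow> {u, v} \<in> P" by (rule key) (use uv dj vS in auto)
      moreover have "{u, v} \<in> P \<longleftrightarrow> u = last s2 \<and> v = last s4" unfolding P_iff using uv dj hl by blast
      ultimately show "u \<noteq> v \<and> (adj u v \<longleftrightarrow> u = last s2 \<and> v = last s4)" using uv dj by blast
    qed
    show "\<forall>u\<in>set s3. \<forall>v\<in>set s4. u \<noteq> v \<and> (adj u v \<longleftrightarrow> u = hd s3 \<and> v = hd s4 \<or> u = last s3 \<and> v = last s4)"
    proof (intro ballI)
      fix u v assume uv: "u \<in> set s3" "v \<in> set s4"
      have "adj u v \<longleftrightarrow> {u, v} \<in> P" by (rule key) (use uv dj vS in auto)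
      moreover have "v \<noteq> hd s3" "v \<noteq> last s3" "u \<noteq> last s1" "v \<noteq> last s1" "u \<noteq> last s2" "v \<noteq> last s2"
        using uv dj hl by blast+
      then have "{u, v} \<in> P \<longleftrightarrow> u = hd s3 \<and> v = hd s4 \<or> u = last s3 \<and> v = last s4" unfolding P_iff by simp
      ultimately show "u \<noteq> v \<and> (adj u v \<longleftrightarrow> u = hd s3 \<and> v = hd s4 \<or> u = last s3 \<and> v = last s4)" using uv dj by blast
    qed
  qed
qed

lemma special_even_pair_of:
  assumes sp: "artemis_adj.special_in adj (verts G) a b"
  shows "special_even_pair G a b"
proof -
  interpret ad: artemis_adj adj by (rule artemis_adj)
  have "even_pair G a b"
    unfolding even_pair_def
  proof (intro conjI allI impI)
    show "a \<in> verts G" "b \<in> verts G" "a \<noteq> b" using sp unfolding ad.special_in_def by blast+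
    fix p assume p: "is_path G p \<and> hd p = a \<and> last p = b"
    then have "odd (length p)" using sp is_path_cpath[of G p] unfolding ad.special_in_def by blast
    then show "even (path_length p)" unfolding path_length_def by simp
  qed
  moreover have "\<not> strict_quasi_prism (induced G S) a b" if S: "S \<subseteq> verts G" for S
  proof
    assume "strict_quasi_prism (induced G S) a b"
    then obtain s1 s2 s3 s4 where q: "quasi_prism (induced G S) s1 s2 s3 s4" "hd s1 = a" "hd s2 = b"
      "path_length s1 \<ge> 1 \<or> path_length s2 \<ge> 1" unfolding strict_quasi_prism_def by blast
    have "2 \<le> length s1 \<or> 2 \<le> length s2" using q(4) unfolding path_length_def by auto
    then show False using quasi_prism_lists_of[OF S q(1)] q(2,3) S sp unfolding ad.special_in_def by blast
  qed
  ultimately show ?thesis unfolding special_even_pair_def by blast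
qed

end

end

theorem mainTheorem1:
  fixes G :: "'a ugraph" and T :: "'a set"
  assumes "simple_graph G"
    and "artemis G"
    and "interesting G T"
  shows "\<exists>a \<in> common_nbrs G T. \<exists>b \<in> common_nbrs G T. special_even_pair G a b"
proof -
  let ?E = "\<lambda>u v. {u, v} \<in> edges G"
  interpret ad: artemis_adj ?E by (rule artemis_adj[OF assms(1,2)])
  have T: "T \<subseteq> verts G" "T \<noteq> {}" "anticonnected (induced G T)" "\<not> clique (induced G (common_nbrs G T))"
    using assms(3) unfolding interesting_def by blast+
  have C: "common_nbrs G T = ad.common (verts G) T"
    unfolding common_nbrs_def ad.common_def ad.complete_to_def ..
  obtain x y where xy: "x \<in> common_nbrs G T" "y \<in> common_nbrs G T" "x \<noteq> y" "\<not> ?E x y"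
    using T(4) unfolding clique_def induced_def by auto
  have fin: "finite (verts G)" using assms(1) unfolding simple_graph_def by blast
  obtain a b where "a \<in> common_nbrs G T" "b \<in> common_nbrs G T" "ad.special_in (verts G) a b"
    using ad.special_pair_exists[OF fin T(1,2) anticonnected_conn[OF assms(1) T(3)]] xy unfolding C by blast
  then show ?thesis using special_even_pair_of[OF assms(1,2)] by blast
qed

end
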